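(* Let $D_8=\langle a,b\mid a^4=1=b^2,\ b^{-1}ab=a^{-1}\rangle$ and, for $i\ge1$, let $U_i=\{1+2^iu\mid u\in\mathbb{Z}[D_8]\}\cap\mathcal{U}(\mathbb{Z}[D_8])$. The following hold: (1) $\mathcal{U}(\mathbb{Z}[D_8])\cong F_3\rtimes(\pm D_8)$ with $F_3$ generated by bicyclic units; (2) $U_1\cong F_9\times C_2$; (3) $U_i\cong F_{n_i}$ with $n_i=1+8^i$ for $i\ge2$; (4) $\pm D_8\times C_2^n$ has a torsion-free normal complement in $\mathcal{U}(\mathbb{Z}[D_8\times C_2^n])$.
   Context: $\mathcal{U}(\cdot)$ is the unit group and $F_n$ the free group of rank $n$. Bicyclic units of $\mathbb{Z}G$ are the units $1+(1-h)g\widetilde{h}$ and $1+\widetilde{h}g(1-h)$, $g,h\in G$, where $\widetilde{h}=\sum_{j=1}^{o(h)}h^j$. In (4), $C_2^n$ is the elementary abelian $2$-group of rank $n$, and a torsion-free normal complement of the group $\pm(D_8\times C_2^n)$ of trivial units is a torsion-free normal subgroup $M$ with $\mathcal{U}(\mathbb{Z}[D_8\times C_2^n])=M\rtimes(\pm(D_8\times C_2^n))$. *)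

theory Defs
  imports "HOL-Algebra.Algebra"
begin

section \<open>Free groups and presentations\<close>

text \<open>The letter \<open>(x, True)\<close> stands for the generator \<open>x\<close> and \<open>(x, False)\<close> for its inverse.
  The elements of the free group are the freely reduced words.\<close>

type_synonym 'a letter = "'a \<times> bool"

definition inv_letter :: "'a letter \<Rightarrow> 'a letter" where
  "inv_letter p = (fst p, \<not> snd p)"

definition reduced :: "'a letter list \<Rightarrow> bool" where
  "reduced = successively (\<lambda>p q. q \<noteq> inv_letter p)"

fun rcons :: "'a letter \<Rightarrow> 'a letter list \<Rightarrow> 'a letter list" where
  "rcons p [] = [p]"
| "rcons p (q # w) = (if q = inv_letter p then w else p # q # w)"

definition free_group :: "'a set \<Rightarrow> 'a letter list monoid" where
  "free_group A = \<lparr>carrier = {w. reduced w \<and> fst ` set w \<subseteq> A}, monoid.mult = foldr rcons, one = []\<rparr>"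

text \<open>\<open>E\<close> is a set of defining relations; the pair \<open>(u, v)\<close> is the relation \<open>u = v\<close>.\<close>

definition relators_closure :: "'a set \<Rightarrow> ('a letter list \<times> 'a letter list) set \<Rightarrow> 'a letter list set"
  where "relators_closure A E =
    (let F = free_group A in generate F
      {g \<otimes>\<^bsub>F\<^esub> (u \<otimes>\<^bsub>F\<^esub> inv\<^bsub>F\<^esub> v) \<otimes>\<^bsub>F\<^esub> inv\<^bsub>F\<^esub> g | g u v. g \<in> carrier F \<and> (u, v) \<in> E})"

definition presented_group ::
  "'a set \<Rightarrow> ('a letter list \<times> 'a letter list) set \<Rightarrow> 'a letter list set monoid" where
  "presented_group A E = free_group A Mod relators_closure A E"

datatype dihedral_gen = gen_a | gen_b

definition D8 :: "dihedral_gen letter list set monoid" where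
  "D8 = (let F = free_group UNIV; a = [(gen_a, True)]; b = [(gen_b, True)] in
     presented_group UNIV
       {(a [^]\<^bsub>F\<^esub> (4::nat), \<one>\<^bsub>F\<^esub>), (b [^]\<^bsub>F\<^esub> (2::nat), \<one>\<^bsub>F\<^esub>),
        (inv\<^bsub>F\<^esub> b \<otimes>\<^bsub>F\<^esub> a \<otimes>\<^bsub>F\<^esub> b, inv\<^bsub>F\<^esub> a)})"

definition C2_power :: "nat \<Rightarrow> (nat \<Rightarrow> int) monoid" where
  "C2_power n = product_group {..<n} (\<lambda>_. integer_mod_group 2)"

section \<open>Complements\<close>

definition internal_semidirect :: "('a, 'b) monoid_scheme \<Rightarrow> 'a set \<Rightarrow> 'a set \<Rightarrow> bool" where
  "internal_semidirect G N H \<longleftrightarrow>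
     N \<lhd> G \<and> subgroup H G \<and> N \<inter> H = {\<one>\<^bsub>G\<^esub>} \<and> N <#>\<^bsub>G\<^esub> H = carrier G"

definition torsion_free_set :: "('a, 'b) monoid_scheme \<Rightarrow> 'a set \<Rightarrow> bool" where
  "torsion_free_set G M \<longleftrightarrow>
     (\<forall>x\<in>M. \<forall>k::nat. k > 0 \<longrightarrow> x [^]\<^bsub>G\<^esub> k = \<one>\<^bsub>G\<^esub> \<longrightarrow> x = \<one>\<^bsub>G\<^esub>)"

section \<open>Integral group rings\<close>

definition supp :: "('a \<Rightarrow> int) \<Rightarrow> 'a set" where
  "supp f = {x. f x \<noteq> 0}"

definition elt :: "'a \<Rightarrow> 'a \<Rightarrow> int" where
  "elt g = (\<lambda>x. if x = g then 1 else 0)"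

definition group_ring :: "('a, 'b) monoid_scheme \<Rightarrow> ('a \<Rightarrow> int) ring" where
  "group_ring G =
    \<lparr>carrier = {f. finite (supp f) \<and> supp f \<subseteq> carrier G},
     monoid.mult = (\<lambda>f g x. \<Sum>y\<in>supp f. \<Sum>z\<in>supp g. if y \<otimes>\<^bsub>G\<^esub> z = x then f y * g z else 0),
     one = elt \<one>\<^bsub>G\<^esub>,
     ring.zero = (\<lambda>x. 0),
     ring.add = (\<lambda>f g x. f x + g x)\<rparr>"

abbreviation unit_group :: "('a, 'b) monoid_scheme \<Rightarrow> ('a \<Rightarrow> int) monoid" where
  "unit_group G \<equiv> units_of (group_ring G)"

definition trivial_units :: "('a, 'b) monoid_scheme \<Rightarrow> ('a \<Rightarrow> int) set" where
  "trivial_units G = elt ` carrier G \<union> (\<lambda>g. \<ominus>\<^bsub>group_ring G\<^esub> elt g) ` carrier G"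

text \<open>Only meaningful for \<open>h\<close> of finite order: \<open>group.ord\<close> is \<open>0\<close> otherwise.\<close>

definition tilde :: "('a, 'b) monoid_scheme \<Rightarrow> 'a \<Rightarrow> 'a \<Rightarrow> int" where
  "tilde G h = (\<Oplus>\<^bsub>group_ring G\<^esub>j\<in>{1..group.ord G h}. elt (h [^]\<^bsub>G\<^esub> j))"

definition bicyclic_units :: "('a, 'b) monoid_scheme \<Rightarrow> ('a \<Rightarrow> int) set" where
  "bicyclic_units G = (let R = group_ring G in
     {\<one>\<^bsub>R\<^esub> \<oplus>\<^bsub>R\<^esub> (\<one>\<^bsub>R\<^esub> \<ominus>\<^bsub>R\<^esub> elt h) \<otimes>\<^bsub>R\<^esub> elt g \<otimes>\<^bsub>R\<^esub> tilde G h | g h. g \<in> carrier G \<and> h \<in> carrier G} \<union>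
     {\<one>\<^bsub>R\<^esub> \<oplus>\<^bsub>R\<^esub> tilde G h \<otimes>\<^bsub>R\<^esub> elt g \<otimes>\<^bsub>R\<^esub> (\<one>\<^bsub>R\<^esub> \<ominus>\<^bsub>R\<^esub> elt h) | g h. g \<in> carrier G \<and> h \<in> carrier G})"

definition cong_units :: "('a, 'b) monoid_scheme \<Rightarrow> nat \<Rightarrow> ('a \<Rightarrow> int) set" where
  "cong_units G i = (let R = group_ring G in
     {\<one>\<^bsub>R\<^esub> \<oplus>\<^bsub>R\<^esub> add_pow R ((2::nat) ^ i) u | u. u \<in> carrier R} \<inter> Units R)"

abbreviation cong_unit_group :: "('a, 'b) monoid_scheme \<Rightarrow> nat \<Rightarrow> ('a \<Rightarrow> int) monoid" where
  "cong_unit_group G i \<equiv> (unit_group G)\<lparr>carrier := cong_units G i\<rparr>"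

section \<open>The structures above are groups and rings\<close>

lemma inv_letter_inv_letter [simp]: "inv_letter (inv_letter p) = p"
  by (simp add: inv_letter_def)

lemma inv_letter_neq [simp]: "inv_letter p \<noteq> p" "p \<noteq> inv_letter p"
  by (simp_all add: inv_letter_def prod_eq_iff)

lemma fst_inv_letter [simp]: "fst (inv_letter p) = fst p"
  by (simp add: inv_letter_def)

lemma reduced_Nil [simp]: "reduced []"
  by (simp add: reduced_def)

lemma reduced_Cons:
  "reduced (p # w) \<longleftrightarrow> reduced w \<and> (w = [] \<or> hd w \<noteq> inv_letter p)"
  by (cases w) (auto simp: reduced_def)

lemma reduced_rcons: "reduced w \<Longrightarrow> reduced (rcons p w)"
  by (cases w) (auto simp: reduced_Cons)

lemma reduced_foldr_rcons: "reduced w \<Longrightarrow> reduced (foldr rcons v w)"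
  by (induction v) (auto simp: reduced_rcons)

lemma rcons_cancel: "reduced w \<Longrightarrow> rcons p (rcons (inv_letter p) w) = w"
proof (cases w)
  case (Cons q v)
  assume "reduced w"
  then show ?thesis
    using Cons by (cases v) (auto simp: reduced_Cons)
qed simp

lemma foldr_rcons_rcons:
  assumes "reduced w"
  shows "foldr rcons (rcons p v) w = rcons p (foldr rcons v w)"
proof (cases v)
  case (Cons q u)
  show ?thesis
    using Cons rcons_cancel[OF reduced_foldr_rcons[OF assms], of p u] by auto
qed simp

lemma foldr_rcons_assoc:
  "reduced w \<Longrightarrow> foldr rcons (foldr rcons u v) w = foldr rcons u (foldr rcons v w)"
  by (induction u) (auto simp: foldr_rcons_rcons)

lemma foldr_rcons_Nil: "reduced w \<Longrightarrow> foldr rcons w [] = w"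
proof (induction w)
  case (Cons p w)
  then show ?case by (cases w) (auto simp: reduced_Cons)
qed simp

lemma set_foldr_rcons: "set (foldr rcons v w) \<subseteq> set v \<union> set w"
proof (induction v)
  case (Cons p v)
  have "set (rcons p u) \<subseteq> insert p (set u)" for u by (cases u) auto
  then show ?case using Cons by fastforce
qed simp

lemma foldr_rcons_inverse:
  "reduced w \<Longrightarrow> foldr rcons (map inv_letter (rev v) @ v) w = w"
proof (induction v arbitrary: w)
  case (Cons p v)
  have "rcons (inv_letter p) (rcons p (foldr rcons v w)) = foldr rcons v w"
    using rcons_cancel[OF reduced_foldr_rcons[OF Cons.prems], of "inv_letter p" v] by simp
  then show ?case using Cons by simp
qed simp

lemma group_free_group: "group (free_group A)"
proof (rule groupI)
  let ?F = "free_group A"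
  fix v w assume v: "v \<in> carrier ?F" and w: "w \<in> carrier ?F"
  show "v \<otimes>\<^bsub>?F\<^esub> w \<in> carrier ?F"
  proof -
    have "fst ` set (foldr rcons v w) \<subseteq> fst ` set v \<union> fst ` set w"
      unfolding image_Un[symmetric] by (rule image_mono[OF set_foldr_rcons])
    also have "\<dots> \<subseteq> A" using v w by (simp add: free_group_def)
    finally show ?thesis using w by (simp add: free_group_def reduced_foldr_rcons)
  qed
next
  let ?F = "free_group A"
  show "\<one>\<^bsub>?F\<^esub> \<in> carrier ?F" by (simp add: free_group_def)
next
  let ?F = "free_group A"
  fix u v w assume "u \<in> carrier ?F" "v \<in> carrier ?F" "w \<in> carrier ?F"
  then show "u \<otimes>\<^bsub>?F\<^esub> v \<otimes>\<^bsub>?F\<^esub> w = u \<otimes>\<^bsub>?F\<^esub> (v \<otimes>\<^bsub>?F\<^esub> w)"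
    by (simp add: free_group_def foldr_rcons_assoc)
next
  let ?F = "free_group A"
  fix w assume "w \<in> carrier ?F"
  then show "\<one>\<^bsub>?F\<^esub> \<otimes>\<^bsub>?F\<^esub> w = w" by (simp add: free_group_def)
next
  let ?F = "free_group A"
  fix w assume w: "w \<in> carrier ?F"
  define v where "v = foldr rcons (map inv_letter (rev w)) []"
  have "fst ` set v \<subseteq> fst ` set (map inv_letter (rev w))"
    unfolding v_def using set_foldr_rcons[of "map inv_letter (rev w)" "[]"]
    by (intro image_mono) simp
  also have "\<dots> = fst ` set w" by (simp add: image_image)
  also have "fst ` set w \<subseteq> A" using w by (simp add: free_group_def)
  finally have "v \<in> carrier ?F" by (simp add: free_group_def v_def reduced_foldr_rcons)
  moreover have "v \<otimes>\<^bsub>?F\<^esub> w = \<one>\<^bsub>?F\<^esub>"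
  proof -
    have r: "reduced w" using w by (simp add: free_group_def)
    have "foldr rcons v w = foldr rcons (map inv_letter (rev w)) (foldr rcons [] w)"
      unfolding v_def by (rule foldr_rcons_assoc[OF r])
    also have "\<dots> = foldr rcons (map inv_letter (rev w) @ w) []"
      by (simp add: foldr_rcons_Nil[OF r])
    also have "\<dots> = []" by (rule foldr_rcons_inverse) simp
    finally show ?thesis by (simp add: free_group_def)
  qed
  ultimately show "\<exists>v\<in>carrier ?F. v \<otimes>\<^bsub>?F\<^esub> w = \<one>\<^bsub>?F\<^esub>" by blast
qed

lemma relators_closure_normal:
  assumes "E \<subseteq> carrier (free_group A) \<times> carrier (free_group A)"
  shows "relators_closure A E \<lhd> free_group A"
proof -
  define F where "F = free_group A"
  interpret F: group F unfolding F_def by (rule group_free_group)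
  let ?R = "{g \<otimes>\<^bsub>F\<^esub> (u \<otimes>\<^bsub>F\<^esub> inv\<^bsub>F\<^esub> v) \<otimes>\<^bsub>F\<^esub> inv\<^bsub>F\<^esub> g | g u v. g \<in> carrier F \<and> (u, v) \<in> E}"
  have E: "u \<in> carrier F" "v \<in> carrier F" if "(u, v) \<in> E" for u v
    using assms that by (auto simp: F_def)
  have "generate F ?R \<lhd> F"
  proof (rule F.normal_generateI)
    show "?R \<subseteq> carrier F" using E by auto
  next
    fix h g assume "h \<in> ?R" and g: "g \<in> carrier F"
    then obtain k u v where h: "h = k \<otimes>\<^bsub>F\<^esub> (u \<otimes>\<^bsub>F\<^esub> inv\<^bsub>F\<^esub> v) \<otimes>\<^bsub>F\<^esub> inv\<^bsub>F\<^esub> k"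
      and k: "k \<in> carrier F" and uv: "(u, v) \<in> E" by blast
    have "g \<otimes>\<^bsub>F\<^esub> h \<otimes>\<^bsub>F\<^esub> inv\<^bsub>F\<^esub> g =
        (g \<otimes>\<^bsub>F\<^esub> k) \<otimes>\<^bsub>F\<^esub> (u \<otimes>\<^bsub>F\<^esub> inv\<^bsub>F\<^esub> v) \<otimes>\<^bsub>F\<^esub> inv\<^bsub>F\<^esub> (g \<otimes>\<^bsub>F\<^esub> k)"
      using g k E[OF uv] by (simp add: h F.m_assoc F.inv_mult_group)
    moreover have "g \<otimes>\<^bsub>F\<^esub> k \<in> carrier F" using g k by simp
    ultimately show "g \<otimes>\<^bsub>F\<^esub> h \<otimes>\<^bsub>F\<^esub> inv\<^bsub>F\<^esub> g \<in> ?R" using uv by blast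
  qed
  then show ?thesis by (simp add: relators_closure_def Let_def F_def)
qed

lemma group_D8: "group D8"
proof -
  interpret F: group "free_group (UNIV :: dihedral_gen set)" by (rule group_free_group)
  have gen: "[(x, True)] \<in> carrier (free_group UNIV)" for x :: dihedral_gen
    by (simp add: free_group_def reduced_def)
  show ?thesis
    unfolding D8_def Let_def presented_group_def
    by (intro normal.factorgroup_is_group relators_closure_normal) (auto simp: gen)
qed

lemma group_C2_power: "group (C2_power n)"
  by (simp add: C2_power_def)

lemma group_ring_simps:
  "f \<in> carrier (group_ring G) \<longleftrightarrow> finite (supp f) \<and> supp f \<subseteq> carrier G"
  "\<one>\<^bsub>group_ring G\<^esub> = elt \<one>\<^bsub>G\<^esub>"
  "\<zero>\<^bsub>group_ring G\<^esub> = (\<lambda>x. 0)"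
  "f \<oplus>\<^bsub>group_ring G\<^esub> g = (\<lambda>x. f x + g x)"
  by (simp_all add: group_ring_def)

lemma group_ring_mult:
  assumes "finite A" "supp f \<subseteq> A" "finite B" "supp g \<subseteq> B"
  shows "(f \<otimes>\<^bsub>group_ring G\<^esub> g) x = (\<Sum>y\<in>A. \<Sum>z\<in>B. if y \<otimes>\<^bsub>G\<^esub> z = x then f y * g z else 0)"
proof -
  have "(\<Sum>y\<in>supp f. \<Sum>z\<in>supp g. if y \<otimes>\<^bsub>G\<^esub> z = x then f y * g z else 0)
      = (\<Sum>y\<in>A. \<Sum>z\<in>supp g. if y \<otimes>\<^bsub>G\<^esub> z = x then f y * g z else 0)"
    by (rule sum.mono_neutral_left) (use assms in \<open>auto simp: supp_def intro!: sum.neutral\<close>)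
  also have "\<dots> = (\<Sum>y\<in>A. \<Sum>z\<in>B. if y \<otimes>\<^bsub>G\<^esub> z = x then f y * g z else 0)"
    by (rule sum.cong[OF refl], rule sum.mono_neutral_left) (use assms in \<open>auto simp: supp_def\<close>)
  finally show ?thesis by (simp add: group_ring_def)
qed

lemma supp_group_ring_mult:
  "supp (f \<otimes>\<^bsub>group_ring G\<^esub> g) \<subseteq> (\<lambda>(y, z). y \<otimes>\<^bsub>G\<^esub> z) ` (supp f \<times> supp g)"
proof
  fix x assume "x \<in> supp (f \<otimes>\<^bsub>group_ring G\<^esub> g)"
  then have "(\<Sum>y\<in>supp f. \<Sum>z\<in>supp g. if y \<otimes>\<^bsub>G\<^esub> z = x then f y * g z else 0) \<noteq> 0"
    by (simp add: supp_def group_ring_def)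
  then obtain y where y: "y \<in> supp f"
    "(\<Sum>z\<in>supp g. if y \<otimes>\<^bsub>G\<^esub> z = x then f y * g z else 0) \<noteq> 0"
    by (rule sum.not_neutral_contains_not_neutral)
  from y(2) obtain z where "z \<in> supp g" "(if y \<otimes>\<^bsub>G\<^esub> z = x then f y * g z else 0) \<noteq> 0"
    by (rule sum.not_neutral_contains_not_neutral)
  then have "(y, z) \<in> supp f \<times> supp g" "y \<otimes>\<^bsub>G\<^esub> z = x"
    using y(1) by (simp_all split: if_splits)
  then show "x \<in> (\<lambda>(y, z). y \<otimes>\<^bsub>G\<^esub> z) ` (supp f \<times> supp g)"
    by (metis (no_types, lifting) case_prod_conv image_eqI)
qed

lemma supp_elt [simp]: "supp (elt g) = {g}"
  by (auto simp: supp_def elt_def)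

lemma elt_same [simp]: "elt g g = 1"
  by (simp add: elt_def)

lemma ring_group_ring:
  assumes "group G"
  shows "ring (group_ring G)"
proof -
  interpret G: group G by fact
  let ?R = "group_ring G"
  have mult_closed: "f \<otimes>\<^bsub>?R\<^esub> g \<in> carrier ?R" if "f \<in> carrier ?R" "g \<in> carrier ?R" for f g
  proof -
    have "(\<lambda>(y, z). y \<otimes>\<^bsub>G\<^esub> z) ` (supp f \<times> supp g) \<subseteq> carrier G"
      "finite ((\<lambda>(y, z). y \<otimes>\<^bsub>G\<^esub> z) ` (supp f \<times> supp g))"
      using that by (auto simp: group_ring_simps)
    then show ?thesis
      unfolding group_ring_simps(1) using supp_group_ring_mult[of G f g]
      by (meson finite_subset order_trans)
  qed
  have supp_add: "supp (\<lambda>x. f x + g x) \<subseteq> supp f \<union> supp g" for f g :: "'a \<Rightarrow> int"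
    by (auto simp: supp_def)
  have add_closed: "f \<oplus>\<^bsub>?R\<^esub> g \<in> carrier ?R" if "f \<in> carrier ?R" "g \<in> carrier ?R" for f g
  proof -
    have "finite (supp f \<union> supp g)" "supp f \<union> supp g \<subseteq> carrier G"
      using that by (auto simp: group_ring_simps)
    then show ?thesis
      unfolding group_ring_simps using supp_add[of f g] by (meson finite_subset order_trans)
  qed
  have assoc: "f \<otimes>\<^bsub>?R\<^esub> g \<otimes>\<^bsub>?R\<^esub> h = f \<otimes>\<^bsub>?R\<^esub> (g \<otimes>\<^bsub>?R\<^esub> h)"
    if f: "f \<in> carrier ?R" and g: "g \<in> carrier ?R" and h: "h \<in> carrier ?R" for f g h
  proof
    fix x
    let ?A = "supp f" and ?B = "supp g" and ?C = "supp h"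
    define W where "W = (\<lambda>(y, z). y \<otimes>\<^bsub>G\<^esub> z) ` (?A \<times> ?B)"
    define V where "V = (\<lambda>(y, z). y \<otimes>\<^bsub>G\<^esub> z) ` (?B \<times> ?C)"
    have fin: "finite ?A" "finite ?B" "finite ?C" "finite W" "finite V"
      using f g h by (auto simp: group_ring_simps W_def V_def)
    have sub: "?A \<subseteq> carrier G" "?B \<subseteq> carrier G" "?C \<subseteq> carrier G"
      using f g h by (auto simp: group_ring_simps)
    have sW: "supp (f \<otimes>\<^bsub>?R\<^esub> g) \<subseteq> W" and sV: "supp (g \<otimes>\<^bsub>?R\<^esub> h) \<subseteq> V"
      unfolding W_def V_def by (rule supp_group_ring_mult)+
    have "(f \<otimes>\<^bsub>?R\<^esub> g \<otimes>\<^bsub>?R\<^esub> h) x =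
        (\<Sum>w\<in>W. \<Sum>c\<in>?C. if w \<otimes>\<^bsub>G\<^esub> c = x then (f \<otimes>\<^bsub>?R\<^esub> g) w * h c else 0)"
      by (rule group_ring_mult) (use fin sW in auto)
    also have "\<dots> = (\<Sum>w\<in>W. \<Sum>c\<in>?C. \<Sum>a\<in>?A. \<Sum>b\<in>?B.
        if w = a \<otimes>\<^bsub>G\<^esub> b then if w \<otimes>\<^bsub>G\<^esub> c = x then f a * g b * h c else 0 else 0)"
      by (intro sum.cong refl)
        (auto simp: group_ring_def sum_distrib_right intro!: sum.cong sum.neutral)
    also have "\<dots> = (\<Sum>c\<in>?C. \<Sum>a\<in>?A. \<Sum>b\<in>?B. \<Sum>w\<in>W.
        if w = a \<otimes>\<^bsub>G\<^esub> b then if w \<otimes>\<^bsub>G\<^esub> c = x then f a * g b * h c else 0 else 0)"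
      by (subst sum.swap, rule sum.cong[OF refl], subst sum.swap, rule sum.cong[OF refl], rule sum.swap)
    also have "\<dots> = (\<Sum>c\<in>?C. \<Sum>a\<in>?A. \<Sum>b\<in>?B.
        if a \<otimes>\<^bsub>G\<^esub> b \<otimes>\<^bsub>G\<^esub> c = x then f a * g b * h c else 0)"
      using fin by (intro sum.cong refl) (auto simp: sum.delta W_def)
    also have "\<dots> = (\<Sum>a\<in>?A. \<Sum>c\<in>?C. \<Sum>b\<in>?B.
        if a \<otimes>\<^bsub>G\<^esub> b \<otimes>\<^bsub>G\<^esub> c = x then f a * g b * h c else 0)"
      by (rule sum.swap)
    also have "\<dots> = (\<Sum>a\<in>?A. \<Sum>b\<in>?B. \<Sum>c\<in>?C.
        if a \<otimes>\<^bsub>G\<^esub> b \<otimes>\<^bsub>G\<^esub> c = x then f a * g b * h c else 0)"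
      by (rule sum.cong[OF refl], rule sum.swap)
    also have "\<dots> = (\<Sum>a\<in>?A. \<Sum>b\<in>?B. \<Sum>c\<in>?C. \<Sum>v\<in>V.
        if v = b \<otimes>\<^bsub>G\<^esub> c then if a \<otimes>\<^bsub>G\<^esub> v = x then f a * g b * h c else 0 else 0)"
    proof (intro sum.cong refl)
      fix a b c assume abc: "a \<in> ?A" "b \<in> ?B" "c \<in> ?C"
      then have "b \<otimes>\<^bsub>G\<^esub> c \<in> V" by (auto simp: V_def)
      moreover have "a \<otimes>\<^bsub>G\<^esub> b \<otimes>\<^bsub>G\<^esub> c = a \<otimes>\<^bsub>G\<^esub> (b \<otimes>\<^bsub>G\<^esub> c)"
        using abc sub by (intro G.m_assoc) auto
      ultimately show "(if a \<otimes>\<^bsub>G\<^esub> b \<otimes>\<^bsub>G\<^esub> c = x then f a * g b * h c else 0) =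
        (\<Sum>v\<in>V. if v = b \<otimes>\<^bsub>G\<^esub> c then if a \<otimes>\<^bsub>G\<^esub> v = x then f a * g b * h c else 0 else 0)"
        using fin by (simp add: sum.delta)
    qed
    also have "\<dots> = (\<Sum>a\<in>?A. \<Sum>v\<in>V. \<Sum>b\<in>?B. \<Sum>c\<in>?C.
        if v = b \<otimes>\<^bsub>G\<^esub> c then if a \<otimes>\<^bsub>G\<^esub> v = x then f a * g b * h c else 0 else 0)"
      by (rule sum.cong[OF refl], rule trans[OF sum.cong[OF refl sum.swap] sum.swap])
    also have "\<dots> = (\<Sum>a\<in>?A. \<Sum>v\<in>V. if a \<otimes>\<^bsub>G\<^esub> v = x then f a * (g \<otimes>\<^bsub>?R\<^esub> h) v else 0)"
      by (intro sum.cong refl)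
        (auto simp: group_ring_def sum_distrib_left mult.assoc intro!: sum.cong sum.neutral)
    also have "\<dots> = (f \<otimes>\<^bsub>?R\<^esub> (g \<otimes>\<^bsub>?R\<^esub> h)) x"
      by (rule group_ring_mult[symmetric]) (use fin sV in auto)
    finally show "(f \<otimes>\<^bsub>?R\<^esub> g \<otimes>\<^bsub>?R\<^esub> h) x = (f \<otimes>\<^bsub>?R\<^esub> (g \<otimes>\<^bsub>?R\<^esub> h)) x" .
  qed
  show ?thesis
  proof (rule ringI)
    show "abelian_group ?R"
    proof (rule abelian_groupI)
      fix f assume f: "f \<in> carrier ?R"
      have "supp (\<lambda>x. - f x) = supp f" by (auto simp: supp_def)
      then show "\<exists>g\<in>carrier ?R. g \<oplus>\<^bsub>?R\<^esub> f = \<zero>\<^bsub>?R\<^esub>"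
        using f by (intro bexI[of _ "\<lambda>x. - f x"]) (auto simp: group_ring_simps)
    next
      show "\<zero>\<^bsub>?R\<^esub> \<in> carrier ?R" by (auto simp: group_ring_simps supp_def)
    next
      fix f g assume "f \<in> carrier ?R" "g \<in> carrier ?R"
      then show "f \<oplus>\<^bsub>?R\<^esub> g \<in> carrier ?R" by (rule add_closed)
    qed (simp_all add: group_ring_simps(2-4) add_ac)
  next
    show "monoid ?R"
    proof (rule monoidI)
      show "\<one>\<^bsub>?R\<^esub> \<in> carrier ?R" by (simp add: group_ring_simps)
    next
      fix f assume f: "f \<in> carrier ?R"
      then have fin: "finite (supp f)" and sub: "supp f \<subseteq> carrier G"
        by (auto simp: group_ring_simps)
      show "\<one>\<^bsub>?R\<^esub> \<otimes>\<^bsub>?R\<^esub> f = f"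
      proof
        fix x
        have "(\<one>\<^bsub>?R\<^esub> \<otimes>\<^bsub>?R\<^esub> f) x = (\<Sum>z\<in>supp f. if \<one>\<^bsub>G\<^esub> \<otimes>\<^bsub>G\<^esub> z = x then f z else 0)"
          by (simp add: group_ring_def cong: if_cong)
        also have "\<dots> = (\<Sum>z\<in>supp f. if z = x then f z else 0)"
          using sub by (intro sum.cong) auto
        also have "\<dots> = f x" using fin by (auto simp: sum.delta supp_def)
        finally show "(\<one>\<^bsub>?R\<^esub> \<otimes>\<^bsub>?R\<^esub> f) x = f x" .
      qed
      show "f \<otimes>\<^bsub>?R\<^esub> \<one>\<^bsub>?R\<^esub> = f"
      proof
        fix x
        have "(f \<otimes>\<^bsub>?R\<^esub> \<one>\<^bsub>?R\<^esub>) x = (\<Sum>z\<in>supp f. if z \<otimes>\<^bsub>G\<^esub> \<one>\<^bsub>G\<^esub> = x then f z else 0)"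
          by (simp add: group_ring_def cong: if_cong)
        also have "\<dots> = (\<Sum>z\<in>supp f. if z = x then f z else 0)"
          using sub by (intro sum.cong) auto
        also have "\<dots> = f x" using fin by (auto simp: sum.delta supp_def)
        finally show "(f \<otimes>\<^bsub>?R\<^esub> \<one>\<^bsub>?R\<^esub>) x = f x" .
      qed
    next
      fix f g assume "f \<in> carrier ?R" "g \<in> carrier ?R"
      then show "f \<otimes>\<^bsub>?R\<^esub> g \<in> carrier ?R" by (rule mult_closed)
    next
      fix f g h assume "f \<in> carrier ?R" "g \<in> carrier ?R" "h \<in> carrier ?R"
      then show "f \<otimes>\<^bsub>?R\<^esub> g \<otimes>\<^bsub>?R\<^esub> h = f \<otimes>\<^bsub>?R\<^esub> (g \<otimes>\<^bsub>?R\<^esub> h)" by (rule assoc)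
    qed
  next
    fix f g h assume f: "f \<in> carrier ?R" and g: "g \<in> carrier ?R" and h: "h \<in> carrier ?R"
    let ?A = "supp f \<union> supp g" and ?C = "supp h"
    have fin: "finite ?A" "finite ?C" using f g h by (auto simp: group_ring_simps)
    show "(f \<oplus>\<^bsub>?R\<^esub> g) \<otimes>\<^bsub>?R\<^esub> h = f \<otimes>\<^bsub>?R\<^esub> h \<oplus>\<^bsub>?R\<^esub> g \<otimes>\<^bsub>?R\<^esub> h"
    proof
      fix x
      have "((f \<oplus>\<^bsub>?R\<^esub> g) \<otimes>\<^bsub>?R\<^esub> h) x =
          (\<Sum>y\<in>?A. \<Sum>z\<in>?C. if y \<otimes>\<^bsub>G\<^esub> z = x then (f \<oplus>\<^bsub>?R\<^esub> g) y * h z else 0)"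
        using fin supp_add[of f g] by (intro group_ring_mult) (auto simp: group_ring_simps)
      also have "\<dots> = (\<Sum>y\<in>?A. \<Sum>z\<in>?C. if y \<otimes>\<^bsub>G\<^esub> z = x then f y * h z else 0)
          + (\<Sum>y\<in>?A. \<Sum>z\<in>?C. if y \<otimes>\<^bsub>G\<^esub> z = x then g y * h z else 0)"
        unfolding sum.distrib[symmetric]
        by (intro sum.cong refl) (simp add: group_ring_simps distrib_right)
      also have "\<dots> = (f \<otimes>\<^bsub>?R\<^esub> h) x + (g \<otimes>\<^bsub>?R\<^esub> h) x"
        using fin by (simp add: group_ring_mult[where A = ?A and B = ?C])
      finally show "((f \<oplus>\<^bsub>?R\<^esub> g) \<otimes>\<^bsub>?R\<^esub> h) x = (f \<otimes>\<^bsub>?R\<^esub> h \<oplus>\<^bsub>?R\<^esub> g \<otimes>\<^bsub>?R\<^esub> h) x"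
        by (simp add: group_ring_simps)
    qed
    show "h \<otimes>\<^bsub>?R\<^esub> (f \<oplus>\<^bsub>?R\<^esub> g) = h \<otimes>\<^bsub>?R\<^esub> f \<oplus>\<^bsub>?R\<^esub> h \<otimes>\<^bsub>?R\<^esub> g"
    proof
      fix x
      have "(h \<otimes>\<^bsub>?R\<^esub> (f \<oplus>\<^bsub>?R\<^esub> g)) x =
          (\<Sum>y\<in>?C. \<Sum>z\<in>?A. if y \<otimes>\<^bsub>G\<^esub> z = x then h y * (f \<oplus>\<^bsub>?R\<^esub> g) z else 0)"
        using fin supp_add[of f g] by (intro group_ring_mult) (auto simp: group_ring_simps)
      also have "\<dots> = (\<Sum>y\<in>?C. \<Sum>z\<in>?A. if y \<otimes>\<^bsub>G\<^esub> z = x then h y * f z else 0)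
          + (\<Sum>y\<in>?C. \<Sum>z\<in>?A. if y \<otimes>\<^bsub>G\<^esub> z = x then h y * g z else 0)"
        unfolding sum.distrib[symmetric]
        by (intro sum.cong refl) (simp add: group_ring_simps distrib_left)
      also have "\<dots> = (h \<otimes>\<^bsub>?R\<^esub> f) x + (h \<otimes>\<^bsub>?R\<^esub> g) x"
        using fin by (simp add: group_ring_mult[where A = ?C and B = ?A])
      finally show "(h \<otimes>\<^bsub>?R\<^esub> (f \<oplus>\<^bsub>?R\<^esub> g)) x = (h \<otimes>\<^bsub>?R\<^esub> f \<oplus>\<^bsub>?R\<^esub> h \<otimes>\<^bsub>?R\<^esub> g) x"
        by (simp add: group_ring_simps)
    qed
  qed
qed

lemma subgroup_cong_units:
  assumes "group G"
  shows "subgroup (cong_units G i) (unit_group G)"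
proof -
  define R where "R = group_ring G"
  interpret R: ring R unfolding R_def using assms by (rule ring_group_ring)
  interpret U: group "units_of R" by (rule R.units_group)
  define q where "q = (2::nat) ^ i"
  define C where "C = {\<one>\<^bsub>R\<^esub> \<oplus>\<^bsub>R\<^esub> add_pow R q u | u. u \<in> carrier R} \<inter> Units R"
  have C: "cong_units G i = C"
    by (simp add: cong_units_def C_def R_def q_def Let_def)
  have "subgroup C (units_of R)"
  proof (rule U.subgroupI)
    show "C \<subseteq> carrier (units_of R)" by (auto simp: C_def units_of_def)
    have "\<one>\<^bsub>R\<^esub> \<oplus>\<^bsub>R\<^esub> add_pow R q \<zero>\<^bsub>R\<^esub> = \<one>\<^bsub>R\<^esub>" by simp
    then have "\<one>\<^bsub>R\<^esub> \<in> C"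
      unfolding C_def by (auto intro!: exI[of _ "\<zero>\<^bsub>R\<^esub>"])
    then show "C \<noteq> {}" by blast
  next
    fix x assume "x \<in> C"
    then obtain u where u: "u \<in> carrier R" "x = \<one>\<^bsub>R\<^esub> \<oplus>\<^bsub>R\<^esub> add_pow R q u" and x: "x \<in> Units R"
      by (auto simp: C_def)
    define y where "y = inv\<^bsub>R\<^esub> x"
    have y: "y \<in> Units R" "y \<in> carrier R" using x by (auto simp: y_def)
    have "\<one>\<^bsub>R\<^esub> = x \<otimes>\<^bsub>R\<^esub> y" using x by (simp add: y_def)
    also have "\<dots> = y \<oplus>\<^bsub>R\<^esub> add_pow R q (u \<otimes>\<^bsub>R\<^esub> y)"
      using u y by (simp add: R.l_distr R.add_pow_ldistr)
    finally have e: "y \<oplus>\<^bsub>R\<^esub> add_pow R q (u \<otimes>\<^bsub>R\<^esub> y) = \<one>\<^bsub>R\<^esub>" by simp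
    have "add_pow R q (\<ominus>\<^bsub>R\<^esub> (u \<otimes>\<^bsub>R\<^esub> y)) = \<ominus>\<^bsub>R\<^esub> (add_pow R q (u \<otimes>\<^bsub>R\<^esub> y))"
      using u y by (metis R.add.nat_pow_inv R.m_closed)
    then have "y = \<one>\<^bsub>R\<^esub> \<oplus>\<^bsub>R\<^esub> add_pow R q (\<ominus>\<^bsub>R\<^esub> (u \<otimes>\<^bsub>R\<^esub> y))"
      using u y by (simp add: e[symmetric] R.a_assoc R.r_neg)
    then have "y \<in> C" unfolding C_def using u y by blast
    then show "inv\<^bsub>units_of R\<^esub> x \<in> C"
      using x by (simp add: y_def R.units_of_inv)
  next
    fix x y assume "x \<in> C" "y \<in> C"
    then obtain u v where u: "u \<in> carrier R" "x = \<one>\<^bsub>R\<^esub> \<oplus>\<^bsub>R\<^esub> add_pow R q u" "x \<in> Units R"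
      and v: "v \<in> carrier R" "y = \<one>\<^bsub>R\<^esub> \<oplus>\<^bsub>R\<^esub> add_pow R q v" "y \<in> Units R"
      by (auto simp: C_def)
    have yc: "y \<in> carrier R" using v by simp
    have "x \<otimes>\<^bsub>R\<^esub> y = y \<oplus>\<^bsub>R\<^esub> add_pow R q (u \<otimes>\<^bsub>R\<^esub> y)"
      using u(1) yc by (simp add: u(2) R.l_distr R.add_pow_ldistr)
    also have "\<dots> = \<one>\<^bsub>R\<^esub> \<oplus>\<^bsub>R\<^esub> (add_pow R q v \<oplus>\<^bsub>R\<^esub> add_pow R q (u \<otimes>\<^bsub>R\<^esub> y))"
      using u(1) v(1) yc by (subst v(2)) (simp add: R.a_assoc)
    also have "\<dots> = \<one>\<^bsub>R\<^esub> \<oplus>\<^bsub>R\<^esub> add_pow R q (v \<oplus>\<^bsub>R\<^esub> u \<otimes>\<^bsub>R\<^esub> y)"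
      using u(1) v(1) yc by (simp add: R.add.nat_pow_distrib)
    finally have "\<exists>w. x \<otimes>\<^bsub>R\<^esub> y = \<one>\<^bsub>R\<^esub> \<oplus>\<^bsub>R\<^esub> add_pow R q w \<and> w \<in> carrier R"
      using u(1) v(1) yc by blast
    then show "x \<otimes>\<^bsub>units_of R\<^esub> y \<in> C"
      using u(3) v(3) by (simp add: C_def units_of_def)
  qed
  then show ?thesis by (simp add: C R_def)
qed

end

theory Submission
  imports Defs
begin

text \<open>
  A unit of \<open>\<int>[D\<^sub>8]\<close> is determined by its images modulo \<open>a\<^sup>2 = 1\<close> and modulo \<open>a\<^sup>2 = -1\<close>. The first
  lies in \<open>\<int>[C\<^sub>2 \<times> C\<^sub>2]\<close>, where all units are trivial; the second is a quadruple \<open>(p, q, r, s)\<close> with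
  \<open>p\<^sup>2 + q\<^sup>2 - r\<^sup>2 - s\<^sup>2 = \<plusminus>1\<close>, that is, an integral \<open>2 \<times> 2\<close> matrix. Up to trivial units one is left with the
  quadruples of norm \<open>1\<close> such that \<open>p \<equiv> 1 (mod 4)\<close> and \<open>q, r, s\<close> are even. They are generated by three parabolic
  matrices (Euclidean descent on the first column), which come from bicyclic units and are free by
  ping-pong on the projective line.

  The group \<open>U\<^sub>i\<close> corresponds, up to sign if \<open>i = 1\<close>, to the quadruples congruent to \<open>(1, 0, 0, 0)\<close> modulo
  \<open>2\<^sup>i\<^sup>+\<^sup>1\<close>. These are reached through a chain of kernels of parity characters, two of them from level \<open>0\<close> to
  level \<open>1\<close> and three for every further level. Each kernel has index two, so that a free group of rank
  \<open>n + 1\<close> is replaced by one of rank \<open>2 n + 1\<close>, and the rank at level \<open>i\<close> is \<open>1 + 8\<^sup>i\<close>.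

  A complement for \<open>G\<close> extends to \<open>G \<times> C\<^sub>2\<close> because a torsion unit congruent to \<open>1\<close> modulo \<open>2\<close> is \<open>\<plusminus>1\<close>. For
  \<open>D\<^sub>8\<close> this holds because the off-scalar coordinates of a power are nonzero multiples of the
  original ones.
\<close>

section \<open>Evaluating words\<close>

text \<open>The two quotients are glued modulo 2: a pair of quadruples comes from Z[D_8] exactly
  when corresponding coordinates have equal parity. Units over 1 in the first quotient are therefore
  the quadruples of norm +-1 with p odd and q, r, s even, and such a norm is 1 because it is 1
  modulo 4. One of these units is a^2, whose second image is -1; so a sign has to be removed, and of
  x and -x exactly one has p congruent to 1 modulo 4. As p is half the trace, this choice is
  invariant under conjugation, which makes the complement normal.

  A unit over 1 has opposite coefficients at g and a^2 g, apart from the pair 1, a^2. Hence its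
  quadruple doubles its coefficients, and the modulus 2^i becomes 2^(i+1). From level 0 to level 1
  the norm equation forces the third parity, so rank minus one runs through 2, 8, 64 and so on: once
  a factor 4, then always 8.

  Ping-pong is phrased with integral quadratic forms, so that arcs and their images become
  polynomial identities and sign conditions over the integers.\<close>

definition letter_val :: "('b, 'c) monoid_scheme \<Rightarrow> ('a \<Rightarrow> 'b) \<Rightarrow> 'a letter \<Rightarrow> 'b" where
  "letter_val G f p = (if snd p then f (fst p) else inv\<^bsub>G\<^esub> f (fst p))"

definition word_val :: "('b, 'c) monoid_scheme \<Rightarrow> ('a \<Rightarrow> 'b) \<Rightarrow> 'a letter list \<Rightarrow> 'b" where
  "word_val G f w = foldr (\<lambda>p x. letter_val G f p \<otimes>\<^bsub>G\<^esub> x) w \<one>\<^bsub>G\<^esub>"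

lemma word_val_simps [simp]:
  "word_val G f [] = \<one>\<^bsub>G\<^esub>"
  "word_val G f (p # w) = letter_val G f p \<otimes>\<^bsub>G\<^esub> word_val G f w"
  by (simp_all add: word_val_def)

lemma free_group_carrier: "w \<in> carrier (free_group A) \<longleftrightarrow> reduced w \<and> fst ` set w \<subseteq> A"
  by (simp add: free_group_def)

lemma free_group_mult [simp]: "v \<otimes>\<^bsub>free_group A\<^esub> w = foldr rcons v w"
  by (simp add: free_group_def)

lemma free_group_one [simp]: "\<one>\<^bsub>free_group A\<^esub> = []"
  by (simp add: free_group_def)

lemma free_group_gen: "fst p \<in> A \<Longrightarrow> [p] \<in> carrier (free_group A)"
  by (simp add: free_group_carrier reduced_Cons)

lemma fst_set_foldr_rcons:
  assumes "fst ` set v \<subseteq> A" "fst ` set w \<subseteq> A"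
  shows "fst ` set (foldr rcons v w) \<subseteq> A"
  using image_mono[OF set_foldr_rcons, of fst v w] assms by (simp only: image_Un) blast

lemma free_group_inv_gen:
  assumes "x \<in> A"
  shows "inv\<^bsub>free_group A\<^esub> [(x, b)] = [(x, \<not> b)]"
proof -
  interpret F: group "free_group A" by (rule group_free_group)
  show ?thesis
    by (rule F.inv_equality) (use assms in \<open>auto intro!: free_group_gen simp: inv_letter_def\<close>)
qed

context group
begin

lemma letter_val_closed: "f ` A \<subseteq> carrier G \<Longrightarrow> fst p \<in> A \<Longrightarrow> letter_val G f p \<in> carrier G"
  by (auto simp: letter_val_def)

lemma word_val_closed:
  "f ` A \<subseteq> carrier G \<Longrightarrow> fst ` set w \<subseteq> A \<Longrightarrow> word_val G f w \<in> carrier G"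
  by (induction w) (auto intro!: letter_val_closed)

lemma letter_val_inv_letter:
  "f ` A \<subseteq> carrier G \<Longrightarrow> fst p \<in> A \<Longrightarrow>
    letter_val G f p \<otimes> letter_val G f (inv_letter p) = \<one>"
  by (auto simp: letter_val_def inv_letter_def)

lemma word_val_rcons:
  assumes f: "f ` A \<subseteq> carrier G" and "fst p \<in> A" "fst ` set w \<subseteq> A"
  shows "word_val G f (rcons p w) = letter_val G f p \<otimes> word_val G f w"
proof (cases w)
  case (Cons q v)
  have c: "letter_val G f p \<in> carrier G" "letter_val G f (inv_letter p) \<in> carrier G"
    "word_val G f v \<in> carrier G"
    using assms Cons by (auto intro!: letter_val_closed[OF f] word_val_closed[OF f])
  then show ?thesis
    using Cons letter_val_inv_letter[OF f \<open>fst p \<in> A\<close>] by (auto simp: m_assoc[symmetric])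
qed simp

lemma word_val_mult:
  assumes f: "f ` A \<subseteq> carrier G" and "fst ` set v \<subseteq> A" and w: "fst ` set w \<subseteq> A"
  shows "word_val G f (foldr rcons v w) = word_val G f v \<otimes> word_val G f w"
  using assms(2)
proof (induction v)
  case Nil
  then show ?case using word_val_closed[OF f w] by simp
next
  case (Cons p v)
  have "fst ` set (foldr rcons v w) \<subseteq> A"
    using Cons.prems w by (simp add: fst_set_foldr_rcons)
  then have "word_val G f (foldr rcons (p # v) w)
      = letter_val G f p \<otimes> (word_val G f v \<otimes> word_val G f w)"
    using Cons word_val_rcons[OF f, of p "foldr rcons v w"] by simp
  then show ?case
    using Cons.prems letter_val_closed[OF f] word_val_closed[OF f] w by (simp add: m_assoc)
qed

lemma word_val_hom:
  assumes "f ` A \<subseteq> carrier G"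
  shows "word_val G f \<in> hom (free_group A) G"
  using assms by (auto simp: hom_def free_group_carrier word_val_closed word_val_mult)

lemma word_val_group_hom:
  assumes "f ` A \<subseteq> carrier G"
  shows "group_hom (free_group A) G (word_val G f)"
  by (simp add: group_hom_def group_hom_axioms_def group_free_group word_val_hom assms is_group)

lemma word_val_gen: "f x \<in> carrier G \<Longrightarrow> word_val G f [(x, True)] = f x"
  by (simp add: letter_val_def)

lemma word_val_in_generate:
  assumes "f ` A \<subseteq> carrier G" "fst ` set w \<subseteq> A"
  shows "word_val G f w \<in> generate G (f ` A)"
  using assms(2)
proof (induction w)
  case (Cons p w)
  have "letter_val G f p \<in> generate G (f ` A)"
    using Cons.prems by (auto simp: letter_val_def intro: generate.incl generate.inv)
  then show ?case using Cons by (auto intro: generate.eng)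
qed (simp add: generate.one)

lemma word_val_image:
  assumes f: "f ` A \<subseteq> carrier G"
  shows "word_val G f ` carrier (free_group A) = generate G (f ` A)"
proof
  show "word_val G f ` carrier (free_group A) \<subseteq> generate G (f ` A)"
    using word_val_in_generate[OF f] by (auto simp: free_group_carrier)
  interpret h: group_hom "free_group A" G "word_val G f" by (rule word_val_group_hom[OF f])
  have "f x \<in> word_val G f ` carrier (free_group A)" if "x \<in> A" for x
    using that f by (intro image_eqI[of _ _ "[(x, True)]"] free_group_gen) (auto simp: letter_val_def)
  then show "generate G (f ` A) \<subseteq> word_val G f ` carrier (free_group A)"
    by (intro generate_subgroup_incl h.img_is_subgroup) auto
qed

text \<open>Elements of the free group are reduced words, so a family is free as soon as no nonempty
  reduced word in it evaluates to one.\<close>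

lemma free_basis_iso:
  assumes f: "f ` A \<subseteq> carrier G"
    and "\<And>w. w \<in> carrier (free_group A) \<Longrightarrow> word_val G f w = \<one> \<Longrightarrow> w = []"
  shows "G\<lparr>carrier := generate G (f ` A)\<rparr> \<cong> free_group A"
proof -
  interpret h: group_hom "free_group A" G "word_val G f" by (rule word_val_group_hom[OF f])
  let ?H = "G\<lparr>carrier := generate G (f ` A)\<rparr>"
  have "inj_on (word_val G f) (carrier (free_group A))"
    using assms(2) h.inj_iff_trivial_ker by (auto simp: kernel_def h.inj_iff_trivial_ker free_group_carrier)
  then have "word_val G f \<in> iso (free_group A) ?H"
    using word_val_image[OF f] h.homh by (auto simp: iso_def hom_def bij_betw_def)
  then have "free_group A \<cong> ?H" by (auto simp: is_iso_def)
  then show ?thesis by (rule group.iso_sym[OF group_free_group])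
qed

end

lemma free_group_generate: "generate (free_group A) ((\<lambda>x. [(x, True)]) ` A) = carrier (free_group A)"
proof -
  interpret F: group "free_group A" by (rule group_free_group)
  let ?g = "\<lambda>x. [(x, True)]"
  have g: "?g ` A \<subseteq> carrier (free_group A)" by (auto intro!: free_group_gen)
  have "w \<in> generate (free_group A) (?g ` A)" if "w \<in> carrier (free_group A)" for w
    using that
  proof (induction w)
    case Nil
    then show ?case using generate.one[of "free_group A"] by simp
  next
    case (Cons p w)
    then have p: "fst p \<in> A" and w: "w \<in> carrier (free_group A)" and r: "reduced (p # w)"
      by (auto simp: free_group_carrier reduced_Cons)
    obtain x b where pe: "p = (x, b)" by (cases p)
    have "[p] \<in> generate (free_group A) (?g ` A)"
    proof (cases b)
      case True
      then show ?thesis using p pe by (auto intro!: generate.incl)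
    next
      case False
      have "inv\<^bsub>free_group A\<^esub> ?g x \<in> generate (free_group A) (?g ` A)"
        using p pe by (auto intro!: generate.inv)
      then show ?thesis using p pe False by (simp add: free_group_inv_gen)
    qed
    from generate.eng[OF this Cons.IH[OF w]] have "rcons p w \<in> generate (free_group A) (?g ` A)"
      by simp
    moreover have "rcons p w = p # w" using r by (cases w) (auto simp: reduced_Cons)
    ultimately show ?case by simp
  qed
  then show ?thesis using F.generate_incl[OF g] by blast
qed

text \<open>Schreier generators are indexed by pairs. Only their number should survive a step, so
  that the next one again starts from an index set \<open>{..<n}\<close>.\<close>

lemma free_group_reindex:
  assumes "bij_betw g A B"
  shows "free_group A \<cong> free_group B"
proof -
  define m where "m = map (\<lambda>p :: 'a letter. (g (fst p), snd p))"
  have inj: "inj_on g A" and im: "g ` A = B" using assms by (auto simp: bij_betw_def)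
  have il: "(g (fst q), snd q) = inv_letter (g (fst p), snd p) \<longleftrightarrow> q = inv_letter p"
    if "fst p \<in> A" "fst q \<in> A" for p q :: "'a letter"
    using inj that by (auto simp: inv_letter_def inj_on_def prod_eq_iff)
  have red: "reduced (m w) \<longleftrightarrow> reduced w" if "fst ` set w \<subseteq> A" for w
    using that
  proof (induction w)
    case (Cons p w)
    then show ?case by (cases w) (auto simp: m_def reduced_Cons il)
  qed (simp add: m_def)
  have rc: "m (rcons p w) = rcons (g (fst p), snd p) (m w)"
    if "fst p \<in> A" "fst ` set w \<subseteq> A" for p w
    using that by (cases w) (auto simp: m_def il)
  have hom: "m (foldr rcons v w) = foldr rcons (m v) (m w)"
    if "fst ` set v \<subseteq> A" "fst ` set w \<subseteq> A" for v w
    using that(1)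
  proof (induction v)
    case (Cons p v)
    moreover have "fst ` set (foldr rcons v w) \<subseteq> A"
      using Cons.prems that(2) by (simp add: fst_set_foldr_rcons)
    ultimately show ?case by (simp add: rc) (simp add: m_def)
  qed (simp add: m_def)
  have injm: "inj_on m (carrier (free_group A))"
  proof (rule inj_onI)
    fix v w assume "v \<in> carrier (free_group A)" "w \<in> carrier (free_group A)" and e: "m v = m w"
    then have *: "fst p \<in> A" if "p \<in> set v \<union> set w" for p
      using that by (auto simp: free_group_carrier)
    have "inj_on (\<lambda>p. (g (fst p), snd p)) (set v \<union> set w)"
      by (rule inj_onI) (use * inj in \<open>auto simp: inj_on_def prod_eq_iff\<close>)
    then show "v = w" using map_inj_on e by (auto simp: m_def)
  qed
  have "m ` carrier (free_group A) = carrier (free_group B)"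
  proof (intro equalityI subsetI)
    fix w assume "w \<in> m ` carrier (free_group A)"
    then obtain v where "w = m v" "reduced v" "fst ` set v \<subseteq> A" by (auto simp: free_group_carrier)
    then show "w \<in> carrier (free_group B)" using red im by (auto simp: free_group_carrier m_def)
  next
    fix w assume w: "w \<in> carrier (free_group B)"
    define v where "v = map (\<lambda>p :: 'b letter. (inv_into A g (fst p), snd p)) w"
    have mem: "fst p \<in> g ` A" if "p \<in> set w" for p
      using that w im by (metis free_group_carrier image_subset_iff)
    have "fst ` set v = (\<lambda>p. inv_into A g (fst p)) ` set w"
      by (simp add: v_def image_image)
    then have "fst ` set v \<subseteq> A" by (simp add: image_subset_iff inv_into_into[OF mem])
    moreover have "m v = w"
      unfolding m_def v_def map_map by (intro map_idI) (simp add: f_inv_into_f[OF mem])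
    ultimately show "w \<in> m ` carrier (free_group A)"
      using red[of v] w by (auto simp: free_group_carrier)
  qed
  then have "m \<in> iso (free_group A) (free_group B)"
    using injm hom by (auto simp: iso_def hom_def bij_betw_def free_group_carrier)
  then show ?thesis by (auto simp: is_iso_def)
qed

section \<open>Subgroups of index two\<close>

text \<open>\<open>\<phi>\<close> prescribes a homomorphism to the group of order two on the basis
  (truth values under \<open>\<noteq>\<close>). The basis element \<open>j\<close> lies outside its
  kernel and serves as the nontrivial coset representative.\<close>

locale index_two =
  fixes I :: "'i set" and j :: 'i and \<phi> :: "'i \<Rightarrow> bool"
  assumes j: "j \<in> I" "\<phi> j"
begin

definition par :: "'i letter list \<Rightarrow> bool" where
  "par w = foldr (\<lambda>p b. \<phi> (fst p) \<noteq> b) w False"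

lemma par_simps [simp]: "par [] = False" "par (p # w) = (\<phi> (fst p) \<noteq> par w)"
  by (simp_all add: par_def)

lemma par_rcons: "par (rcons p w) = (\<phi> (fst p) \<noteq> par w)"
  by (cases w) auto

lemma par_foldr_rcons: "par (foldr rcons v w) = (par v \<noteq> par w)"
  by (induction v) (auto simp: par_rcons)

text \<open>An inverse letter runs backwards along an edge of the coset graph, so its generator is
  indexed by the coset that it leads to. The edge \<open>(j, False)\<close> is the spanning tree:
  its generator is trivial and no letter is written.\<close>

definition step :: "bool \<Rightarrow> 'i letter \<Rightarrow> ('i \<times> bool) letter list \<Rightarrow> ('i \<times> bool) letter list" where
  "step k p x = (let q = (fst p, if snd p then k else k \<noteq> \<phi> (fst p)) in
     if q = (j, False) then x else rcons (q, snd p) x)"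

text \<open>Schreier rewriting along the transversal \<open>1, j\<close>: the Boolean is the current coset, and the
  letter \<open>(i, k)\<close> of the output stands for the Schreier generator \<open>y (i, k)\<close> below.\<close>

fun schreier :: "bool \<Rightarrow> 'i letter list \<Rightarrow> ('i \<times> bool) letter list" where
  "schreier k [] = []"
| "schreier k (p # w) = step k p (schreier (k \<noteq> \<phi> (fst p)) w)"

definition J :: "('i \<times> bool) set" where
  "J = (I \<times> UNIV) - {(j, False)}"

lemma step_eq:
  "step k (i, s) x = (if (i, if s then k else k \<noteq> \<phi> i) = (j, False) then x
     else rcons ((i, if s then k else k \<noteq> \<phi> i), s) x)"
  by (simp add: step_def)

lemma reduced_step: "reduced x \<Longrightarrow> reduced (step k p x)"
  by (simp add: step_def Let_def reduced_rcons)

lemma reduced_coc: "reduced (schreier k w)"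
  by (induction w arbitrary: k) (auto simp: reduced_step)

lemma set_step:
  assumes "fst p \<in> I" "fst ` set x \<subseteq> J"
  shows "fst ` set (step k p x) \<subseteq> J"
proof -
  obtain i s where p: "p = (i, s)" by (cases p)
  define q where "q = (i, if s then k else k \<noteq> \<phi> i)"
  have "fst ` set (rcons (q, s) x) \<subseteq> J" if "q \<noteq> (j, False)"
    using fst_set_foldr_rcons[of "[(q, s)]" J x] that assms by (simp add: q_def p J_def)
  then show ?thesis
    unfolding p step_eq q_def[symmetric] using assms by simp
qed

lemma set_coc: "fst ` set w \<subseteq> I \<Longrightarrow> fst ` set (schreier k w) \<subseteq> J"
  by (induction w arbitrary: k) (simp_all add: set_step)

lemma schreier_closed: "w \<in> carrier (free_group I) \<Longrightarrow> schreier k w \<in> carrier (free_group J)"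
  by (simp add: free_group_carrier reduced_coc set_coc)

text \<open>A letter, and its inverse read from the coset reached, use the same edge in opposite
  directions.\<close>

lemma step_cancel:
  assumes "reduced x"
  shows "step k p (step (k \<noteq> \<phi> (fst p)) (inv_letter p) x) = x"
proof -
  obtain i s where p: "p = (i, s)" by (cases p)
  define q where "q = (i, if s then k else k \<noteq> \<phi> i)"
  have q': "(i, if \<not> s then k \<noteq> \<phi> i else (k \<noteq> \<phi> i) \<noteq> \<phi> i) = q" by (auto simp: q_def)
  have "step k p y = (if q = (j, False) then y else rcons (q, s) y)" for y
    by (simp add: step_def p q_def)
  moreover have "step (k \<noteq> \<phi> (fst p)) (inv_letter p) y
      = (if q = (j, False) then y else rcons (inv_letter (q, s)) y)" for y
    unfolding step_def p inv_letter_def fst_conv snd_conv q' Let_def ..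
  ultimately show ?thesis using rcons_cancel[OF assms] by simp
qed

lemma schreier_rcons: "schreier k (rcons p w) = step k p (schreier (k \<noteq> \<phi> (fst p)) w)"
proof (cases w)
  case (Cons q v)
  show ?thesis
  proof (cases "q = inv_letter p")
    case True
    have "((k \<noteq> \<phi> (fst p)) \<noteq> \<phi> (fst p)) = k" by auto
    then show ?thesis using Cons True step_cancel[OF reduced_coc, of k p k v] by simp
  qed (simp add: Cons)
qed simp

lemma step_mult: "reduced y \<Longrightarrow> foldr rcons (step k p x) y = step k p (foldr rcons x y)"
  by (simp add: step_def Let_def foldr_rcons_rcons)

text \<open>Reading \<open>v\<close> moves the coset \<open>k\<close> to
  \<open>k \<noteq> par v\<close>, so rewriting is a cocycle. On words of even parity it is a
  homomorphism.\<close>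

lemma schreier_mult: "schreier k (foldr rcons v w) = foldr rcons (schreier k v) (schreier (k \<noteq> par v) w)"
proof (induction v arbitrary: k)
  case (Cons p v)
  have "((k \<noteq> \<phi> (fst p)) \<noteq> par v) = (k \<noteq> (\<phi> (fst p) \<noteq> par v))" by auto
  then show ?case using Cons by (simp add: schreier_rcons step_mult reduced_coc)
qed simp

definition rep :: "bool \<Rightarrow> 'i letter list" where
  "rep k = (if k then [(j, True)] else [])"

definition y :: "'i \<times> bool \<Rightarrow> 'i letter list" where
  "y q = foldr rcons (rep (snd q))
     (foldr rcons [(fst q, True)] (inv\<^bsub>free_group I\<^esub> (rep (snd q \<noteq> \<phi> (fst q)))))"

lemma rep_closed: "rep k \<in> carrier (free_group I)"
  using j by (auto simp: rep_def free_group_carrier reduced_Cons)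

lemma inv_rep: "inv\<^bsub>free_group I\<^esub> (rep k) = (if k then [(j, False)] else [])"
proof -
  interpret F: group "free_group I" by (rule group_free_group)
  show ?thesis using free_group_inv_gen[OF j(1), of True] F.inv_one by (simp add: rep_def)
qed

lemma schreier_rep: "schreier False (rep k) = []" "schreier k (inv\<^bsub>free_group I\<^esub> (rep k)) = []"
  unfolding inv_rep using j by (auto simp: rep_def step_def)

lemma par_rep: "par (rep k) = k" "par (inv\<^bsub>free_group I\<^esub> (rep k)) = k"
  unfolding inv_rep using j by (auto simp: rep_def)

lemma par_y: "\<not> par (y q)"
  by (auto simp: y_def par_foldr_rcons par_rep simp del: foldr.simps)
 
text \<open>Supplies preimages of the basis letters, hence surjectivity of the rewriting.\<close>

lemma schreier_y: "q \<noteq> (j, False) \<Longrightarrow> schreier False (y q) = [(q, True)]"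
  unfolding y_def schreier_mult par_rep schreier_rep by (simp add: step_def schreier_rep prod_eq_iff)

lemma y_closed: "fst q \<in> I \<Longrightarrow> y q \<in> carrier (free_group I)"
proof -
  interpret F: group "free_group I" by (rule group_free_group)
  assume "fst q \<in> I"
  then have "rep (snd q) \<otimes>\<^bsub>free_group I\<^esub> ([(fst q, True)] \<otimes>\<^bsub>free_group I\<^esub>
      inv\<^bsub>free_group I\<^esub> (rep (snd q \<noteq> \<phi> (fst q)))) \<in> carrier (free_group I)"
    by (intro F.m_closed F.inv_closed rep_closed free_group_gen) auto
  then show ?thesis by (simp add: y_def)
qed

lemma y_trivial: "y (j, False) = []"
  unfolding y_def inv_rep using j by (simp add: rep_def inv_letter_def)

text \<open>Each letter contributes itself framed by two coset representatives, and adjacent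
  representatives cancel. For \<open>k = False\<close> and \<open>w\<close> in the kernel the outer
  ones are empty, so evaluation at \<open>y\<close> undoes the rewriting; this gives
  injectivity.\<close>

lemma word_val_coc:
  assumes "w \<in> carrier (free_group I)"
  shows "word_val (free_group I) y (schreier k w) =
    rep k \<otimes>\<^bsub>free_group I\<^esub> w \<otimes>\<^bsub>free_group I\<^esub> inv\<^bsub>free_group I\<^esub> (rep (k \<noteq> par w))"
  using assms
proof (induction w arbitrary: k)
  interpret F: group "free_group I" by (rule group_free_group)
  case Nil
  have "rep k \<otimes>\<^bsub>free_group I\<^esub> inv\<^bsub>free_group I\<^esub> (rep k) = []"
    using F.r_inv[OF rep_closed] by simp
  then show ?case using F.r_one[OF rep_closed[of k]] by simp
next
  define F where "F = free_group I"
  interpret F: group F unfolding F_def by (rule group_free_group)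
  case (Cons p w)
  then have p: "fst p \<in> I" and w: "w \<in> carrier F" and r: "reduced (p # w)"
    by (auto simp: free_group_carrier reduced_Cons F_def)
  obtain i s where pe: "p = (i, s)" by (cases p)
  have i: "i \<in> I" using p pe by simp
  define k' where "k' = (k \<noteq> \<phi> i)"
  define q where "q = (i, if s then k else k')"
  have pw: "p # w = [p] \<otimes>\<^bsub>F\<^esub> w"
    using r by (cases w) (auto simp: reduced_Cons F_def)
  have yJ: "y ` (I \<times> UNIV) \<subseteq> carrier F" using y_closed by (auto simp: F_def)
  have pc: "[p] \<in> carrier F" and ic: "[(i, True)] \<in> carrier F"
    using p i by (auto intro!: free_group_gen simp: F_def)
  have rc: "rep k \<in> carrier F" for k using rep_closed by (simp add: F_def)
  have yq: "y (i, l) = rep l \<otimes>\<^bsub>F\<^esub> ([(i, True)] \<otimes>\<^bsub>F\<^esub> inv\<^bsub>F\<^esub> (rep (l \<noteq> \<phi> i)))" for l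
    by (simp add: y_def F_def)
  have lv: "letter_val F y (q, s) = rep k \<otimes>\<^bsub>F\<^esub> [p] \<otimes>\<^bsub>F\<^esub> inv\<^bsub>F\<^esub> (rep k')"
  proof (cases s)
    case True
    then show ?thesis
      using rc ic by (simp add: letter_val_def q_def yq pe k'_def F.m_assoc del: foldr.simps)
  next
    case False
    have "(k' \<noteq> \<phi> i) = k" by (auto simp: k'_def)
    then have "letter_val F y (q, s) = rep k \<otimes>\<^bsub>F\<^esub> inv\<^bsub>F\<^esub> [(i, True)] \<otimes>\<^bsub>F\<^esub> inv\<^bsub>F\<^esub> (rep k')"
      using rc ic False by (simp add: letter_val_def q_def yq F.inv_mult_group)
    then show ?thesis using False pe free_group_inv_gen[OF i, of True] by (simp add: F_def)
  qed
  have wc: "schreier k' w \<in> carrier (free_group J)" using w by (simp add: schreier_closed F_def)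
  then have wJ: "fst ` set (schreier k' w) \<subseteq> I \<times> UNIV" by (auto simp: free_group_carrier J_def)
  have "word_val F y (schreier k (p # w)) = word_val F y (step k p (schreier k' w))"
    by (simp add: pe k'_def)
  also have "\<dots> = letter_val F y (q, s) \<otimes>\<^bsub>F\<^esub> word_val F y (schreier k' w)"
  proof (cases "q = (j, False)")
    case True
    have c: "word_val F y (schreier k' w) \<in> carrier F" by (rule F.word_val_closed[OF yJ wJ])
    \<comment> \<open>The letter that \<open>step\<close> drops has value one.\<close>
    have "letter_val F y (q, s) = \<one>\<^bsub>F\<^esub>"
      using True y_trivial F.inv_one by (simp add: letter_val_def F_def)
    moreover have "step k p (schreier k' w) = schreier k' w"
      unfolding pe step_eq k'_def[symmetric] q_def[symmetric] True by simp
    ultimately show ?thesis using c by (simp only: F.l_one)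
  next
    case False
    then have "step k p (schreier k' w) = rcons (q, s) (schreier k' w)"
      unfolding pe step_eq k'_def[symmetric] q_def[symmetric] by simp
    then show ?thesis using F.word_val_rcons[OF yJ _ wJ, of "(q, s)"] i by (simp add: q_def)
  qed
  also have "word_val F y (schreier k' w) = rep k' \<otimes>\<^bsub>F\<^esub> w \<otimes>\<^bsub>F\<^esub> inv\<^bsub>F\<^esub> (rep (k' \<noteq> par w))"
    using Cons.IH w by (simp add: F_def)
  also have "letter_val F y (q, s) \<otimes>\<^bsub>F\<^esub> (rep k' \<otimes>\<^bsub>F\<^esub> w \<otimes>\<^bsub>F\<^esub> inv\<^bsub>F\<^esub> (rep (k' \<noteq> par w)))
    = rep k \<otimes>\<^bsub>F\<^esub> [p] \<otimes>\<^bsub>F\<^esub> (inv\<^bsub>F\<^esub> (rep k') \<otimes>\<^bsub>F\<^esub> rep k') \<otimes>\<^bsub>F\<^esub> w \<otimes>\<^bsub>F\<^esub> inv\<^bsub>F\<^esub> (rep (k' \<noteq> par w))"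
    unfolding lv using rc pc w by (simp only: F.m_assoc F.m_closed F.inv_closed)
  also have "\<dots> = rep k \<otimes>\<^bsub>F\<^esub> (p # w) \<otimes>\<^bsub>F\<^esub> inv\<^bsub>F\<^esub> (rep (k' \<noteq> par w))"
    unfolding pw using rc pc w by (simp only: F.l_inv F.r_one F.m_assoc F.m_closed F.inv_closed)
  also have "(k' \<noteq> par w) = (k \<noteq> par (p # w))" by (auto simp: k'_def pe)
  finally show ?case by (simp only: F_def)
qed

lemma kernel_subgroup:
  "subgroup {w \<in> carrier (free_group I). \<not> par w} (free_group I)"
proof -
  define F where "F = free_group I"
  interpret F: group F unfolding F_def by (rule group_free_group)
  define C where "C = {w \<in> carrier F. \<not> par w}"
  have "subgroup C F"
  proof (rule F.subgroupI)
    have "[] \<in> C" using F.one_closed by (simp add: C_def F_def)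
    then show "C \<noteq> {}" by blast
  next
    fix a assume "a \<in> C"
    moreover have "par (inv\<^bsub>F\<^esub> a \<otimes>\<^bsub>F\<^esub> a) = (par (inv\<^bsub>F\<^esub> a) \<noteq> par a)"
      by (simp add: F_def par_foldr_rcons)
    ultimately show "inv\<^bsub>F\<^esub> a \<in> C" by (simp add: C_def) (simp add: F_def)
  next
    fix a b assume "a \<in> C" "b \<in> C"
    then show "a \<otimes>\<^bsub>F\<^esub> b \<in> C"
      using F.m_closed[of a b] by (auto simp: C_def F_def par_foldr_rcons)
  qed (auto simp: C_def)
  then show ?thesis by (simp add: C_def F_def)
qed

lemma kernel_free:
  "(free_group I)\<lparr>carrier := {w \<in> carrier (free_group I). \<not> par w}\<rparr> \<cong> free_group J"
proof -
  define F where "F = free_group I"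
  define E where "E = free_group J"
  interpret F: group F unfolding F_def by (rule group_free_group)
  interpret E: group E unfolding E_def by (rule group_free_group)
  define C where "C = {w \<in> carrier F. \<not> par w}"
  have sub: "subgroup C F" using kernel_subgroup by (simp add: C_def F_def)
  let ?K = "F\<lparr>carrier := C\<rparr>"
  have gK: "group ?K" by (rule F.subgroup_imp_group[OF sub])
  have hom: "schreier False \<in> hom ?K E"
    by (auto simp: hom_def C_def schreier_mult F_def E_def schreier_closed)
  interpret h: group_hom ?K E "schreier False"
    using gK hom E.is_group by (simp add: group_hom_def group_hom_axioms_def)
  have inj: "inj_on (schreier False) C"
  proof (rule inj_on_inverseI)
    fix w assume "w \<in> C"
    then show "word_val F y (schreier False w) = w"
      using word_val_coc[of w False] by (simp add: C_def F_def rep_def foldr_rcons_Nil free_group_carrier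
          inv_rep[of False, unfolded rep_def, simplified])
  qed
  have "generate E ((\<lambda>x. [(x, True)]) ` J) \<subseteq> schreier False ` C"
  proof (rule E.generate_subgroup_incl)
    show "subgroup (schreier False ` C) E" using h.img_is_subgroup by simp
    show "(\<lambda>x. [(x, True)]) ` J \<subseteq> schreier False ` C"
    proof
      fix v assume "v \<in> (\<lambda>x. [(x, True)]) ` J"
      then obtain q where q: "q \<in> J" "v = [(q, True)]" by auto
      then have "y q \<in> C" "schreier False (y q) = v"
        using par_y schreier_y y_closed by (auto simp: C_def F_def J_def)
      then show "v \<in> schreier False ` C" by blast
    qed
  qed
  then have "schreier False ` C = carrier E"
    using free_group_generate[of J] h.hom_closed by (auto simp: E_def)
  then have "schreier False \<in> iso ?K E" using inj hom by (simp add: iso_def bij_betw_def)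
  then show ?thesis unfolding is_iso_def F_def E_def C_def by blast
qed

lemma card_J: "finite I \<Longrightarrow> card J = 2 * card I - 1"
  using j by (simp add: J_def card_cartesian_product mult.commute)

end

text \<open>\<open>\<chi>\<close> is a character whose values are truth values under
  \<open>\<noteq>\<close>. Pulled back to words it is determined by its values on the basis, which
  puts it in the setting of \<open>index_two\<close>.\<close>

lemma index_two_free:
  assumes G: "group G" and iso: "G \<cong> free_group {..<Suc n}"
    and \<chi>: "\<And>x y. x \<in> carrier G \<Longrightarrow> y \<in> carrier G \<Longrightarrow> \<chi> (x \<otimes>\<^bsub>G\<^esub> y) = (\<chi> x \<noteq> \<chi> y)"
    and x0: "x\<^sub>0 \<in> carrier G" "\<chi> x\<^sub>0"
  shows "G\<lparr>carrier := {x \<in> carrier G. \<not> \<chi> x}\<rparr> \<cong> free_group {..<Suc (2 * n)}"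
proof -
  define F where "F = free_group {..<Suc n}"
  interpret G: group G by (rule G)
  interpret F: group F unfolding F_def by (rule group_free_group)
  have "F \<cong> G" using G.iso_sym[OF iso] by (simp add: F_def)
  then obtain h where h: "h \<in> iso F G" by (auto simp: is_iso_def)
  then have hh: "h \<in> hom F G" and bij: "bij_betw h (carrier F) (carrier G)" by (auto simp: iso_def)
  interpret h: group_hom F G h using hh by (simp add: group_hom_def group_hom_axioms_def)
  have \<chi>1: "\<not> \<chi> \<one>\<^bsub>G\<^esub>" using \<chi>[of "\<one>\<^bsub>G\<^esub>" "\<one>\<^bsub>G\<^esub>"] by auto
  have \<chi>inv: "\<chi> (inv\<^bsub>G\<^esub> x) = \<chi> x" if "x \<in> carrier G" for x
    using \<chi>[of "inv\<^bsub>G\<^esub> x" x] that \<chi>1 by auto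
  define \<phi> where "\<phi> i = \<chi> (h [(i, True)])" for i
  have gen: "\<chi> (h [p]) = \<phi> (fst p)" if "fst p < Suc n" for p
  proof -
    obtain i s where p: "p = (i, s)" by (cases p)
    have c: "[(i, True)] \<in> carrier F" using that p by (auto simp: F_def intro!: free_group_gen)
    have "inv\<^bsub>F\<^esub> [(i, True)] = [(i, False)]"
      using that p free_group_inv_gen[of i "{..<Suc n}" True] by (simp add: F_def)
    then have "h [(i, False)] = inv\<^bsub>G\<^esub> h [(i, True)]" using h.hom_inv[OF c] by simp
    then show ?thesis using \<chi>inv[OF h.hom_closed[OF c]] p by (cases s) (auto simp: \<phi>_def)
  qed
  have par: "\<chi> (h w) = foldr (\<lambda>p b. \<phi> (fst p) \<noteq> b) w False" if "w \<in> carrier F" for w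
    using that
  proof (induction w)
    case Nil
    then show ?case using h.hom_one \<chi>1 by (simp add: F_def)
  next
    case (Cons p w)
    then have p: "fst p < Suc n" and w: "w \<in> carrier F" and r: "reduced (p # w)"
      by (auto simp: free_group_carrier reduced_Cons F_def)
    have pc: "[p] \<in> carrier F" using p by (auto simp: F_def intro!: free_group_gen)
    have "p # w = [p] \<otimes>\<^bsub>F\<^esub> w" using r by (cases w) (auto simp: reduced_Cons F_def)
    then have "h (p # w) = h [p] \<otimes>\<^bsub>G\<^esub> h w" using h.hom_mult[OF pc w] by simp
    then show ?case
      using \<chi>[OF h.hom_closed[OF pc] h.hom_closed[OF w]] gen[OF p] Cons.IH[OF w] by simp
  qed
  obtain w0 where w0: "w0 \<in> carrier F" "h w0 = x\<^sub>0" using bij x0 by (metis bij_betw_imp_surj_on imageE)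
  \<comment> \<open>If every basis element had trivial parity, so would every word, contrary to the
    existence of \<open>x\<^sub>0\<close>.\<close>
  have "\<exists>j<Suc n. \<phi> j"
  proof (rule ccontr)
    assume none: "\<not> (\<exists>j<Suc n. \<phi> j)"
    have "\<not> foldr (\<lambda>p b. \<phi> (fst p) \<noteq> b) w False" if "fst ` set w \<subseteq> {..<Suc n}" for w :: "nat letter list"
      using that none by (induction w) auto
    then show False using par[OF w0(1)] w0 x0 by (auto simp: F_def free_group_carrier)
  qed
  then obtain j where j: "j < Suc n" "\<phi> j" by blast
  interpret ix: index_two "{..<Suc n}" j \<phi> by unfold_locales (use j in auto)
  let ?C = "{w \<in> carrier F. \<not> ix.par w}"
  have hC: "h ` ?C = {x \<in> carrier G. \<not> \<chi> x}"
  proof (intro equalityI subsetI)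
    fix x assume "x \<in> {x \<in> carrier G. \<not> \<chi> x}"
    then obtain w where "w \<in> carrier F" "x = h w" "\<not> \<chi> x"
      using bij_betw_imp_surj_on[OF bij] by (metis (no_types, lifting) imageE mem_Collect_eq)
    then show "x \<in> h ` ?C" using par by (auto simp: ix.par_def)
  qed (use par in \<open>auto simp: ix.par_def\<close>)
  have "h \<in> iso (F\<lparr>carrier := ?C\<rparr>) (G\<lparr>carrier := {x \<in> carrier G. \<not> \<chi> x}\<rparr>)"
    using hC bij hh by (auto simp: iso_def hom_def bij_betw_def intro: inj_on_subset)
  then have "F\<lparr>carrier := ?C\<rparr> \<cong> G\<lparr>carrier := {x \<in> carrier G. \<not> \<chi> x}\<rparr>"
    by (auto simp: is_iso_def)
  moreover have "group (F\<lparr>carrier := ?C\<rparr>)"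
    using F.subgroup_imp_group ix.kernel_subgroup by (simp add: F_def)
  ultimately have "G\<lparr>carrier := {x \<in> carrier G. \<not> \<chi> x}\<rparr> \<cong> F\<lparr>carrier := ?C\<rparr>"
    by (rule group.iso_sym[rotated])
  moreover have "F\<lparr>carrier := ?C\<rparr> \<cong> free_group ix.J" using ix.kernel_free by (simp add: F_def)
  moreover have "free_group ix.J \<cong> free_group {..<Suc (2 * n)}"
  proof -
    have "finite ix.J" "card ix.J = Suc (2 * n)"
      using ix.card_J by (auto simp: ix.J_def)
    then obtain g where "bij_betw g ix.J {..<Suc (2 * n)}"
      using finite_same_card_bij[of ix.J "{..<Suc (2 * n)}"] by auto
    then show ?thesis by (rule free_group_reindex)
  qed
  ultimately show ?thesis by (blast intro: iso_trans)
qed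

text \<open>The conclusions have the shape of the assumptions on \<open>H\<close>, so the step can
  be iterated along a chain of subgroups of one ambient group.\<close>

lemma (in group) index_two_free_subgroup:
  assumes H: "subgroup H G" and iso: "G\<lparr>carrier := H\<rparr> \<cong> free_group {..<Suc n}"
    and \<chi>: "\<And>x y. x \<in> H \<Longrightarrow> y \<in> H \<Longrightarrow> \<chi> (x \<otimes> y) = (\<chi> x \<noteq> \<chi> y)"
    and x0: "x\<^sub>0 \<in> H" "\<chi> x\<^sub>0"
  shows "subgroup {x \<in> H. \<not> \<chi> x} G"
    "G\<lparr>carrier := {x \<in> H. \<not> \<chi> x}\<rparr> \<cong> free_group {..<Suc (2 * n)}"
proof -
  have \<chi>1: "\<not> \<chi> \<one>" using \<chi>[of \<one> \<one>] subgroup.one_closed[OF H] by auto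
  show "subgroup {x \<in> H. \<not> \<chi> x} G"
  proof (rule subgroupI)
    show "{x \<in> H. \<not> \<chi> x} \<subseteq> carrier G" using subgroup.subset[OF H] by auto
    show "{x \<in> H. \<not> \<chi> x} \<noteq> {}" using subgroup.one_closed[OF H] \<chi>1 by blast
  next
    fix a assume a: "a \<in> {x \<in> H. \<not> \<chi> x}"
    then have "a \<in> carrier G" "inv a \<in> H"
      using subgroup.subset[OF H] subgroup.m_inv_closed[OF H] by auto
    then show "inv a \<in> {x \<in> H. \<not> \<chi> x}" using \<chi>[of "inv a" a] \<chi>1 a by auto
  qed (use \<chi> subgroup.m_closed[OF H] in auto)
  have "(G\<lparr>carrier := H\<rparr>)\<lparr>carrier := {x \<in> carrier (G\<lparr>carrier := H\<rparr>). \<not> \<chi> x}\<rparr>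
      \<cong> free_group {..<Suc (2 * n)}"
    by (rule index_two_free[OF subgroup_imp_group[OF H] iso, of \<chi> x\<^sub>0]) (use \<chi> x0 in auto)
  then show "G\<lparr>carrier := {x \<in> H. \<not> \<chi> x}\<rparr> \<cong> free_group {..<Suc (2 * n)}" by simp
qed

section \<open>A congruence tower of free groups\<close>

type_synonym quad = "int \<times> int \<times> int \<times> int"

text \<open>The quadruple \<open>(p, q, r, s)\<close> is \<open>p + q a + r b + s ab\<close> in the quotient of \<open>\<int>[D\<^sub>8]\<close> by
  \<open>a\<^sup>2 = -1\<close>, that is, the matrix with rows \<open>(p + r, s - q)\<close> and \<open>(q + s, p - r)\<close>.\<close>

fun qmul :: "quad \<Rightarrow> quad \<Rightarrow> quad" where
  "qmul (p, q, r, s) (p', q', r', s') =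
     (p * p' - q * q' + r * r' + s * s', p * q' + q * p' - r * s' + s * r',
      p * r' + r * p' - q * s' + s * q', p * s' + s * p' + q * r' - r * q')"

fun qnorm :: "quad \<Rightarrow> int" where
  "qnorm (p, q, r, s) = p * p + q * q - r * r - s * s"

definition QG :: "quad monoid" where
  "QG = \<lparr>carrier = {x. \<bar>qnorm x\<bar> = 1}, monoid.mult = qmul, one = (1, 0, 0, 0)\<rparr>"

text \<open>The adjugate divided by the norm; a norm 1 or -1 is its own inverse, so the division is
  a multiplication.\<close>

fun qinv :: "quad \<Rightarrow> quad" where
  "qinv (p, q, r, s) = (let n = qnorm (p, q, r, s) in (n * p, - n * q, - n * r, - n * s))"

lemma qnorm_qmul: "qnorm (qmul x y) = qnorm x * qnorm y"
  by (cases x; cases y) (simp add: algebra_simps)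

lemma qmul_assoc: "qmul (qmul x y) z = qmul x (qmul y z)"
  by (cases x; cases y; cases z) (simp add: algebra_simps)

lemma qmul_one: "qmul (1, 0, 0, 0) x = x" "qmul x (1, 0, 0, 0) = x"
  by (cases x; simp)+

lemma abs_one_square: "\<bar>n :: int\<bar> = 1 \<Longrightarrow> n * n = 1"
  by (auto simp: abs_if split: if_splits)

lemma qinv:
  assumes "\<bar>qnorm x\<bar> = 1"
  shows "\<bar>qnorm (qinv x)\<bar> = 1" "qmul (qinv x) x = (1, 0, 0, 0)"
proof -
  obtain p q r s where x: "x = (p, q, r, s)" by (cases x)
  define n where "n = qnorm x"
  have n2: "n * n = 1" using assms by (auto simp: n_def intro: abs_one_square)
  have nx: "p * p + q * q - r * r - s * s = n" by (simp add: n_def x)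
  have i: "qinv x = (n * p, - n * q, - n * r, - n * s)"
    unfolding x qinv.simps n_def Let_def ..
  have "qnorm (qinv x) = (n * n) * (p * p + q * q - r * r - s * s)"
    unfolding i by (simp add: algebra_simps)
  then show "\<bar>qnorm (qinv x)\<bar> = 1" using assms n2 nx by (simp add: n_def)
  have "qmul (qinv x) x = (n * (p * p + q * q - r * r - s * s), 0, 0, 0)"
    unfolding i by (simp add: x algebra_simps)
  then show "qmul (qinv x) x = (1, 0, 0, 0)" using n2 nx by simp
qed

lemma QG_simps [simp]:
  "x \<in> carrier QG \<longleftrightarrow> \<bar>qnorm x\<bar> = 1" "x \<otimes>\<^bsub>QG\<^esub> y = qmul x y" "\<one>\<^bsub>QG\<^esub> = (1, 0, 0, 0)"
  by (simp_all add: QG_def)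

lemma group_QG: "group QG"
  by (rule groupI) (auto simp: qnorm_qmul abs_mult qmul_assoc qmul_one intro!: bexI[OF _ iffD2[OF QG_simps(1)]] qinv)

interpretation QG: group QG by (rule group_QG)

lemma inv_QG: "\<bar>qnorm x\<bar> = 1 \<Longrightarrow> inv\<^bsub>QG\<^esub> x = qinv x"
  by (rule QG.inv_equality) (simp_all add: qinv)

text \<open>At level 0 the condition modulo 4 fixes a sign: for odd p exactly one of p and -p
  satisfies it. The exponent \<open>Suc i\<close> is the one that matches congruence modulo
  \<open>2 ^ i\<close> in the group ring.\<close>

definition cong_quads :: "nat \<Rightarrow> quad set" where
  "cong_quads i = {(p, q, r, s). qnorm (p, q, r, s) = 1 \<and> 4 dvd p - 1 \<and> 2 ^ Suc i dvd p - 1 \<and>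
     2 ^ Suc i dvd q \<and> 2 ^ Suc i dvd r \<and> 2 ^ Suc i dvd s}"

lemma cong_quads_iff: "(p, q, r, s) \<in> cong_quads i \<longleftrightarrow> p * p + q * q - r * r - s * s = 1 \<and> 4 dvd p - 1 \<and>
    2 ^ Suc i dvd p - 1 \<and> 2 ^ Suc i dvd q \<and> 2 ^ Suc i dvd r \<and> 2 ^ Suc i dvd s"
  by (simp add: cong_quads_def)

lemma cong_quads_mult:
  assumes "x \<in> cong_quads i" "y \<in> cong_quads i"
  shows "qmul x y \<in> cong_quads i"
proof -
  obtain p q r s where x: "x = (p, q, r, s)" by (cases x)
  obtain p' q' r' s' where y: "y = (p', q', r', s')" by (cases y)
  define t where "t = (2::int) ^ Suc i"
  have X: "4 dvd p - 1" "t dvd p - 1" "t dvd q" "t dvd r" "t dvd s" "qnorm x = 1"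
    and Y: "4 dvd p' - 1" "t dvd p' - 1" "t dvd q'" "t dvd r'" "t dvd s'" "qnorm y = 1"
    using assms unfolding x y cong_quads_iff t_def by auto
  have t2: "2 dvd t" by (simp add: t_def)
  have ev: "2 dvd q" "2 dvd r" "2 dvd s" "2 dvd q'" "2 dvd r'" "2 dvd s'"
    using X Y dvd_trans[OF t2] by blast+
  have four: "4 dvd m * n" if "2 dvd m" "2 dvd n" for m n :: int
    using mult_dvd_mono[OF that] by simp
  have e: "p * p' - q * q' + r * r' + s * s' - 1
      = (p - 1) * p' + (p' - 1) - q * q' + r * r' + s * s'"
    by (simp add: algebra_simps)
  have "4 dvd p * p' - q * q' + r * r' + s * s' - 1"
    unfolding e
    by (intro dvd_add dvd_diff dvd_mult2[OF X(1)] Y(1) four[OF ev(1,4)] four[OF ev(2,5)] four[OF ev(3,6)])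
  moreover have "t dvd p * p' - q * q' + r * r' + s * s' - 1"
    unfolding e
    by (intro dvd_add dvd_diff dvd_mult2[OF X(2)] Y(2) dvd_mult2[OF X(3)] dvd_mult2[OF X(4)] dvd_mult2[OF X(5)])
  moreover have "t dvd p * q' + q * p' - r * s' + s * r'" "t dvd p * r' + r * p' - q * s' + s * q'"
    "t dvd p * s' + s * p' + q * r' - r * q'"
    using X Y by (auto intro!: dvd_add dvd_diff)
  moreover have "qnorm (qmul x y) = 1" using X Y by (simp add: qnorm_qmul)
  ultimately show ?thesis unfolding x y by (simp add: cong_quads_def t_def)
qed

lemma cong_quads_subgroup: "subgroup (cong_quads i) QG"
proof (rule QG.subgroupI)
  show "cong_quads i \<subseteq> carrier QG" by (auto simp: cong_quads_def)
  have "(1, 0, 0, 0) \<in> cong_quads i" by (simp add: cong_quads_iff)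
  then show "cong_quads i \<noteq> {}" by blast
next
  fix x assume x: "x \<in> cong_quads i"
  obtain p q r s where e: "x = (p, q, r, s)" by (cases x)
  have n: "qnorm x = 1" using x by (auto simp: cong_quads_def)
  then have "inv\<^bsub>QG\<^esub> x = (p, -q, -r, -s)" by (simp add: inv_QG) (simp add: e Let_def)
  then show "inv\<^bsub>QG\<^esub> x \<in> cong_quads i" using x by (simp add: e cong_quads_iff)
qed (simp add: cong_quads_mult)

subsection \<open>Rank three: ping-pong and descent\<close>

text \<open>As matrices: the lower and the upper unitriangular matrix with corner 4, and the
  parabolic matrix with rows (-1, -2) and (2, 3). On the projective line they fix 0, infinity and
  -1, the points where the two arcs of a generator meet.\<close>

definition bicyclic_quad :: "nat \<Rightarrow> quad" where
  "bicyclic_quad i = (if i = 0 then (1, 2, 0, 2) else if i = 1 then (1, -2, 0, 2) else (1, 2, -2, 0))"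

fun act :: "quad \<Rightarrow> int \<times> int \<Rightarrow> int \<times> int" where
  "act (p, q, r, s) (x, y) = ((p + r) * x + (s - q) * y, (q + s) * x + (p - r) * y)"

lemma act_qmul: "act (qmul g h) v = act g (act h v)"
  by (cases g; cases h; cases v) (simp add: algebra_simps)

text \<open>Ping-pong on the projective line: with \<open>z = x / y\<close>, the inequality \<open>form p (x, y) \<le> 0\<close> says
  that \<open>z\<close> lies in a closed arc attached to the letter \<open>p\<close>. The arcs
  \<open>[0, 1]\<close>, \<open>[-1/3, 0]\<close>, \<open>[1, \<infinity>]\<close>, \<open>[\<infinity>, -3]\<close>, \<open>[-1, -1/3]\<close>, \<open>[-3, -1]\<close> cut out an ideal
  hexagon, and the letter \<open>p\<close> maps the outside of the arc of its inverse onto its own arc.\<close>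

fun form :: "nat letter \<Rightarrow> int \<times> int \<Rightarrow> int" where
  "form (i, b) (x, y) =
    (if i = 0 then (if b then x * (x - y) else x * (3 * x + y))
     else if i = 1 then (if b then y * (y - x) else y * (x + 3 * y))
     else (if b then (x + y) * (3 * x + y) else (x + y) * (x + 3 * y)))"

lemma bicyclic_quad_carrier: "\<bar>qnorm (bicyclic_quad i)\<bar> = 1"
  by (simp add: bicyclic_quad_def)

text \<open>Both sides are quadratic forms in \<open>v\<close> with the same roots, the end points
  of an arc. The two forms of a generator are scaled to equal discriminant and the matrices have
  determinant 1, so they agree up to sign; the sign is negative because the outside of one arc
  becomes the inside of the other.\<close>

lemma form_act: "form p (act (letter_val QG bicyclic_quad p) v) = - form (inv_letter p) v"
proof -
  obtain i b where p: "p = (i, b)" by (cases p)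
  obtain x y where v: "v = (x, y)" by (cases v)
  have "letter_val QG bicyclic_quad p = (if b then bicyclic_quad i else qinv (bicyclic_quad i))"
    by (simp add: p letter_val_def inv_QG bicyclic_quad_carrier)
  then show ?thesis
    by (cases b) (auto simp: p v bicyclic_quad_def inv_letter_def algebra_simps Let_def)
qed

text \<open>Distinct arcs meet at most in end points, where both forms vanish; hence the weak
  inequality.\<close>

lemma form_disjoint:
  assumes "form p v \<le> 0" "p \<noteq> q" "fst p < 3" "fst q < 3"
  shows "0 \<le> form q v"
proof -
  obtain i b where p: "p = (i, b)" by (cases p)
  obtain j c where q: "q = (j, c)" by (cases q)
  obtain x y where v: "v = (x, y)" by (cases v)
  have "i = 0 \<or> i = 1 \<or> i = 2" "j = 0 \<or> j = 1 \<or> j = 2" using assms p q by auto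
  moreover have False if "form q v < 0"
    using calculation that assms(1,2) unfolding p q v
    by (elim disjE; cases b; cases c) (auto simp: mult_le_0_iff mult_less_0_iff)
  ultimately show ?thesis by force
qed

text \<open>Reducedness keeps the moving point out of the open arc of the inverse of the next
  letter. The condition on \<open>p\<close> and \<open>last w\<close> does the same for the starting
  point.\<close>

lemma form_word:
  assumes "reduced w" "fst ` set w \<subseteq> {..<3}" "w \<noteq> []"
    and "form p v \<le> 0" "fst p < 3" "p \<noteq> inv_letter (last w)"
  shows "form (hd w) (act (word_val QG bicyclic_quad w) v) \<le> 0"
  using assms(1-3,6)
proof (induction w)
  case (Cons q w)
  show ?case
  proof (cases "w = []")
    case True
    then have "0 \<le> form (inv_letter q) v"
      using form_disjoint[OF assms(4), of "inv_letter q"] assms(5) Cons.prems by auto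
    then show ?thesis using True form_act[of q v] by (simp add: qmul_one)
  next
    case False
    define u where "u = act (word_val QG bicyclic_quad w) v"
    have "form (hd w) u \<le> 0" unfolding u_def using Cons False by (auto simp: reduced_Cons)
    moreover have "fst (hd w) \<in> {..<3}"
      using subsetD[OF _ imageI[OF hd_in_set[OF False]], of fst "{..<3}"] Cons.prems by simp
    then have "hd w \<noteq> inv_letter q" "fst (hd w) < 3" "fst q < 3"
      using Cons.prems False by (auto simp: reduced_Cons)
    ultimately have "0 \<le> form (inv_letter q) u" using form_disjoint by simp
    then show ?thesis using form_act[of q u] by (simp add: act_qmul u_def)
  qed
qed simp

lemma bicyclic_quad_free:
  assumes "w \<in> carrier (free_group {..<3})" "word_val QG bicyclic_quad w = \<one>\<^bsub>QG\<^esub>"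
  shows "w = []"
proof (rule ccontr)
  assume w: "w \<noteq> []"
  have red: "reduced w" and sub: "fst ` set w \<subseteq> {..<3}"
    using assms(1) by (auto simp: free_group_carrier)
  \<comment> \<open>Three candidates, of which the first letter and the inverse of the last one
    exclude at most two.\<close>
  define P where "P = {(0 :: nat, True), (1, True), (2, True)}"
  have "card P = 3" by (simp add: P_def)
  moreover have "card {hd w, inv_letter (last w)} \<le> 2" by (simp add: card_insert_if)
  ultimately have "\<not> P \<subseteq> {hd w, inv_letter (last w)}"
    using card_mono[of "{hd w, inv_letter (last w)}" P] by auto
  then obtain p where p: "p \<in> P" "p \<noteq> hd w" "p \<noteq> inv_letter (last w)" by auto
  \<comment> \<open>The points 1/2, 2 and -1/2, strictly inside the arcs of the candidates. There
    the forms of all other letters are strictly positive, which contradicts the weak inequality of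
    \<open>form_word\<close>.\<close>
  define v :: "int \<times> int" where
    "v = (if fst p = 0 then (1, 2) else if fst p = 1 then (2, 1) else (-1, 2))"
  have pv: "form p v \<le> 0" "fst p < 3" using p(1) by (auto simp: P_def v_def)
  have "act (1, 0, 0, 0) v = v" by (cases v) simp
  then have "form (hd w) v \<le> 0"
    using form_word[OF red sub w pv p(3)] assms(2) by simp
  moreover have "fst (hd w) < 3" using subsetD[OF sub imageI[OF hd_in_set[OF w]]] by simp
  then have "0 < form (hd w) v"
    using p(1,2) by (cases "hd w") (auto simp: P_def v_def less_Suc_eq numeral_3_eq_3)
  ultimately show False by simp
qed

text \<open>If one entry exceeds twice the other, a unitriangular shear by 4 shortens it. In the
  intermediate range a shear is too coarse, and a parabolic matrix fixing (1, 1) or (1, -1) takes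
  over, according to whether the signs agree; it preserves A - C or A + C. The parities of A and C
  exclude the ties |A| = |C| and |A| = 2|C|.\<close>

lemma descent_step:
  assumes "odd A" "even C" "C \<noteq> (0::int)"
  shows "\<exists>h \<in> {(1, -2, 0, 2), (1, 2, 0, -2), (1, 2, 0, 2), (1, -2, 0, -2),
      (1, 2, -2, 0), (1, -2, 2, 0), (1, 2, 2, 0), (1, -2, -2, 0)}.
      \<bar>fst (act h (A, C))\<bar> + \<bar>snd (act h (A, C))\<bar> < \<bar>A\<bar> + \<bar>C\<bar>" (is "\<exists>h \<in> ?H. ?P h")
proof -
  have ne: "A \<noteq> C" "A \<noteq> - C" "A \<noteq> 2 * C" "A \<noteq> - 2 * C" "A \<noteq> 0" using assms by auto
  consider (pos) "0 < A * C" | (neg) "A * C < 0" using ne assms(3) by (metis linorder_neqE mult_eq_0_iff)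
  then show ?thesis
  proof cases
    case pos
    then have s: "0 < A \<and> 0 < C \<or> A < 0 \<and> C < 0" by (simp add: zero_less_mult_iff)
    consider "\<bar>A\<bar> > 2 * \<bar>C\<bar>" | "\<bar>C\<bar> > 2 * \<bar>A\<bar>" | "\<bar>C\<bar> < \<bar>A\<bar>" "\<bar>A\<bar> < 2 * \<bar>C\<bar>"
      | "\<bar>A\<bar> < \<bar>C\<bar>" "\<bar>C\<bar> \<le> 2 * \<bar>A\<bar>"
      using ne by linarith
    then have "?P (1, 2, 0, -2) \<or> ?P (1, -2, 0, -2) \<or> ?P (1, -2, -2, 0) \<or> ?P (1, 2, 2, 0)"
      using s by cases (auto simp: abs_if)
    then show ?thesis by blast
  next
    case neg
    then have s: "0 < A \<and> C < 0 \<or> A < 0 \<and> 0 < C" by (simp add: mult_less_0_iff)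
    consider "\<bar>A\<bar> > 2 * \<bar>C\<bar>" | "\<bar>C\<bar> > 2 * \<bar>A\<bar>" | "\<bar>C\<bar> < \<bar>A\<bar>" "\<bar>A\<bar> < 2 * \<bar>C\<bar>"
      | "\<bar>A\<bar> < \<bar>C\<bar>" "\<bar>C\<bar> \<le> 2 * \<bar>A\<bar>"
      using ne by linarith
    then have "?P (1, -2, 0, 2) \<or> ?P (1, 2, 0, 2) \<or> ?P (1, 2, -2, 0) \<or> ?P (1, -2, 2, 0)"
      using s by cases (auto simp: abs_if)
    then show ?thesis by blast
  qed
qed

text \<open>The first column (p + r, q + s) is shortened until its lower entry vanishes. What
  remains is upper unitriangular, a power of one generator.\<close>

lemma cong_quads_0_generate: "generate QG (bicyclic_quad ` {..<3}) = cong_quads 0"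
proof
  let ?S = "generate QG (bicyclic_quad ` {..<3})"
  have b: "bicyclic_quad i \<in> cong_quads 0" for i by (simp add: bicyclic_quad_def cong_quads_iff)
  show "?S \<subseteq> cong_quads 0" by (rule QG.generate_subgroup_incl[OF _ cong_quads_subgroup]) (use b in auto)
  have sub: "subgroup ?S QG" by (rule QG.generate_is_subgroup) (auto simp: bicyclic_quad_carrier)
  have mult: "qmul x y \<in> ?S" if "x \<in> ?S" "y \<in> ?S" for x y
    using subgroup.m_closed[OF sub that] by simp
  have inv: "qinv x \<in> ?S" if "x \<in> ?S" for x
    using subgroup.m_inv_closed[OF sub that] subgroup.mem_carrier[OF sub that] by (simp add: inv_QG)
  have g: "bicyclic_quad i \<in> ?S" if "i < 3" for i using that by (auto intro: generate.incl)
  have g0: "(1, 2, 0, 2) \<in> ?S" "(1, -2, 0, -2) \<in> ?S"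
    using g[of 0] inv[OF g[of 0]] by (simp_all add: bicyclic_quad_def Let_def)
  have g1: "(1, -2, 0, 2) \<in> ?S" "(1, 2, 0, -2) \<in> ?S"
    using g[of 1] inv[OF g[of 1]] by (simp_all add: bicyclic_quad_def Let_def)
  have g2: "(1, 2, -2, 0) \<in> ?S" "(1, -2, 2, 0) \<in> ?S"
    using g[of 2] inv[OF g[of 2]] by (simp_all add: bicyclic_quad_def Let_def)
  \<comment> \<open>The parabolic matrix fixing (1, 1), needed for the descent, is a product of the
    three generators, one of them inverted.\<close>
  have g3: "(1, -2, -2, 0) \<in> ?S" "(1, 2, 2, 0) \<in> ?S"
    using mult[OF mult[OF g0(1) g2(1)] g1(2)] inv[OF mult[OF mult[OF g0(1) g2(1)] g1(2)]]
    by (simp_all add: Let_def)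
  have one: "(1, 0, 0, 0) \<in> ?S" using subgroup.one_closed[OF sub] by simp
  have par: "(1, -2 * int k, 0, 2 * int k) \<in> ?S \<and> (1, 2 * int k, 0, -2 * int k) \<in> ?S" for k
  proof (induction k)
    case (Suc k)
    then show ?case
      using mult[OF g1(1), of "(1, -2 * int k, 0, 2 * int k)"]
        mult[OF g1(2), of "(1, 2 * int k, 0, -2 * int k)"] by (simp add: algebra_simps)
  qed (simp add: one)
  have "x \<in> ?S" if "x \<in> cong_quads 0" for x
    using that
  proof (induction "nat (let (p, q, r, s) = x in \<bar>p + r\<bar> + \<bar>q + s\<bar>)" arbitrary: x rule: less_induct)
    case less
    obtain p q r s where x: "x = (p, q, r, s)" by (cases x)
    have X: "p * p + q * q - r * r - s * s = 1" "4 dvd p - 1" "even q" "even r" "even s"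
      using less.prems unfolding x cong_quads_iff by auto
    have "odd p" using X(2) by presburger
    show ?case
    proof (cases "q + s = 0")
      case True
      then have s: "s = - q" by simp
      \<comment> \<open>The lower left entry is 0, so the determinant is the product of the diagonal
        entries. The diagonal (-1, -1) is ruled out by p being 1 modulo 4.\<close>
      have "(p + r) * (p - r) = 1" using X(1) by (simp add: s algebra_simps)
      then have "(p + r = 1 \<and> p - r = 1) \<or> (p + r = -1 \<and> p - r = -1)"
        by (simp add: zmult_eq_1_iff)
      then have "p = 1" "r = 0" using X(2) by presburger+
      moreover obtain m where "q = 2 * m" using X(3) by auto
      ultimately show ?thesis
        using par[of "nat m"] par[of "nat (- m)"] s x by (cases "m \<ge> 0") auto
    next
      case False
      have "\<exists>h \<in> ?S. qinv h \<in> ?S \<and>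
        (let (p', q', r', s') = qmul h x in \<bar>p' + r'\<bar> + \<bar>q' + s'\<bar> < \<bar>p + r\<bar> + \<bar>q + s\<bar>)"
      proof -
        \<comment> \<open>The image of (1, 0) is the first column of the matrix.\<close>
        have A: "fst (act (qmul h x) (1, 0)) = fst (act h (p + r, q + s))"
          "snd (act (qmul h x) (1, 0)) = snd (act h (p + r, q + s))" for h
          unfolding act_qmul x by simp_all
        have "odd (p + r)" "even (q + s)" using X \<open>odd p\<close> by auto
        from descent_step[OF this False] obtain h where h: "h \<in> ?S"
          "\<bar>fst (act h (p + r, q + s))\<bar> + \<bar>snd (act h (p + r, q + s))\<bar> < \<bar>p + r\<bar> + \<bar>q + s\<bar>"
          using g0 g1 g2 g3 by blast
        then show ?thesis
          using inv[OF h(1)] unfolding A[symmetric] by (cases "qmul h x") (auto intro!: bexI[OF _ h(1)])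
      qed
      then obtain h where h: "h \<in> ?S" "qinv h \<in> ?S"
        "(let (p', q', r', s') = qmul h x in \<bar>p' + r'\<bar> + \<bar>q' + s'\<bar> < \<bar>p + r\<bar> + \<bar>q + s\<bar>)"
        by blast
      have "h \<in> cong_quads 0" using h(1) \<open>?S \<subseteq> cong_quads 0\<close> by blast
      then have hx: "qmul h x \<in> cong_quads 0" using cong_quads_mult less.prems by blast
      have "0 < \<bar>p + r\<bar> + \<bar>q + s\<bar>" using False by linarith
      then have "nat (let (p, q, r, s) = qmul h x in \<bar>p + r\<bar> + \<bar>q + s\<bar>)
          < nat (let (p, q, r, s) = x in \<bar>p + r\<bar> + \<bar>q + s\<bar>)"
        using h(3) by (cases "qmul h x") (simp add: x)
      from less.hyps[OF this hx] have "qmul h x \<in> ?S" .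
      then have "qmul (qinv h) (qmul h x) \<in> ?S" using mult h(2) by blast
      moreover have "qmul (qinv h) (qmul h x) = x"
        using qinv(2)[of h] subgroup.mem_carrier[OF sub h(1)]
        by (simp add: qmul_assoc[symmetric] qmul_one)
      ultimately show ?thesis by simp
    qed
  qed
  then show "cong_quads 0 \<subseteq> ?S" by blast
qed

lemma cong_quads_0_free: "QG\<lparr>carrier := cong_quads 0\<rparr> \<cong> free_group {..<3::nat}"
  using QG.free_basis_iso[of bicyclic_quad "{..<3}"] bicyclic_quad_free
  unfolding cong_quads_0_generate by (simp add: image_subset_iff bicyclic_quad_carrier)

subsection \<open>Index-two steps\<close>

text \<open>The order r, q, s is the order in which the kernels are taken; s comes last because at
  level 0 its parity follows from the other two.\<close>

fun coord :: "nat \<Rightarrow> quad \<Rightarrow> int" where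
  "coord k (p, q, r, s) = (if k = 0 then r else if k = 1 then q else s)"

definition coord_parity :: "int \<Rightarrow> nat \<Rightarrow> quad \<Rightarrow> bool" where
  "coord_parity t k x = odd (coord k x div t)"

text \<open>After division by t, an off-scalar coordinate of the product is of the form p q' + q p'
  + t (...). Since p and p' are odd and t is even, this is additive modulo 2.\<close>

lemma coord_parity_mult:
  assumes "x \<in> cong_quads i" "y \<in> cong_quads i"
  shows "coord_parity (2 ^ Suc i) k (qmul x y) = (coord_parity (2 ^ Suc i) k x \<noteq> coord_parity (2 ^ Suc i) k y)"
proof -
  define t where "t = (2::int) ^ Suc i"
  have t: "even t" "t \<noteq> 0" by (simp_all add: t_def)
  have ex: "\<exists>p q r s. z = (p, t * q, t * r, t * s) \<and> odd p" if "z \<in> cong_quads i" for z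
  proof -
    obtain p q r s where z: "z = (p, q, r, s)" by (cases z)
    have d: "t dvd q" "t dvd r" "t dvd s" and p: "4 dvd p - 1"
      using that by (simp_all add: z cong_quads_iff t_def)
    have "odd p" using p by presburger
    then show ?thesis using d unfolding z by (auto elim!: dvdE)
  qed
  obtain p q r s where x: "x = (p, t * q, t * r, t * s)" "odd p" using ex[OF assms(1)] by blast
  obtain p' q' r' s' where y: "y = (p', t * q', t * r', t * s')" "odd p'" using ex[OF assms(2)] by blast
  have "qmul x y = (p * p' + t * t * (- q * q' + r * r' + s * s'),
    t * (p * q' + q * p' + t * (s * r' - r * s')), t * (p * r' + r * p' + t * (s * q' - q * s')),
    t * (p * s' + s * p' + t * (q * r' - r * q')))"
    by (simp add: x y algebra_simps)
  then show ?thesis using t x(2) y(2) unfolding t_def[symmetric] coord_parity_def by (auto simp: x(1) y(1))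
qed

lemma cong_quads_Suc_subset: "cong_quads (Suc i) \<subseteq> cong_quads i"
proof -
  have "(2::int) ^ Suc i dvd 2 ^ Suc (Suc i)" by simp
  then show ?thesis using dvd_trans by (fastforce simp: cong_quads_def simp del: power_Suc)
qed

lemma cong_quads_subset: "cong_quads i \<subseteq> cong_quads 0"
proof (induction i)
  case (Suc i)
  then show ?case using cong_quads_Suc_subset[of i] by blast
qed simp

lemma coord_parity_dvd: "t \<noteq> 0 \<Longrightarrow> t dvd coord k x \<Longrightarrow> coord_parity t k x \<longleftrightarrow> \<not> 2 * t dvd coord k x"
  by (auto simp: coord_parity_def elim!: dvdE)

text \<open>The congruence for p follows from the norm equation (p - 1)(p + 1) = r^2 + s^2 - q^2: as
  p is 1 modulo 4, p + 1 is twice an odd number, so all other powers of 2 divide p - 1.\<close>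

lemma cong_quads_Suc_iff:
  "x \<in> cong_quads (Suc i) \<longleftrightarrow> x \<in> cong_quads i \<and> \<not> coord_parity (2 ^ Suc i) 0 x \<and> \<not> coord_parity (2 ^ Suc i) 1 x \<and>
     \<not> coord_parity (2 ^ Suc i) 2 x"
proof -
  obtain p q r s where x: "x = (p, q, r, s)" by (cases x)
  define t where "t = (2::int) ^ Suc i"
  have t: "t \<noteq> 0" "even t" and t2: "2 ^ Suc (Suc i) = 2 * t" by (simp_all add: t_def)
  have "2 * t dvd p - 1" if w: "x \<in> cong_quads i" and qrs: "2 * t dvd q" "2 * t dvd r" "2 * t dvd s"
  proof -
    have p: "p * p + q * q - r * r - s * s = 1" "4 dvd p - 1" using w by (simp_all add: x cong_quads_iff)
    have "2 * t * 2 dvd q * q" "2 * t * 2 dvd r * r" "2 * t * 2 dvd s * s"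
      using mult_dvd_mono[OF qrs(1) dvd_trans[OF _ qrs(1)], of 2]
        mult_dvd_mono[OF qrs(2) dvd_trans[OF _ qrs(2)], of 2]
        mult_dvd_mono[OF qrs(3) dvd_trans[OF _ qrs(3)], of 2] by simp_all
    then have "2 * t * 2 dvd r * r + s * s - q * q" by (intro dvd_add dvd_diff)
    also have "r * r + s * s - q * q = (p - 1) * (p + 1)" using p(1) by (simp add: algebra_simps)
    finally have d: "2 * t * 2 dvd (p - 1) * (p + 1)" .
    obtain m where m: "p = 1 + 4 * m" using p(2) by (metis dvdE add.commute diff_add_cancel)
    have "2 * (2 * t) dvd 2 * ((p - 1) * (1 + 2 * m))"
      using d by (simp add: m algebra_simps)
    then have "2 * t dvd (p - 1) * (1 + 2 * m)" by (simp only: dvd_mult_cancel_left) simp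
    moreover have "coprime (2 * t) (1 + 2 * m)"
      unfolding t2[symmetric] by (subst coprime_power_left_iff) simp
    ultimately show ?thesis by (simp add: coprime_dvd_mult_left_iff)
  qed
  then show ?thesis
    using cong_quads_Suc_subset[of i] coord_parity_dvd[OF t(1), of 0 x] coord_parity_dvd[OF t(1), of 1 x] coord_parity_dvd[OF t(1), of 2 x]
    unfolding x cong_quads_iff t2 t_def[symmetric] by (auto simp: cong_quads_iff t2 t_def[symmetric] simp del: power_Suc)
qed

text \<open>Witnesses that two characters are nontrivial: the first has odd parity at r; the second
  lies in the kernel of that parity and has odd parity at q.\<close>

lemma cong_quads_unipotent_mem:
  "(1, 2 ^ Suc i, - (2 ^ Suc i), 0) \<in> cong_quads i" "(1, 2 ^ Suc i, 0, 2 ^ Suc i) \<in> cong_quads i"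
  by (simp_all add: cong_quads_iff)

text \<open>The product of the upper and the lower unitriangular matrix with corner \<open>2\<^sup>i\<^sup>+\<^sup>1\<close>.\<close>

lemma cong_quads_product_mem:
  assumes "i \<ge> 1"
  shows "(1 + 2 * 4 ^ i, 0, 2 * 4 ^ i, 2 ^ Suc i) \<in> cong_quads i"
proof -
  define u where "u = (2::int) ^ i"
  have "even u" using assms by (simp add: u_def)
  moreover have "(4::int) ^ i = u * u" by (simp add: u_def power_mult_distrib[symmetric])
  ultimately show ?thesis
    by (auto simp: cong_quads_iff u_def[symmetric] algebra_simps elim!: evenE)
qed

text \<open>The first conclusion stops after two kernels, which at level 0 already reaches level 1.
  From level 1 on the third character is nontrivial on what is left.\<close>

lemma cong_quads_step:
  assumes H: "QG\<lparr>carrier := cong_quads i\<rparr> \<cong> free_group {..<Suc n}"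
  shows "QG\<lparr>carrier := {x \<in> cong_quads i. \<not> coord_parity (2 ^ Suc i) 0 x \<and> \<not> coord_parity (2 ^ Suc i) 1 x}\<rparr>
      \<cong> free_group {..<Suc (4 * n)}"
    and "i \<ge> 1 \<Longrightarrow> QG\<lparr>carrier := cong_quads (Suc i)\<rparr> \<cong> free_group {..<Suc (8 * n)}"
proof -
  define t where "t = (2::int) ^ Suc i"
  have t: "t \<noteq> 0" by (simp add: t_def)
  let ?c = "coord_parity t"
  let ?H1 = "{x \<in> cong_quads i. \<not> ?c 0 x}"
  let ?H2 = "{x \<in> ?H1. \<not> ?c 1 x}"
  have m: "?c k (x \<otimes>\<^bsub>QG\<^esub> y) = (?c k x \<noteq> ?c k y)" if "x \<in> cong_quads i" "y \<in> cong_quads i" for k x y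
    using coord_parity_mult[OF that] by (simp add: t_def)
  have "(- 1) * t div t = - 1" by (rule nonzero_mult_div_cancel_right[OF t])
  then have e1: "(1, t, - t, 0) \<in> cong_quads i" "?c 0 (1, t, - t, 0)"
    using cong_quads_unipotent_mem(1)[of i, folded t_def] by (simp_all add: coord_parity_def)
  note H1 = QG.index_two_free_subgroup[OF cong_quads_subgroup H, of "?c 0", OF m e1, simplified]
  have e2: "(1, t, 0, t) \<in> ?H1" "?c 1 (1, t, 0, t)"
    using cong_quads_unipotent_mem(2)[of i, folded t_def] t by (simp_all add: coord_parity_def)
  have m1: "?c k (x \<otimes>\<^bsub>QG\<^esub> y) = (?c k x \<noteq> ?c k y)" if "x \<in> ?H1" "y \<in> ?H1" for k x y
    using m that by auto
  have H2: "subgroup ?H2 QG" "QG\<lparr>carrier := ?H2\<rparr> \<cong> free_group {..<Suc (2 * (2 * n))}"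
    using QG.index_two_free_subgroup[OF H1, of "?c 1", OF m1 e2] by simp_all
  have m2: "?c k (x \<otimes>\<^bsub>QG\<^esub> y) = (?c k x \<noteq> ?c k y)" if "x \<in> ?H2" "y \<in> ?H2" for k x y
    using m that by auto
  have eq: "?H2 = {x \<in> cong_quads i. \<not> ?c 0 x \<and> \<not> ?c 1 x}" by auto
  show "QG\<lparr>carrier := {x \<in> cong_quads i. \<not> coord_parity (2 ^ Suc i) 0 x \<and> \<not> coord_parity (2 ^ Suc i) 1 x}\<rparr>
      \<cong> free_group {..<Suc (4 * n)}"
    using H2(2) unfolding eq t_def[symmetric] by simp
  show "QG\<lparr>carrier := cong_quads (Suc i)\<rparr> \<cong> free_group {..<Suc (8 * n)}" if i: "i \<ge> 1"
  proof -
    have z: "2 * 4 ^ i = t * 2 ^ i" by (simp add: t_def power_mult_distrib[symmetric])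
    \<comment> \<open>This quotient is even because i is at least 1, so the third witness lies in
      both earlier kernels.\<close>
    have "2 * 4 ^ i div t = 2 ^ i" using t by (simp add: z)
    then have e3: "(1 + 2 * 4 ^ i, 0, 2 * 4 ^ i, t) \<in> ?H2" "?c 2 (1 + 2 * 4 ^ i, 0, 2 * 4 ^ i, t)"
      using cong_quads_product_mem[OF i, folded t_def] t i by (simp_all add: coord_parity_def)
    have "{x \<in> ?H2. \<not> ?c 2 x} = cong_quads (Suc i)" using cong_quads_Suc_iff by (auto simp: t_def)
    then show ?thesis
      using QG.index_two_free_subgroup(2)[OF H2, of "?c 2", OF m2 e3] by simp
  qed
qed

text \<open>If 4 divides q and r, the norm equation with p = 1 + 4m and s = 2s' shows that s'^2 is
  even, so 4 divides s as well.\<close>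

lemma cong_quads_1_eq: "{x \<in> cong_quads 0. \<not> coord_parity (2 ^ Suc 0) 0 x \<and> \<not> coord_parity (2 ^ Suc 0) 1 x} = cong_quads 1"
proof -
  have "even (s div 2)" if "(p, q, r, s) \<in> cong_quads 0" "even (r div 2)" "even (q div 2)" for p q r s
  proof -
    have p: "p * p + q * q - r * r - s * s = 1" "4 dvd p - 1" "even q" "even r" "even s"
      using that(1) by (simp_all add: cong_quads_iff)
    define q' where "q' = q div 2 div 2"
    define r' where "r' = r div 2 div 2"
    define s' where "s' = s div 2"
    define m where "m = (p - 1) div 4"
    have e: "q = 2 * (2 * q')" "r = 2 * (2 * r')" "s = 2 * s'" "p = 1 + 4 * m"
      using p that(2,3) by (simp_all add: q'_def r'_def s'_def m_def)
    have "s' * s' = 2 * (m + 2 * (m * m) + 2 * (q' * q') - 2 * (r' * r'))"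
      using p(1) by (simp add: e algebra_simps)
    then have "even (s' * s')" by (simp only: dvd_triv_left)
    then show ?thesis by (simp add: e)
  qed
  then show ?thesis using cong_quads_Suc_iff[of _ 0] by (auto simp: coord_parity_def)
qed

text \<open>Rank minus one starts with 2 at level 0, becomes 4 * 2 = 8 at level 1, and is multiplied
  by 8 at each later level.\<close>

lemma cong_quads_free: "QG\<lparr>carrier := cong_quads (Suc i)\<rparr> \<cong> free_group {..<1 + 8 ^ Suc i :: nat}"
proof (induction i)
  case 0
  have "QG\<lparr>carrier := cong_quads 0\<rparr> \<cong> free_group {..<Suc 2}" using cong_quads_0_free by (simp add: numeral_3_eq_3)
  from cong_quads_step(1)[OF this] show ?case unfolding cong_quads_1_eq by simp
next
  case (Suc i)
  then have "QG\<lparr>carrier := cong_quads (Suc i)\<rparr> \<cong> free_group {..<Suc (8 ^ Suc i)}" by simp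
  from cong_quads_step(2)[OF this] show ?case by simp
qed

section \<open>Units of integral group rings\<close>

locale integral_group_ring = group G for G (structure)
begin

abbreviation R :: "('a \<Rightarrow> int) ring" where "R \<equiv> group_ring G"

abbreviation U :: "('a \<Rightarrow> int) monoid" where "U \<equiv> units_of R"

end

sublocale integral_group_ring \<subseteq> R: ring "group_ring G"
  by (rule ring_group_ring[OF is_group])

sublocale integral_group_ring \<subseteq> U: group "units_of (group_ring G)"
  by (rule R.units_group)

context integral_group_ring
begin

lemma U_simps [simp]: "carrier U = Units R" "x \<otimes>\<^bsub>U\<^esub> y = x \<otimes>\<^bsub>R\<^esub> y" "\<one>\<^bsub>U\<^esub> = \<one>\<^bsub>R\<^esub>"
  by (simp_all add: units_of_def)

lemma inv_U: "x \<in> Units R \<Longrightarrow> inv\<^bsub>U\<^esub> x = inv\<^bsub>R\<^esub> x"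
  by (rule R.units_of_inv)

lemma elt_closed: "g \<in> carrier G \<Longrightarrow> elt g \<in> carrier R"
  by (simp add: group_ring_simps)

lemma elt_mult: "elt g \<otimes>\<^bsub>R\<^esub> elt h = elt (g \<otimes> h)"
proof
  fix x
  have "(elt g \<otimes>\<^bsub>R\<^esub> elt h) x = (if g \<otimes> h = x then 1 else 0)"
    by (simp add: group_ring_def)
  then show "(elt g \<otimes>\<^bsub>R\<^esub> elt h) x = elt (g \<otimes> h) x" by (auto simp: elt_def)
qed

lemma neg_eq: "f \<in> carrier R \<Longrightarrow> \<ominus>\<^bsub>R\<^esub> f = (\<lambda>x. - f x)"
proof -
  assume f: "f \<in> carrier R"
  have "supp (\<lambda>x. - f x) = supp f" by (auto simp: supp_def)
  then have "(\<lambda>x. - f x) \<in> carrier R" using f by (simp add: group_ring_simps)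
  then show ?thesis
    using f by (intro R.minus_equality) (simp_all add: group_ring_simps)
qed

lemma elt_unit:
  assumes "g \<in> carrier G"
  shows "elt g \<in> Units R" "inv\<^bsub>R\<^esub> (elt g) = elt (inv g)"
proof -
  have 1: "elt g \<otimes>\<^bsub>R\<^esub> elt (inv g) = \<one>\<^bsub>R\<^esub>" "elt (inv g) \<otimes>\<^bsub>R\<^esub> elt g = \<one>\<^bsub>R\<^esub>"
    using assms by (simp_all add: elt_mult group_ring_simps)
  then show "elt g \<in> Units R" using assms elt_closed by (auto simp: Units_def)
  then show "inv\<^bsub>R\<^esub> (elt g) = elt (inv g)"
    using 1 assms elt_closed by (intro R.inv_unique'[symmetric]) auto
qed

lemma trivial_units_iff:
  "t \<in> trivial_units G \<longleftrightarrow> (\<exists>g\<in>carrier G. t = elt g \<or> t = \<ominus>\<^bsub>R\<^esub> elt g)"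
  by (auto simp: trivial_units_def)

lemma neg_unit: "u \<in> Units R \<Longrightarrow> \<ominus>\<^bsub>R\<^esub> u \<in> Units R"
  by (metis R.Units_closed R.Units_minus_one_closed R.Units_m_closed R.l_minus R.l_one R.one_closed)

lemma trivial_units_subgroup: "subgroup (trivial_units G) U"
proof (rule U.subgroupI)
  show "trivial_units G \<subseteq> carrier U" using elt_unit neg_unit by (auto simp: trivial_units_iff)
  show "trivial_units G \<noteq> {}" by (auto simp: trivial_units_def)
next
  fix t assume "t \<in> trivial_units G"
  then obtain g where g: "g \<in> carrier G" "t = elt g \<or> t = \<ominus>\<^bsub>R\<^esub> elt g" by (auto simp: trivial_units_iff)
  have u: "elt g \<in> Units R" "\<ominus>\<^bsub>R\<^esub> elt g \<in> Units R" using g elt_unit neg_unit by blast+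
  have "inv\<^bsub>R\<^esub> (\<ominus>\<^bsub>R\<^esub> elt g) = \<ominus>\<^bsub>R\<^esub> elt (inv g)"
    using g elt_closed by (intro R.inv_unique'[symmetric])
      (auto simp: R.l_minus R.r_minus elt_mult group_ring_simps(2))
  then have "inv\<^bsub>R\<^esub> t = elt (inv g) \<or> inv\<^bsub>R\<^esub> t = \<ominus>\<^bsub>R\<^esub> elt (inv g)"
    using g elt_unit by auto
  then show "inv\<^bsub>U\<^esub> t \<in> trivial_units G"
    using g u inv_U[of t] by (auto simp: trivial_units_iff)
next
  fix s t assume "s \<in> trivial_units G" "t \<in> trivial_units G"
  then obtain g h where g: "g \<in> carrier G" "s = elt g \<or> s = \<ominus>\<^bsub>R\<^esub> elt g"
    and h: "h \<in> carrier G" "t = elt h \<or> t = \<ominus>\<^bsub>R\<^esub> elt h"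
    by (auto simp: trivial_units_iff)
  have "s \<otimes>\<^bsub>R\<^esub> t = elt (g \<otimes> h) \<or> s \<otimes>\<^bsub>R\<^esub> t = \<ominus>\<^bsub>R\<^esub> elt (g \<otimes> h)"
    using g h elt_closed by (auto simp: R.l_minus R.r_minus elt_mult)
  then show "s \<otimes>\<^bsub>U\<^esub> t \<in> trivial_units G" using g h by (auto simp: trivial_units_iff)
qed

lemma add_pow_eq: "f \<in> carrier R \<Longrightarrow> add_pow R (n :: nat) f = (\<lambda>x. int n * f x)"
proof (induction n)
  case 0
  then show ?case by (simp add: group_ring_simps(3))
next
  case (Suc n)
  then show ?case by (simp add: group_ring_simps(4) algebra_simps)
qed

lemma cong_units_iff:
  "x \<in> cong_units G i \<longleftrightarrow> x \<in> Units R \<and> (\<forall>y\<in>carrier G. 2 ^ i dvd x y - elt \<one> y)"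
proof
  assume "x \<in> cong_units G i"
  then obtain u where u: "u \<in> carrier R" "x = \<one>\<^bsub>R\<^esub> \<oplus>\<^bsub>R\<^esub> add_pow R ((2::nat) ^ i) u" "x \<in> Units R"
    by (auto simp: cong_units_def Let_def)
  then have "x = (\<lambda>y. elt \<one> y + 2 ^ i * u y)"
    using add_pow_eq by (simp add: group_ring_simps(2,4))
  then show "x \<in> Units R \<and> (\<forall>y\<in>carrier G. 2 ^ i dvd x y - elt \<one> y)" using u(3) by simp
next
  assume x: "x \<in> Units R \<and> (\<forall>y\<in>carrier G. 2 ^ i dvd x y - elt \<one> y)"
  then have xc: "x \<in> carrier R" by auto
  define u where "u y = (x y - elt \<one> y) div 2 ^ i" for y
  have z: "x y = 0" "elt \<one> y = 0" if "y \<notin> carrier G" for y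
    using xc that by (auto simp: group_ring_simps supp_def elt_def)
  have "supp u \<subseteq> supp x \<union> {\<one>}" by (auto simp: supp_def u_def elt_def)
  moreover have "finite (supp x)" "supp x \<subseteq> carrier G" using xc by (auto simp: group_ring_simps)
  ultimately have u: "u \<in> carrier R" unfolding group_ring_simps
    by (metis finite.emptyI finite_UnI finite_insert finite_subset insert_subset le_sup_iff one_closed
        order_trans empty_subsetI Un_subset_iff)
  have "x y = elt \<one> y + 2 ^ i * u y" for y
    using x z[of y] by (cases "y \<in> carrier G") (auto simp: u_def)
  then have "x = \<one>\<^bsub>R\<^esub> \<oplus>\<^bsub>R\<^esub> add_pow R ((2::nat) ^ i) u"
    using add_pow_eq[OF u] by (auto simp: group_ring_simps(2,4))
  then show "x \<in> cong_units G i" using x u by (auto simp: cong_units_def Let_def)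
qed

end

section \<open>The dihedral group of order eight\<close>

text \<open>For \<open>i < 4\<close> the index \<open>i\<close> stands for \<open>a\<^sup>i\<close> and the index \<open>4 + i\<close> for \<open>a\<^sup>i b\<close>.\<close>

definition dihedral_index :: "nat \<Rightarrow> nat \<Rightarrow> nat" where
  "dihedral_index i j = (if i < 4 then (if j < 4 then (i + j) mod 4 else 4 + (i + j) mod 4)
     else (if j < 4 then 4 + (i + 4 - j) mod 4 else (i + 4 - j) mod 4))"

lemma dihedral_index_less: "dihedral_index i j < 8"
proof -
  have "m mod 4 < 8" for m :: nat by (rule less_trans[OF mod_less_divisor]) simp_all
  then show ?thesis by (simp add: dihedral_index_def)
qed

lemma sum_lessThan_8: "(\<Sum>i<8. F i) = F 0 + F 1 + F 2 + F 3 + F 4 + F 5 + F 6 + F (7::nat)"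
  for F :: "nat \<Rightarrow> int"
  by (simp add: eval_nat_numeral)

lemma less_8_iff: "k < 8 \<longleftrightarrow> k = 0 \<or> k = 1 \<or> k = 2 \<or> k = 3 \<or> k = 4 \<or> k = 5 \<or> k = 6 \<or> k = (7::nat)"
  by auto

text \<open>Only a multiplication table is assumed, because the results are applied both to the
  presented group and to its copy inside the product with an elementary abelian group.\<close>

locale dihedral8 = integral_group_ring G for G (structure) +
  fixes e :: "nat \<Rightarrow> 'a"
  assumes inj: "inj_on e {..<8}" and carrier_eq: "carrier G = e ` {..<8}"
    and mult: "i < 8 \<Longrightarrow> j < 8 \<Longrightarrow> e i \<otimes> e j = e (dihedral_index i j)"
begin

lemma e_carrier [simp]: "i < 8 \<Longrightarrow> e i \<in> carrier G"
  by (simp add: carrier_eq)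

lemma e_eq: "i < 8 \<Longrightarrow> j < 8 \<Longrightarrow> e i = e j \<longleftrightarrow> i = j"
  using inj by (auto simp: inj_on_def)

lemma one_eq: "\<one> = e 0"
  using mult[of 0 0] by (simp add: dihedral_index_def)

lemma mult_coeff:
  assumes "f \<in> carrier R" "g \<in> carrier R" "k < 8"
  shows "(f \<otimes>\<^bsub>R\<^esub> g) (e k) = (\<Sum>i<8. \<Sum>j<8. if dihedral_index i j = k then f (e i) * g (e j) else 0)"
proof -
  have "(f \<otimes>\<^bsub>R\<^esub> g) (e k)
      = (\<Sum>y\<in>e ` {..<8}. \<Sum>z\<in>e ` {..<8}. if y \<otimes> z = e k then f y * g z else 0)"
    using assms by (intro group_ring_mult) (auto simp: group_ring_simps carrier_eq)
  also have "\<dots> = (\<Sum>i<8. \<Sum>j<8. if e i \<otimes> e j = e k then f (e i) * g (e j) else 0)"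
    by (simp add: sum.reindex[OF inj])
  also have "\<dots> = (\<Sum>i<8. \<Sum>j<8. if dihedral_index i j = k then f (e i) * g (e j) else 0)"
    using assms(3) by (intro sum.cong refl) (simp add: mult e_eq dihedral_index_less)
  finally show ?thesis .
qed

text \<open>Two ring homomorphisms that are jointly injective: reduction modulo \<open>a\<^sup>2 = 1\<close> (with coordinates
  \<open>1, a, b, ab\<close>) and modulo \<open>a\<^sup>2 = -1\<close>.\<close>

definition lin :: "('a \<Rightarrow> int) \<Rightarrow> quad" where
  "lin f = (f (e 0) + f (e 2), f (e 1) + f (e 3), f (e 4) + f (e 6), f (e 5) + f (e 7))"

definition quat :: "('a \<Rightarrow> int) \<Rightarrow> quad" where
  "quat f = (f (e 0) - f (e 2), f (e 1) - f (e 3), f (e 4) - f (e 6), f (e 5) - f (e 7))"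

end

text \<open>Multiplication in the integral group ring of the Klein four-group with basis 1, a, b,
  ab; \<open>axis\<close> below lists its trivial units.\<close>

fun lmul :: "quad \<Rightarrow> quad \<Rightarrow> quad" where
  "lmul (p, q, r, s) (p', q', r', s') =
     (p * p' + q * q' + r * r' + s * s', p * q' + q * p' + r * s' + s * r',
      p * r' + r * p' + q * s' + s * q', p * s' + s * p' + q * r' + r * q')"

fun qadd :: "quad \<Rightarrow> quad \<Rightarrow> quad" where
  "qadd (p, q, r, s) (p', q', r', s') = (p + p', q + q', r + r', s + s')"

fun qneg :: "quad \<Rightarrow> quad" where
  "qneg (p, q, r, s) = (- p, - q, - r, - s)"

definition axis :: "quad set" where
  "axis = {(1, 0, 0, 0), (0, 1, 0, 0), (0, 0, 1, 0), (0, 0, 0, 1),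
     (-1, 0, 0, 0), (0, -1, 0, 0), (0, 0, -1, 0), (0, 0, 0, -1)}"

text \<open>The four characters of the Klein four-group send a unit to 1 or -1. Adding the squares
  of the four values (Parseval) gives sum of squares 1 for the coordinates.\<close>

lemma lmul_unit:
  assumes "lmul x y = (1, 0, 0, 0)"
  shows "x \<in> axis"
proof -
  obtain p q r s where x: "x = (p, q, r, s)" by (cases x)
  obtain p' q' r' s' where y: "y = (p', q', r', s')" by (cases y)
  have "(p + q + r + s) * (p' + q' + r' + s') = 1" "(p + q - r - s) * (p' + q' - r' - s') = 1"
    "(p - q + r - s) * (p' - q' + r' - s') = 1" "(p - q - r + s) * (p' - q' - r' + s') = 1"
    using assms unfolding x y by (simp_all add: algebra_simps)
  then have c: "\<bar>p + q + r + s\<bar> = 1" "\<bar>p + q - r - s\<bar> = 1" "\<bar>p - q + r - s\<bar> = 1" "\<bar>p - q - r + s\<bar> = 1"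
    by (auto simp: zmult_eq_1_iff)
  have sq: "p * p + q * q + r * r + s * s = 1"
    using abs_one_square[OF c(1)] abs_one_square[OF c(2)] abs_one_square[OF c(3)]
      abs_one_square[OF c(4)] by (simp add: algebra_simps)
  have one: "z = 0 \<or> z = 1 \<or> z = - 1" if "z * z \<le> 1" for z :: int
  proof (rule ccontr)
    assume "\<not> ?thesis"
    then have "2 * 2 \<le> \<bar>z\<bar> * \<bar>z\<bar>" by (intro mult_mono) auto
    then show False using that by simp
  qed
  have "0 \<le> p * p" "0 \<le> q * q" "0 \<le> r * r" "0 \<le> s * s" by simp_all
  then have "p * p \<le> 1" "q * q \<le> 1" "r * r \<le> 1" "s * s \<le> 1" using sq by linarith+
  from one[OF this(1)] one[OF this(2)] one[OF this(3)] one[OF this(4)] show ?thesis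
    using sq unfolding x axis_def by (elim disjE) simp_all
qed

section \<open>The two quotient maps and the lifting of quadruples\<close>

context dihedral8
begin

lemma lin_mult: "f \<in> carrier R \<Longrightarrow> g \<in> carrier R \<Longrightarrow> lin (f \<otimes>\<^bsub>R\<^esub> g) = lmul (lin f) (lin g)"
  by (simp add: lin_def mult_coeff sum_lessThan_8 dihedral_index_def algebra_simps)

lemma quat_mult: "f \<in> carrier R \<Longrightarrow> g \<in> carrier R \<Longrightarrow> quat (f \<otimes>\<^bsub>R\<^esub> g) = qmul (quat f) (quat g)"
  by (simp add: quat_def mult_coeff sum_lessThan_8 dihedral_index_def algebra_simps)

lemma lin_add: "lin (f \<oplus>\<^bsub>R\<^esub> g) = qadd (lin f) (lin g)"
  by (simp add: lin_def group_ring_simps)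

lemma quat_add: "quat (f \<oplus>\<^bsub>R\<^esub> g) = qadd (quat f) (quat g)"
  by (simp add: quat_def group_ring_simps)

lemma lin_neg: "f \<in> carrier R \<Longrightarrow> lin (\<ominus>\<^bsub>R\<^esub> f) = qneg (lin f)"
  by (simp add: lin_def neg_eq)

lemma quat_neg: "f \<in> carrier R \<Longrightarrow> quat (\<ominus>\<^bsub>R\<^esub> f) = qneg (quat f)"
  by (simp add: quat_def neg_eq)

lemma elt_e: "i < 8 \<Longrightarrow> j < 8 \<Longrightarrow> elt (e i) (e j) = (if i = j then 1 else 0)"
  by (simp add: elt_def e_eq)

lemma lin_elt:
  "lin (elt (e 0)) = (1, 0, 0, 0)" "lin (elt (e 1)) = (0, 1, 0, 0)"
  "lin (elt (e 2)) = (1, 0, 0, 0)" "lin (elt (e 3)) = (0, 1, 0, 0)"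
  "lin (elt (e 4)) = (0, 0, 1, 0)" "lin (elt (e 5)) = (0, 0, 0, 1)"
  "lin (elt (e 6)) = (0, 0, 1, 0)" "lin (elt (e 7)) = (0, 0, 0, 1)"
  by (simp_all add: lin_def elt_e)

lemma quat_elt:
  "quat (elt (e 0)) = (1, 0, 0, 0)" "quat (elt (e 1)) = (0, 1, 0, 0)"
  "quat (elt (e 2)) = (-1, 0, 0, 0)" "quat (elt (e 3)) = (0, -1, 0, 0)"
  "quat (elt (e 4)) = (0, 0, 1, 0)" "quat (elt (e 5)) = (0, 0, 0, 1)"
  "quat (elt (e 6)) = (0, 0, -1, 0)" "quat (elt (e 7)) = (0, 0, 0, -1)"
  by (simp_all add: quat_def elt_e)

lemma lin_one: "lin \<one>\<^bsub>R\<^esub> = (1, 0, 0, 0)" and quat_one: "quat \<one>\<^bsub>R\<^esub> = (1, 0, 0, 0)"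
  by (simp_all add: group_ring_simps one_eq lin_elt quat_elt)

lemma coeff_eqI:
  assumes "f \<in> carrier R" "g \<in> carrier R" "lin f = lin g" "quat f = quat g"
  shows "f = g"
proof
  fix x
  show "f x = g x"
  proof (cases "x \<in> carrier G")
    case True
    then obtain k where "x = e k" "k < 8" by (auto simp: carrier_eq)
    then show ?thesis using assms(3,4) unfolding lin_def quat_def less_8_iff by auto
  next
    case False
    then have "x \<notin> supp f" "x \<notin> supp g" using assms(1,2) by (auto simp: group_ring_simps)
    then show ?thesis by (simp add: supp_def)
  qed
qed

text \<open>Equality of parities is the only obstruction to solving for the coefficients. With
  \<open>coeff_eqI\<close> this makes the group ring a fibre product over the integers modulo
  2.\<close>

lemma coeff_exists:
  assumes "even (l0 - p)" "even (l1 - q)" "even (l2 - r)" "even (l3 - s)"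
  shows "\<exists>f \<in> carrier R. lin f = (l0, l1, l2, l3) \<and> quat f = (p, q, r, s)"
proof -
  define c where "c k = [(l0 + p) div 2, (l1 + q) div 2, (l0 - p) div 2, (l1 - q) div 2,
    (l2 + r) div 2, (l3 + s) div 2, (l2 - r) div 2, (l3 - s) div 2] ! k" for k
  define f where "f x = (if x \<in> carrier G then c (inv_into {..<8} e x) else 0)" for x
  have fe: "f (e k) = c k" if "k < 8" for k
    using that by (simp add: f_def inv_into_f_f[OF inj])
  have "supp f \<subseteq> carrier G" by (auto simp: supp_def f_def)
  moreover have "finite (carrier G)" by (simp add: carrier_eq)
  ultimately have "f \<in> carrier R" by (auto simp: group_ring_simps intro: finite_subset)
  moreover have "lin f = (l0, l1, l2, l3)" "quat f = (p, q, r, s)"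
    unfolding lin_def quat_def using assms by (simp_all add: fe c_def) presburger+
  ultimately show ?thesis by blast
qed

lemma lin_unit: "u \<in> Units R \<Longrightarrow> lin u \<in> axis"
  by (rule lmul_unit[of _ "lin (inv\<^bsub>R\<^esub> u)"])
    (simp add: lin_mult[symmetric] R.Units_closed lin_one)

lemma quat_unit: "u \<in> Units R \<Longrightarrow> \<bar>qnorm (quat u)\<bar> = 1"
proof -
  assume u: "u \<in> Units R"
  have "qmul (quat u) (quat (inv\<^bsub>R\<^esub> u)) = (1, 0, 0, 0)"
    using u by (simp add: quat_mult[symmetric] R.Units_closed quat_one)
  then have "qnorm (quat u) * qnorm (quat (inv\<^bsub>R\<^esub> u)) = 1"
    unfolding qnorm_qmul[symmetric] by simp
  then show ?thesis by (auto simp: zmult_eq_1_iff)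
qed

lemma quat_hom: "quat \<in> hom U QG"
  by (auto simp: hom_def quat_unit quat_mult R.Units_closed)

lemma quat_group_hom: "group_hom U QG quat"
  by (simp add: group_hom_def group_hom_axioms_def quat_hom U.is_group QG.is_group)

lemma parity:
  assumes "lin u = (l0, l1, l2, l3)" "quat u = (p, q, r, s)"
  shows "even (l0 - p)" "even (l1 - q)" "even (l2 - r)" "even (l3 - s)"
  using assms unfolding lin_def quat_def by auto

definition lift :: "quad set \<Rightarrow> ('a \<Rightarrow> int) set" where
  "lift H = {u \<in> carrier R. lin u = (1, 0, 0, 0) \<and> quat u \<in> H}"

lemma lift_units: "H \<subseteq> cong_quads 0 \<Longrightarrow> lift H \<subseteq> Units R"
proof
  fix u assume "H \<subseteq> cong_quads 0" "u \<in> lift H"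
  then have u: "u \<in> carrier R" "lin u = (1, 0, 0, 0)" "quat u \<in> cong_quads 0" by (auto simp: lift_def)
  obtain p q r s where x: "quat u = (p, q, r, s)" by (cases "quat u")
  have n: "p * p + q * q - r * r - s * s = 1" "4 dvd p - 1" "even q" "even r" "even s"
    using u(3) by (simp_all add: x cong_quads_iff)
  have "even (1 - p)" "even (0 - (- q))" "even (0 - (- r))" "even (0 - (- s))"
    using n(3-5) parity[OF u(2) x] by auto
  \<comment> \<open>The conjugate quadruple is the inverse for norm 1, and it has the parities
    required for lifting.\<close>
  then obtain v where v: "v \<in> carrier R" "lin v = (1, 0, 0, 0)" "quat v = (p, - q, - r, - s)"
    using coeff_exists by blast
  have "u \<otimes>\<^bsub>R\<^esub> v = \<one>\<^bsub>R\<^esub>" "v \<otimes>\<^bsub>R\<^esub> u = \<one>\<^bsub>R\<^esub>"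
    using u v n(1) by (auto intro!: coeff_eqI simp: lin_mult quat_mult lin_one quat_one x algebra_simps)
  then show "u \<in> Units R" using u v by (auto simp: Units_def)
qed

lemma lift_iso:
  assumes "H \<subseteq> cong_quads 0"
  shows "quat \<in> iso (U\<lparr>carrier := lift H\<rparr>) (QG\<lparr>carrier := H\<rparr>)"
proof -
  have "inj_on quat (lift H)" by (rule inj_onI) (auto intro: coeff_eqI simp: lift_def)
  moreover have "H \<subseteq> quat ` lift H"
  proof
    fix x assume x: "x \<in> H"
    obtain p q r s where e: "x = (p, q, r, s)" by (cases x)
    have n: "4 dvd p - 1" "even q" "even r" "even s" using x assms by (auto simp: e cong_quads_iff)
    have "even (1 - p)" using n(1) by presburger
    then obtain u where "u \<in> carrier R" "lin u = (1, 0, 0, 0)" "quat u = x"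
      using coeff_exists[of 1 p 0 q 0 r 0 s] n by (auto simp: e)
    then show "x \<in> quat ` lift H" using x by (auto simp: lift_def)
  qed
  ultimately show ?thesis
    by (auto simp: iso_def hom_def bij_betw_def quat_mult lift_def)
qed

lemma lift_subgroup:
  assumes "H \<subseteq> cong_quads 0" "subgroup H QG"
  shows "subgroup (lift H) U"
proof -
  interpret q: group_hom U QG quat by (rule quat_group_hom)
  show ?thesis
  proof (rule U.subgroupI)
    show "lift H \<subseteq> carrier U" using lift_units[OF assms(1)] by simp
    have "\<one>\<^bsub>R\<^esub> \<in> lift H"
      using subgroup.one_closed[OF assms(2)] by (simp add: lift_def lin_one quat_one)
    then show "lift H \<noteq> {}" by blast
  next
    fix u assume u: "u \<in> lift H"
    then have uU: "u \<in> Units R" using lift_units[OF assms(1)] by blast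
    have "lmul (lin u) (lin (inv\<^bsub>R\<^esub> u)) = (1, 0, 0, 0)"
      using uU by (simp add: lin_mult[symmetric] R.Units_closed lin_one)
    then have "lin (inv\<^bsub>R\<^esub> u) = (1, 0, 0, 0)"
      using u by (cases "lin (inv\<^bsub>R\<^esub> u)") (simp add: lift_def)
    moreover have "quat (inv\<^bsub>R\<^esub> u) \<in> H"
      using q.hom_inv[of u] uU u subgroup.m_inv_closed[OF assms(2)] by (simp add: lift_def inv_U)
    ultimately show "inv\<^bsub>U\<^esub> u \<in> lift H" using uU by (simp add: lift_def inv_U)
  next
    fix u v assume "u \<in> lift H" "v \<in> lift H"
    then show "u \<otimes>\<^bsub>U\<^esub> v \<in> lift H"
      using subgroup.m_closed[OF assms(2)] by (simp add: lift_def lin_mult quat_mult)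
  qed
qed

end

text \<open>The recursion for the scalar part is P p + Q (r^2 + s^2 - q^2), and the norm equation
  turns the bracket into p^2 - 1, which is nonnegative. So both multipliers stay positive.\<close>

lemma qpow_pos:
  assumes "p * p + q * q - r * r - s * s = 1" "p \<ge> 1"
  shows "\<exists>P Q. P \<ge> 1 \<and> Q \<ge> 1 \<and> (p, q, r, s) [^]\<^bsub>QG\<^esub> Suc k = (P, Q * q, Q * r, Q * s)"
proof (induction k)
  case 0
  show ?case using assms(2) by (intro exI[of _ p] exI[of _ 1]) (simp add: qmul_one)
next
  case (Suc k)
  then obtain P Q where PQ: "P \<ge> 1" "Q \<ge> 1"
    "(p, q, r, s) [^]\<^bsub>QG\<^esub> Suc k = (P, Q * q, Q * r, Q * s)" by blast
  have "1 * 1 \<le> p * p" using assms(2) by (intro mult_mono) auto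
  then have "0 \<le> Q * (p * p - 1)" using PQ by simp
  moreover have "1 * 1 \<le> P * p" "1 * 1 \<le> p * Q" using PQ assms(2) by (intro mult_mono; auto)+
  moreover have "r * r + s * s - q * q = p * p - 1" using assms(1) by linarith
  then have "Q * (r * r + s * s - q * q) = Q * (p * p - 1)" by simp
  ultimately have "P * p + Q * (r * r + s * s - q * q) \<ge> 1" "P + p * Q \<ge> 1" using PQ by linarith+
  moreover have "(p, q, r, s) [^]\<^bsub>QG\<^esub> Suc (Suc k)
      = (P * p + Q * (r * r + s * s - q * q), (P + p * Q) * q, (P + p * Q) * r, (P + p * Q) * s)"
    unfolding QG.nat_pow_Suc[of _ "Suc k"] PQ(3) by (simp add: algebra_simps)
  ultimately show ?case by blast
qed

text \<open>Squaring first makes the scalar part 2 p^2 - 1 positive, so that \<open>qpow_pos\<close>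
  applies. Scalar part 0 must be excluded: the image (0, 1, 0, 0) of a has order 4.\<close>

lemma torsion_quad:
  assumes x: "qnorm (p, q, r, s) = 1" "p \<noteq> 0" and k: "k > 0" "(p, q, r, s) [^]\<^bsub>QG\<^esub> (k :: nat) = \<one>\<^bsub>QG\<^esub>"
  shows "q = 0" "r = 0" "s = 0"
proof -
  let ?x = "(p, q, r, s)"
  let ?y = "(2 * (p * p) - 1, (2 * p) * q, (2 * p) * r, (2 * p) * s)"
  have n: "p * p + q * q - r * r - s * s = 1" using x(1) by simp
  have xc: "?x \<in> carrier QG" using x(1) by (simp del: qnorm.simps)
  have xx: "qmul ?x ?x = ?y" using n by (simp add: algebra_simps)
  have "?y [^]\<^bsub>QG\<^esub> k = (?x [^]\<^bsub>QG\<^esub> (2::nat)) [^]\<^bsub>QG\<^esub> k"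
    using xc by (simp add: numeral_2_eq_2 qmul_one xx[symmetric] del: qmul.simps)
  also have "\<dots> = (?x [^]\<^bsub>QG\<^esub> k) [^]\<^bsub>QG\<^esub> (2::nat)"
    by (simp only: QG.nat_pow_pow[OF xc] mult.commute)
  finally have y: "?y [^]\<^bsub>QG\<^esub> k = (1, 0, 0, 0)" by (simp only: k(2) QG.nat_pow_one) simp
  have "qnorm ?y = 1" using qnorm_qmul[of ?x ?x] x(1) unfolding xx by simp
  then have n': "(2 * (p * p) - 1) * (2 * (p * p) - 1) + (2 * p * q) * (2 * p * q)
      - (2 * p * r) * (2 * p * r) - (2 * p * s) * (2 * p * s) = 1"
    by (simp only: qnorm.simps)
  have "0 < p * p" using x(2) by (auto simp: zero_less_mult_iff)
  then have ge: "1 \<le> 2 * (p * p) - 1" by linarith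
  obtain k' where k': "k = Suc k'" using k(1) by (cases k) auto
  from qpow_pos[OF n' ge, of k'] obtain P Q where PQ: "Q \<ge> 1"
    "?y [^]\<^bsub>QG\<^esub> Suc k' = (P, Q * (2 * p * q), Q * (2 * p * r), Q * (2 * p * s))" by blast
  have "(P, Q * (2 * p * q), Q * (2 * p * r), Q * (2 * p * s)) = (1, 0, 0, 0)"
    using y PQ(2) unfolding k' by (simp only:)
  then show "q = 0" "r = 0" "s = 0" using x(2) PQ(1) by auto
qed

text \<open>The first coordinate is half the trace of the matrix. Its invariance under conjugation
  yields normality of the complement.\<close>

lemma qmul_fst_commute: "fst (qmul x y) = fst (qmul y x)"
  by (cases x; cases y) simp

context integral_group_ring
begin

definition torsion_cong_trivial :: bool where
  "torsion_cong_trivial \<longleftrightarrow> (\<forall>u\<in>Units R. \<forall>k::nat. k > 0 \<longrightarrow> u [^]\<^bsub>U\<^esub> k = \<one>\<^bsub>U\<^esub> \<longrightarrow>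
     (\<forall>y\<in>carrier G. even (u y - elt \<one> y)) \<longrightarrow> u = \<one>\<^bsub>R\<^esub> \<or> u = \<ominus>\<^bsub>R\<^esub> \<one>\<^bsub>R\<^esub>)"

lemma tilde_involution:
  assumes "h \<in> carrier G" "h \<otimes> h = \<one>" "h \<noteq> \<one>"
  shows "tilde G h = elt h \<oplus>\<^bsub>R\<^esub> \<one>\<^bsub>R\<^esub>"
proof -
  have h2: "h [^] (2::nat) = \<one>" using assms by (simp add: numeral_2_eq_2)
  then have "ord h dvd 2" using assms(1) by (simp add: pow_eq_id)
  moreover have "ord h \<noteq> 1" using ord_eq_1[OF assms(1)] assms(3) by metis
  ultimately have o: "ord h = 2" using prime_nat_iff two_is_prime_nat by blast
  have "{1..ord h} = insert 1 {2}" unfolding o by auto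
  then show ?thesis
    using assms h2 elt_closed
    by (simp add: tilde_def R.finsum_insert group_ring_simps(2) Pi_def)
qed

end

section \<open>The normal complement of the trivial units\<close>

context dihedral8
begin

text \<open>With p congruent to 1 modulo 4 and q, r, s even, the norm is 1 modulo 4, so -1 is
  impossible. What remains are conditions that are visibly invariant under conjugation.\<close>

lemma lift_cong_quads_0_iff:
  "u \<in> lift (cong_quads 0) \<longleftrightarrow> u \<in> Units R \<and> lin u = (1, 0, 0, 0) \<and> 4 dvd fst (quat u) - 1"
proof
  assume u: "u \<in> lift (cong_quads 0)"
  then show "u \<in> Units R \<and> lin u = (1, 0, 0, 0) \<and> 4 dvd fst (quat u) - 1"
    using lift_units[of "cong_quads 0"] by (cases "quat u") (auto simp: lift_def cong_quads_iff)
next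
  assume u: "u \<in> Units R \<and> lin u = (1, 0, 0, 0) \<and> 4 dvd fst (quat u) - 1"
  obtain p q r s where x: "quat u = (p, q, r, s)" by (cases "quat u")
  have p: "4 dvd p - 1" and l: "lin u = (1, 0, 0, 0)" using u x by simp_all
  have ev: "even (p - 1)" "even q" "even r" "even s" using parity[OF l x] by simp_all
  then obtain q' r' s' where e: "q = 2 * q'" "r = 2 * r'" "s = 2 * s'" by (auto elim!: evenE)
  obtain m where m: "p = 1 + 4 * m" using p by (metis dvdE add.commute diff_add_cancel)
  have "qnorm (quat u) = 1 + 4 * (2 * m + 4 * (m * m) + q' * q' - r' * r' - s' * s')"
    by (simp add: x e m algebra_simps)
  moreover have "\<bar>qnorm (quat u)\<bar> = 1" using quat_unit u by blast
  ultimately have "qnorm (quat u) = 1" by presburger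
  then show "u \<in> lift (cong_quads 0)"
    using u p ev by (simp add: lift_def x cong_quads_iff R.Units_closed)
qed

lemma lin_inv:
  assumes "u \<in> Units R"
  shows "lmul (lin u) (lin (inv\<^bsub>R\<^esub> u)) = (1, 0, 0, 0)"
  using assms by (simp add: lin_mult[symmetric] R.Units_closed lin_one)

lemma lmul_one: "lmul (1, 0, 0, 0) x = x" "lmul x (1, 0, 0, 0) = x"
  by (cases x; simp)+

lemma lift_cong_quads_0_normal: "lift (cong_quads 0) \<lhd> U"
  unfolding U.normal_inv_iff
proof (intro conjI ballI)
  show "subgroup (lift (cong_quads 0)) U" by (rule lift_subgroup[OF order_refl cong_quads_subgroup])
  fix u h assume u: "u \<in> carrier U" and h: "h \<in> lift (cong_quads 0)"
  define v where "v = inv\<^bsub>R\<^esub> u"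
  have uU: "u \<in> Units R" "v \<in> Units R" using u by (simp_all add: v_def)
  have hU: "h \<in> Units R" using h lift_cong_quads_0_iff by blast
  have c: "u \<in> carrier R" "v \<in> carrier R" "h \<in> carrier R" using uU hU by auto
  have "lin (u \<otimes>\<^bsub>R\<^esub> h \<otimes>\<^bsub>R\<^esub> v) = (1, 0, 0, 0)"
    using h lin_inv[OF uU(1)] c by (simp add: lin_mult lift_cong_quads_0_iff lmul_one v_def)
  moreover have "fst (quat (u \<otimes>\<^bsub>R\<^esub> h \<otimes>\<^bsub>R\<^esub> v)) = fst (quat h)"
  proof -
    have "fst (quat (u \<otimes>\<^bsub>R\<^esub> h \<otimes>\<^bsub>R\<^esub> v)) = fst (quat (v \<otimes>\<^bsub>R\<^esub> (u \<otimes>\<^bsub>R\<^esub> h)))"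
      using c by (simp add: quat_mult qmul_fst_commute)
    also have "v \<otimes>\<^bsub>R\<^esub> (u \<otimes>\<^bsub>R\<^esub> h) = h"
      using c uU(1) by (simp add: R.m_assoc[symmetric] v_def)
    finally show ?thesis .
  qed
  moreover have "u \<otimes>\<^bsub>R\<^esub> h \<otimes>\<^bsub>R\<^esub> v \<in> Units R" using uU hU by blast
  ultimately show "u \<otimes>\<^bsub>U\<^esub> h \<otimes>\<^bsub>U\<^esub> inv\<^bsub>U\<^esub> u \<in> lift (cong_quads 0)"
    using h uU(1) by (simp add: lift_cong_quads_0_iff inv_U v_def)
qed

lemma trivial_unit_lin:
  assumes "x \<in> axis"
  shows "\<exists>t\<in>trivial_units G. lin t = x"
proof -
  have p: "\<exists>t\<in>trivial_units G. lin t = lin (elt (e i))"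
    "\<exists>t\<in>trivial_units G. lin t = qneg (lin (elt (e i)))" if "i < 8" for i
  proof -
    have "elt (e i) \<in> trivial_units G" "\<ominus>\<^bsub>R\<^esub> elt (e i) \<in> trivial_units G"
      using e_carrier[OF that] unfolding trivial_units_iff by blast+
    then show "\<exists>t\<in>trivial_units G. lin t = lin (elt (e i))"
      "\<exists>t\<in>trivial_units G. lin t = qneg (lin (elt (e i)))"
      using lin_neg[OF elt_closed[OF e_carrier[OF that]]] by blast+
  qed
  have q: "\<exists>t\<in>trivial_units G. lin t = (1, 0, 0, 0)" "\<exists>t\<in>trivial_units G. lin t = (-1, 0, 0, 0)"
    "\<exists>t\<in>trivial_units G. lin t = (0, 1, 0, 0)" "\<exists>t\<in>trivial_units G. lin t = (0, -1, 0, 0)"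
    "\<exists>t\<in>trivial_units G. lin t = (0, 0, 1, 0)" "\<exists>t\<in>trivial_units G. lin t = (0, 0, -1, 0)"
    "\<exists>t\<in>trivial_units G. lin t = (0, 0, 0, 1)" "\<exists>t\<in>trivial_units G. lin t = (0, 0, 0, -1)"
    using p[of 0] p[of 1] p[of 4] p[of 5] unfolding lin_elt by simp_all
  show ?thesis using assms q unfolding axis_def by (elim insertE) simp_all
qed

lemma lift_cong_quads_0_complement: "internal_semidirect U (lift (cong_quads 0)) (trivial_units G)"
  unfolding internal_semidirect_def
proof (intro conjI)
  show "lift (cong_quads 0) \<lhd> U" by (rule lift_cong_quads_0_normal)
  show "subgroup (trivial_units G) U" by (rule trivial_units_subgroup)
  have e2: "elt (e 2) \<in> Units R" "elt (e 2) \<in> trivial_units G"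
    by (auto simp: elt_unit trivial_units_iff)
  have e22: "elt (e 2) \<otimes>\<^bsub>R\<^esub> elt (e 2) = \<one>\<^bsub>R\<^esub>"
    by (simp add: elt_mult mult dihedral_index_def group_ring_simps one_eq)
  show "lift (cong_quads 0) \<inter> trivial_units G = {\<one>\<^bsub>U\<^esub>}"
  proof
    show "{\<one>\<^bsub>U\<^esub>} \<subseteq> lift (cong_quads 0) \<inter> trivial_units G"
      using subgroup.one_closed[OF lift_subgroup[OF order_refl cong_quads_subgroup]]
        subgroup.one_closed[OF trivial_units_subgroup] by simp
    show "lift (cong_quads 0) \<inter> trivial_units G \<subseteq> {\<one>\<^bsub>U\<^esub>}"
    proof
      fix t assume t: "t \<in> lift (cong_quads 0) \<inter> trivial_units G"
      then obtain g where g: "g \<in> carrier G" "t = elt g \<or> t = \<ominus>\<^bsub>R\<^esub> elt g"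
        by (auto simp: trivial_units_iff)
      then obtain k where k: "k < 8" "g = e k" by (auto simp: carrier_eq)
      have l: "lin t = (1, 0, 0, 0)" "4 dvd fst (quat t) - 1" using t by (auto simp: lift_cong_quads_0_iff)
      \<comment> \<open>The only trivial units over 1 are 1 and a^2, and a^2 has first
        \<open>quat\<close> coordinate -1.\<close>
      have "t = elt (e 0)"
        using g(2) l k(1) unfolding k(2) less_8_iff
        by (elim disjE) (simp_all add: lin_neg elt_closed lin_elt quat_elt del: One_nat_def)
      then show "t \<in> {\<one>\<^bsub>U\<^esub>}" by (simp add: group_ring_simps one_eq)
    qed
  qed
  show "lift (cong_quads 0) <#>\<^bsub>U\<^esub> trivial_units G = carrier U"
  proof
    show "lift (cong_quads 0) <#>\<^bsub>U\<^esub> trivial_units G \<subseteq> carrier U"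
      using lift_cong_quads_0_iff subgroup.subset[OF trivial_units_subgroup] by (auto simp: set_mult_def)
    show "carrier U \<subseteq> lift (cong_quads 0) <#>\<^bsub>U\<^esub> trivial_units G"
    proof
      fix u assume "u \<in> carrier U"
      then have u: "u \<in> Units R" "u \<in> carrier R" by auto
      obtain t where t: "t \<in> trivial_units G" "lin t = lin u"
        using trivial_unit_lin[OF lin_unit[OF u(1)]] by blast
      have tU: "t \<in> Units R" "t \<in> carrier R"
        using subgroup.subset[OF trivial_units_subgroup] t(1) by auto
      define v where "v = u \<otimes>\<^bsub>R\<^esub> inv\<^bsub>R\<^esub> t"
      have v: "v \<in> Units R" "v \<in> carrier R" using u tU by (auto simp: v_def)
      have vt: "v \<otimes>\<^bsub>R\<^esub> t = u" using u tU by (simp add: v_def R.m_assoc)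
      have lv: "lin v = (1, 0, 0, 0)"
        using lin_inv[OF tU(1)] u tU by (simp add: v_def lin_mult t(2))
      obtain p q r s where x: "quat v = (p, q, r, s)" by (cases "quat v")
      have "odd p" using parity(1)[OF lv x] by simp
      then have "4 dvd p - 1 \<or> 4 dvd - p - 1" by presburger
      then consider "4 dvd p - 1" | "4 dvd - p - 1" by blast
      then show "u \<in> lift (cong_quads 0) <#>\<^bsub>U\<^esub> trivial_units G"
      proof cases
        case 1
        then have "v \<in> lift (cong_quads 0)" using v lv x by (simp add: lift_cong_quads_0_iff)
        then show ?thesis using t(1) vt by (auto simp: set_mult_def)
      next
        case 2
        \<comment> \<open>\<open>e 2\<close> is a^2: multiplication by it keeps \<open>lin\<close>
          and negates \<open>quat\<close>, which corrects the sign of p.\<close>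
        define w where "w = v \<otimes>\<^bsub>R\<^esub> elt (e 2)"
        have "lin w = (1, 0, 0, 0)" "fst (quat w) = - p"
          using v e2 by (simp_all add: w_def lin_mult quat_mult R.Units_closed lv x lin_elt quat_elt)
        moreover have "w \<in> Units R" using v e2 by (simp add: w_def)
        ultimately have "w \<in> lift (cong_quads 0)" using 2 by (simp add: lift_cong_quads_0_iff)
        moreover have "elt (e 2) \<otimes>\<^bsub>R\<^esub> t \<in> trivial_units G"
          using subgroup.m_closed[OF trivial_units_subgroup e2(2) t(1)] by simp
        moreover have "w \<otimes>\<^bsub>R\<^esub> (elt (e 2) \<otimes>\<^bsub>R\<^esub> t) = v \<otimes>\<^bsub>R\<^esub> (elt (e 2) \<otimes>\<^bsub>R\<^esub> elt (e 2)) \<otimes>\<^bsub>R\<^esub> t"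
          using v e2(1) tU by (simp only: w_def R.m_assoc R.m_closed R.Units_closed)
        then have "w \<otimes>\<^bsub>R\<^esub> (elt (e 2) \<otimes>\<^bsub>R\<^esub> t) = u" using v vt by (simp add: e22)
        ultimately show ?thesis by (auto simp: set_mult_def)
      qed
    qed
  qed
qed

lemma torsion_quat:
  assumes "u \<in> Units R" "k > 0" "u [^]\<^bsub>U\<^esub> (k::nat) = \<one>\<^bsub>U\<^esub>" "qnorm (quat u) = 1" "fst (quat u) \<noteq> 0"
  shows "quat u = (1, 0, 0, 0) \<or> quat u = (-1, 0, 0, 0)"
proof -
  interpret q: group_hom U QG quat by (rule quat_group_hom)
  obtain p q r s where x: "quat u = (p, q, r, s)" by (cases "quat u")
  have "quat u [^]\<^bsub>QG\<^esub> k = \<one>\<^bsub>QG\<^esub>"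
    using q.hom_nat_pow[of u k] assms(1,3) by (simp add: quat_one)
  then have "q = 0" "r = 0" "s = 0" using torsion_quad[of p q r s k] assms x by simp_all
  then have "p * p = 1" using assms(4) x by simp
  then have "p = 1 \<or> p = - 1" by (simp add: zmult_eq_1_iff)
  then show ?thesis using x \<open>q = 0\<close> \<open>r = 0\<close> \<open>s = 0\<close> by auto
qed

lemma lift_cong_quads_0_torsion_free: "torsion_free_set U (lift (cong_quads 0))"
  unfolding torsion_free_set_def
proof (intro ballI allI impI)
  fix u and k :: nat
  assume u: "u \<in> lift (cong_quads 0)" and k: "k > 0" "u [^]\<^bsub>U\<^esub> k = \<one>\<^bsub>U\<^esub>"
  obtain p q r s where x: "quat u = (p, q, r, s)" by (cases "quat u")
  have "4 dvd p - 1" "qnorm (quat u) = 1" using u by (auto simp: lift_def x cong_quads_iff)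
  moreover have "u \<in> Units R" "lin u = (1, 0, 0, 0)" using u by (auto simp: lift_cong_quads_0_iff)
  ultimately have "quat u = (1, 0, 0, 0)"
    using torsion_quat[OF _ k] x by (cases "p = 0") auto
  then have "u = \<one>\<^bsub>R\<^esub>"
    using u by (intro coeff_eqI) (auto simp: lift_def lin_one quat_one)
  then show "u = \<one>\<^bsub>U\<^esub>" by simp
qed

section \<open>Congruence units as lifted quadruples\<close>

lemma cong_coeff:
  assumes "u \<in> Units R" "\<forall>y\<in>carrier G. d dvd u y - elt \<one> y"
  shows "d dvd u (e 0) - 1" "k < 8 \<Longrightarrow> k \<noteq> 0 \<Longrightarrow> d dvd u (e k)"
  using assms(2)[rule_format, of "e 0"] assms(2)[rule_format, of "e k"]
  by (simp_all add: one_eq elt_e)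

lemma cong_lin:
  assumes "u \<in> Units R" "\<forall>y\<in>carrier G. 2 dvd u y - elt \<one> y"
  shows "lin u = (1, 0, 0, 0) \<or> lin u = (-1, 0, 0, 0)"
proof -
  note c = cong_coeff[OF assms]
  have "odd (u (e 0) + u (e 2))" "even (u (e 1) + u (e 3))" "even (u (e 4) + u (e 6))"
    "even (u (e 5) + u (e 7))"
    using c(1) c(2)[of 1] c(2)[of 2] c(2)[of 3] c(2)[of 4] c(2)[of 5] c(2)[of 6] c(2)[of 7] by simp_all
  moreover have "(l0, l1, l2, l3) = (1, 0, 0, 0) \<or> (l0, l1, l2, l3) = (-1, 0, 0, 0)"
    if "(l0, l1, l2, l3) \<in> axis" "odd l0" "even l1" "even l2" "even l3" for l0 l1 l2 l3
    using that unfolding axis_def by (elim insertE) simp_all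
  ultimately show ?thesis using lin_unit[OF assms(1)] unfolding lin_def by blast
qed

text \<open>Over 1 the coefficients at g and a^2 g cancel (or add to 1 for g = 1), so
  \<open>quat\<close> doubles the coefficients and the modulus \<open>2 ^ i\<close> becomes
  \<open>2 ^ Suc i\<close>. The bound on i turns this into the condition modulo 4 on p.\<close>

lemma lift_cong_quads_iff:
  assumes "i \<ge> 1"
  shows "u \<in> lift (cong_quads i) \<longleftrightarrow>
    u \<in> Units R \<and> lin u = (1, 0, 0, 0) \<and> (\<forall>y\<in>carrier G. 2 ^ i dvd u y - elt \<one> y)"
proof
  assume u: "u \<in> lift (cong_quads i)"
  have U: "u \<in> Units R" using lift_units[OF cong_quads_subset] u by blast
  have l: "lin u = (1, 0, 0, 0)" using u by (simp add: lift_def)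
  have s: "u (e 0) + u (e 2) = 1" "u (e 1) + u (e 3) = 0" "u (e 4) + u (e 6) = 0" "u (e 5) + u (e 7) = 0"
    using l by (simp_all add: lin_def)
  have w: "2 * 2 ^ i dvd u (e 0) - u (e 2) - 1" "2 * 2 ^ i dvd u (e 1) - u (e 3)"
    "2 * 2 ^ i dvd u (e 4) - u (e 6)" "2 * 2 ^ i dvd u (e 5) - u (e 7)"
    using u by (simp_all add: lift_def quat_def cong_quads_iff)
  have half: "2 ^ i dvd x" if "2 * 2 ^ i dvd 2 * x" for x :: int
    using that by (simp only: dvd_mult_cancel_left) simp
  have neg: "u (e 2) = - (u (e 0) - 1)" "u (e 3) = - u (e 1)" "u (e 6) = - u (e 4)" "u (e 7) = - u (e 5)"
    using s by linarith+
  have "u (e 0) - u (e 2) - 1 = 2 * (u (e 0) - 1)" "u (e 1) - u (e 3) = 2 * u (e 1)"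
    "u (e 4) - u (e 6) = 2 * u (e 4)" "u (e 5) - u (e 7) = 2 * u (e 5)"
    by (simp_all add: neg)
  then have d: "2 ^ i dvd u (e 0) - 1" "2 ^ i dvd u (e 1)" "2 ^ i dvd u (e 4)" "2 ^ i dvd u (e 5)"
    using w half by metis+
  have d': "2 ^ i dvd u (e 2)" "2 ^ i dvd u (e 3)" "2 ^ i dvd u (e 6)" "2 ^ i dvd u (e 7)"
    unfolding neg dvd_minus_iff using d by simp_all
  have "2 ^ i dvd u (e k) - elt \<one> (e k)" if "k < 8" for k
    using that d d' unfolding less_8_iff one_eq by (elim disjE) (simp_all add: elt_e)
  then show "u \<in> Units R \<and> lin u = (1, 0, 0, 0) \<and> (\<forall>y\<in>carrier G. 2 ^ i dvd u y - elt \<one> y)"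
    using U l by (auto simp: carrier_eq)
next
  assume u: "u \<in> Units R \<and> lin u = (1, 0, 0, 0) \<and> (\<forall>y\<in>carrier G. 2 ^ i dvd u y - elt \<one> y)"
  then have U: "u \<in> Units R" and l: "lin u = (1, 0, 0, 0)"
    and c: "\<forall>y\<in>carrier G. 2 ^ i dvd u y - elt \<one> y" by auto
  have s: "u (e 0) + u (e 2) = 1" "u (e 1) + u (e 3) = 0" "u (e 4) + u (e 6) = 0" "u (e 5) + u (e 7) = 0"
    using l by (simp_all add: lin_def)
  have q: "quat u = (1 + 2 * (u (e 0) - 1), 2 * u (e 1), 2 * u (e 4), 2 * u (e 5))"
    unfolding quat_def using s by auto
  note d = cong_coeff[OF U c]
  have "(2::int) dvd 2 ^ i" using assms by simp
  then have "2 dvd u (e 0) - 1" using d(1) dvd_trans by blast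
  then have four: "4 dvd 2 * (u (e 0) - 1)" by presburger
  then have "u \<in> lift (cong_quads 0)" using U l q by (simp add: lift_cong_quads_0_iff)
  then have n: "qnorm (quat u) = 1" by (cases "quat u") (simp add: lift_def cong_quads_iff)
  have "2 * 2 ^ i dvd 2 * (u (e 0) - 1)" "2 * 2 ^ i dvd 2 * u (e 1)" "2 * 2 ^ i dvd 2 * u (e 4)"
    "2 * 2 ^ i dvd 2 * u (e 5)"
    using d(1) d(2)[of 1] d(2)[of 4] d(2)[of 5] by (intro mult_dvd_mono; simp)+
  then show "u \<in> lift (cong_quads i)"
    using n four U l unfolding q by (simp add: lift_def q cong_quads_def R.Units_closed)
qed

text \<open>A congruence modulo 4 separates 1 from -1 in the first coordinate of \<open>lin\<close>.
  Modulo 2 it does not, which is the origin of the extra factor of order two at level 1.\<close>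

lemma cong_units_lift:
  assumes "i \<ge> 2"
  shows "cong_units G i = lift (cong_quads i)"
proof -
  have "lin u = (1, 0, 0, 0)" if u: "u \<in> Units R" "\<forall>y\<in>carrier G. 2 ^ i dvd u y - elt \<one> y" for u
  proof -
    have "(2::int) ^ 2 dvd 2 ^ i" using assms by (rule le_imp_power_dvd)
    then have f: "\<forall>y\<in>carrier G. 4 dvd u y - elt \<one> y" using u(2) dvd_trans by fastforce
    then have "\<forall>y\<in>carrier G. 2 dvd u y - elt \<one> y" by (meson dvd_trans even_numeral)
    note l = cong_lin[OF u(1) this]
    note c = cong_coeff[OF u(1) f]
    have "4 dvd u (e 0) + u (e 2) - 1"
      using dvd_add[OF c(1) c(2)[of 2]] by (simp add: algebra_simps)
    then show ?thesis using l by (auto simp: lin_def)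
  qed
  moreover have "i \<ge> 1" using assms by simp
  ultimately have "u \<in> cong_units G i \<longleftrightarrow> u \<in> lift (cong_quads i)" for u
    using cong_units_iff[of u i] lift_cong_quads_iff[of i u] by blast
  then show ?thesis by blast
qed

lemma torsion_cong_trivial: "torsion_cong_trivial"
  unfolding torsion_cong_trivial_def
proof (intro ballI allI impI)
  fix u and k :: nat
  assume u: "u \<in> Units R" and k: "k > 0" "u [^]\<^bsub>U\<^esub> k = \<one>\<^bsub>U\<^esub>"
    and c: "\<forall>y\<in>carrier G. even (u y - elt \<one> y)"
  have uc: "u \<in> carrier R" using u by blast
  obtain p q r s where x: "quat u = (p, q, r, s)" by (cases "quat u")
  have d: "odd (u (e 0))" "even (u (e 1))" "even (u (e 2))" "even (u (e 3))" "even (u (e 4))"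
    "even (u (e 5))" "even (u (e 6))" "even (u (e 7))"
    using cong_coeff[OF u c] by auto
  have o: "odd p" "even q" "even r" "even s" using d x by (auto simp: quat_def)
  have "p \<noteq> 0" using o(1) by auto
  obtain p' q' r' s' where e: "p = 2 * p' + 1" "q = 2 * q'" "r = 2 * r'" "s = 2 * s'"
    using o by (auto elim!: oddE evenE)
  have "qnorm (quat u) = 1 + 4 * (p' * p' + p' + q' * q' - r' * r' - s' * s')"
    by (simp add: x e algebra_simps)
  then have "qnorm (quat u) = 1" using quat_unit[OF u] by presburger
  then have q: "quat u = (1, 0, 0, 0) \<or> quat u = (-1, 0, 0, 0)"
    using torsion_quat[OF u k] \<open>p \<noteq> 0\<close> x by simp
  \<comment> \<open>With opposite signs the coefficient at 1, half the sum of the two first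
    coordinates, would be 0 instead of odd.\<close>
  have "\<not> (lin u = (1, 0, 0, 0) \<and> quat u = (-1, 0, 0, 0))" "\<not> (lin u = (-1, 0, 0, 0) \<and> quat u = (1, 0, 0, 0))"
    using d(1) unfolding lin_def quat_def by auto presburger+
  then have "lin u = (1, 0, 0, 0) \<and> quat u = (1, 0, 0, 0) \<or> lin u = (-1, 0, 0, 0) \<and> quat u = (-1, 0, 0, 0)"
    using q cong_lin[OF u c] by blast
  then show "u = \<one>\<^bsub>R\<^esub> \<or> u = \<ominus>\<^bsub>R\<^esub> \<one>\<^bsub>R\<^esub>"
  proof
    assume "lin u = (1, 0, 0, 0) \<and> quat u = (1, 0, 0, 0)"
    then have "u = \<one>\<^bsub>R\<^esub>" using uc by (intro coeff_eqI) (simp_all add: lin_one quat_one)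
    then show ?thesis ..
  next
    assume "lin u = (-1, 0, 0, 0) \<and> quat u = (-1, 0, 0, 0)"
    then have "u = \<ominus>\<^bsub>R\<^esub> \<one>\<^bsub>R\<^esub>"
      using uc by (intro coeff_eqI) (simp_all add: lin_one quat_one lin_neg quat_neg)
    then show ?thesis ..
  qed
qed

text \<open>In the commutative quotient 1 - h and 1 + h annihilate each other for an involution h,
  so these units lie over 1. The pairs (g, h) used are (a, b), (a^3, b) and (a, ab), the second one
  in the form with \<open>tilde\<close> on the left.\<close>

lemma bicyclic_lift:
  "\<exists>u\<in>bicyclic_units G. u \<in> lift (cong_quads 0) \<and> quat u = bicyclic_quad i"
proof -
  have inv: "tilde G (e 4) = elt (e 4) \<oplus>\<^bsub>R\<^esub> \<one>\<^bsub>R\<^esub>" "tilde G (e 5) = elt (e 5) \<oplus>\<^bsub>R\<^esub> \<one>\<^bsub>R\<^esub>"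
    by (rule tilde_involution; simp add: mult dihedral_index_def one_eq e_eq)+
  have c: "elt (e i) \<in> carrier R" if "i < 8" for i using that by (simp add: elt_closed)
  define F where "F g h = \<one>\<^bsub>R\<^esub> \<oplus>\<^bsub>R\<^esub> (\<one>\<^bsub>R\<^esub> \<ominus>\<^bsub>R\<^esub> elt h) \<otimes>\<^bsub>R\<^esub> elt g \<otimes>\<^bsub>R\<^esub> tilde G h" for g h
  define F' where "F' g h = \<one>\<^bsub>R\<^esub> \<oplus>\<^bsub>R\<^esub> tilde G h \<otimes>\<^bsub>R\<^esub> elt g \<otimes>\<^bsub>R\<^esub> (\<one>\<^bsub>R\<^esub> \<ominus>\<^bsub>R\<^esub> elt h)" for g h
  have "F g h \<in> bicyclic_units G" "F' g h \<in> bicyclic_units G" if "g \<in> carrier G" "h \<in> carrier G" for g h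
    using that unfolding bicyclic_units_def Let_def F_def F'_def by blast+
  then have b: "F (e 1) (e 4) \<in> bicyclic_units G" "F' (e 3) (e 4) \<in> bicyclic_units G"
    "F (e 1) (e 5) \<in> bicyclic_units G" by simp_all
  have cl: "F (e 1) (e 4) \<in> carrier R" "F' (e 3) (e 4) \<in> carrier R" "F (e 1) (e 5) \<in> carrier R"
    by (simp_all add: F_def F'_def inv c)
  have l: "lin (F (e 1) (e 4)) = (1, 0, 0, 0)" "lin (F' (e 3) (e 4)) = (1, 0, 0, 0)"
    "lin (F (e 1) (e 5)) = (1, 0, 0, 0)"
    by (simp_all add: F_def F'_def inv R.minus_eq lin_add lin_mult lin_neg lin_elt lin_one c
      del: One_nat_def)
  have q: "quat (F (e 1) (e 4)) = bicyclic_quad 0" "quat (F' (e 3) (e 4)) = bicyclic_quad 1"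
    "quat (F (e 1) (e 5)) = bicyclic_quad 2"
    by (simp_all add: F_def F'_def inv R.minus_eq quat_add quat_mult quat_neg quat_elt quat_one c bicyclic_quad_def
      del: One_nat_def)
  have w: "bicyclic_quad i \<in> cong_quads 0" for i by (simp add: bicyclic_quad_def cong_quads_iff)
  have m: "F (e 1) (e 4) \<in> lift (cong_quads 0)" "F' (e 3) (e 4) \<in> lift (cong_quads 0)" "F (e 1) (e 5) \<in> lift (cong_quads 0)"
    using cl l q w by (simp_all add: lift_def)
  have "bicyclic_quad i = bicyclic_quad 0 \<or> bicyclic_quad i = bicyclic_quad 1 \<or> bicyclic_quad i = bicyclic_quad 2" by (simp add: bicyclic_quad_def)
  then consider "bicyclic_quad i = bicyclic_quad 0" | "bicyclic_quad i = bicyclic_quad 1" | "bicyclic_quad i = bicyclic_quad 2" by blast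
  then show ?thesis using b m q by cases metis+
qed

lemma lift_cong_quads_0_generated: "\<exists>S\<subseteq>bicyclic_units G. lift (cong_quads 0) = generate U S"
proof -
  obtain u where u: "\<And>i. u i \<in> bicyclic_units G" "\<And>i. u i \<in> lift (cong_quads 0)" "\<And>i. quat (u i) = bicyclic_quad i"
    using bicyclic_lift by metis
  interpret q: group_hom U QG quat by (rule quat_group_hom)
  define S where "S = u ` {..<3}"
  have sub: "subgroup (lift (cong_quads 0)) U" by (rule lift_subgroup[OF order_refl cong_quads_subgroup])
  have SN: "S \<subseteq> lift (cong_quads 0)" using u(2) by (auto simp: S_def)
  then have gN: "generate U S \<subseteq> lift (cong_quads 0)" by (rule U.generate_subgroup_incl[OF _ sub])
  have gS: "subgroup (generate U S) U"
    using SN subgroup.subset[OF sub] by (intro U.generate_is_subgroup) blast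
  have "subgroup (quat ` generate U S) QG" by (rule q.subgroup_img_is_subgroup[OF gS])
  moreover have "bicyclic_quad ` {..<3} \<subseteq> quat ` generate U S"
  proof
    fix x assume "x \<in> bicyclic_quad ` {..<3}"
    then obtain i where i: "i < 3" "x = quat (u i)" using u(3) by auto
    have "u i \<in> generate U S" using i(1) by (intro generate.incl) (simp add: S_def)
    then show "x \<in> quat ` generate U S" using i(2) by blast
  qed
  ultimately have W: "cong_quads 0 \<subseteq> quat ` generate U S"
    unfolding cong_quads_0_generate[symmetric] by (intro QG.generate_subgroup_incl)
  have "lift (cong_quads 0) \<subseteq> generate U S"
  proof
    fix v assume v: "v \<in> lift (cong_quads 0)"
    then obtain w where w: "w \<in> generate U S" "quat v = quat w" using W by (auto simp: lift_def)
    then have "w \<in> lift (cong_quads 0)" using gN by blast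
    then have "v = w" using v w(2) by (intro coeff_eqI) (auto simp: lift_def)
    then show "v \<in> generate U S" using w(1) by simp
  qed
  moreover have "S \<subseteq> bicyclic_units G" using u(1) by (auto simp: S_def)
  ultimately show ?thesis using gN by blast
qed

lemma lift_cong_quads_free: "i \<ge> 1 \<Longrightarrow> U\<lparr>carrier := lift (cong_quads i)\<rparr> \<cong> free_group {..<1 + 8 ^ i :: nat}"
proof -
  assume i: "i \<ge> 1"
  then obtain j where j: "i = Suc j" by (cases i) auto
  have "U\<lparr>carrier := lift (cong_quads i)\<rparr> \<cong> QG\<lparr>carrier := cong_quads i\<rparr>"
    using lift_iso[OF cong_quads_subset] by (auto simp: is_iso_def)
  then show ?thesis using cong_quads_free[of j] iso_trans unfolding j by blast
qed

lemma lift_cong_quads_0_free: "U\<lparr>carrier := lift (cong_quads 0)\<rparr> \<cong> free_group {..<3::nat}"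
proof -
  have "U\<lparr>carrier := lift (cong_quads 0)\<rparr> \<cong> QG\<lparr>carrier := cong_quads 0\<rparr>"
    using lift_iso[OF order_refl] by (auto simp: is_iso_def)
  then show ?thesis using cong_quads_0_free iso_trans by blast
qed

section \<open>The sign factor at level one\<close>

lemma cong_units_1_sign:
  assumes "u \<in> cong_units G 1"
  shows "u \<in> lift (cong_quads 1) \<or> \<ominus>\<^bsub>R\<^esub> u \<in> lift (cong_quads 1) \<and> lin u = (-1, 0, 0, 0)"
proof -
  have u: "u \<in> Units R" and c: "\<forall>y\<in>carrier G. 2 dvd u y - elt \<one> y"
    using assms by (auto simp: cong_units_iff)
  from cong_lin[OF u c] show ?thesis
  proof
    assume "lin u = (1, 0, 0, 0)"
    then show ?thesis using u c lift_cong_quads_iff[of 1 u] by simp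
  next
    assume l: "lin u = (-1, 0, 0, 0)"
    have uc: "u \<in> carrier R" using u by blast
    have "2 dvd - u y - elt \<one> y" if "y \<in> carrier G" for y
      using c[rule_format, OF that] by presburger
    moreover have "lin (\<ominus>\<^bsub>R\<^esub> u) = (1, 0, 0, 0)" using uc l by (simp add: lin_neg)
    ultimately have "\<ominus>\<^bsub>R\<^esub> u \<in> lift (cong_quads 1)"
      using neg_unit[OF u] uc by (simp add: lift_cong_quads_iff neg_eq)
    then show ?thesis using l by simp
  qed
qed

lemma cong_units_1_mem:
  assumes "v \<in> lift (cong_quads 1)"
  shows "v \<in> cong_units G 1" "\<ominus>\<^bsub>R\<^esub> v \<in> cong_units G 1"
proof -
  have v: "v \<in> Units R" "\<forall>y\<in>carrier G. 2 dvd v y - elt \<one> y" using assms lift_cong_quads_iff[of 1 v] by auto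
  then show "v \<in> cong_units G 1" by (simp add: cong_units_iff)
  have "2 dvd - v y - elt \<one> y" if "y \<in> carrier G" for y
    using v(2)[rule_format, OF that] by presburger
  then show "\<ominus>\<^bsub>R\<^esub> v \<in> cong_units G 1"
    using neg_unit[OF v(1)] v(1) by (simp add: cong_units_iff neg_eq R.Units_closed)
qed

text \<open>The factor of order two is generated by the central unit -1, and \<open>lin\<close>
  recovers the sign, so the product is direct.\<close>

lemma cong_units_1_iso:
  "U\<lparr>carrier := lift (cong_quads 1)\<rparr> \<times>\<times> integer_mod_group 2 \<cong> cong_unit_group G 1"
proof -
  define \<psi> where "\<psi> = (\<lambda>(v, i :: int). if i = 0 then v else \<ominus>\<^bsub>R\<^esub> v)"
  have Z: "carrier (integer_mod_group 2) = {0, 1}" by (auto simp: carrier_integer_mod_group)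
  have c: "v \<in> carrier R" and l: "lin v = (1, 0, 0, 0)" if "v \<in> lift (cong_quads 1)" for v
    using that by (auto simp: lift_def)
  have m: "v \<otimes>\<^bsub>R\<^esub> w \<in> lift (cong_quads 1)" if "v \<in> lift (cong_quads 1)" "w \<in> lift (cong_quads 1)" for v w
    using that cong_quads_mult by (simp add: lift_def lin_mult quat_mult)
  have "\<psi> \<in> hom (U\<lparr>carrier := lift (cong_quads 1)\<rparr> \<times>\<times> integer_mod_group 2) (cong_unit_group G 1)"
    by (rule homI)
      (auto simp: \<psi>_def Z cong_units_1_mem R.l_minus R.r_minus c simp del: One_nat_def split: if_splits)
  moreover have "inj_on \<psi> (lift (cong_quads 1) \<times> {0, 1})"
  proof (rule inj_onI; clarify)
    fix v w :: "'a \<Rightarrow> int" and i j :: int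
    assume v: "v \<in> lift (cong_quads 1)" and w: "w \<in> lift (cong_quads 1)" and i: "i \<in> {0, 1}" and j: "j \<in> {0, 1}"
      and eq: "\<psi> (v, i) = \<psi> (w, j)"
    have "lin (\<psi> (v, i)) = lin (\<psi> (w, j))" using eq by simp
    then have "i = j" using i j l[OF v] l[OF w] c[OF v] c[OF w]
      by (auto simp: \<psi>_def lin_neg)
    moreover have "v = w"
    proof (cases "i = 0")
      case True
      then show ?thesis using eq \<open>i = j\<close> by (simp add: \<psi>_def)
    next
      case False
      then have "\<ominus>\<^bsub>R\<^esub> v = \<ominus>\<^bsub>R\<^esub> w" using eq \<open>i = j\<close> by (simp add: \<psi>_def)
      then have "\<ominus>\<^bsub>R\<^esub> (\<ominus>\<^bsub>R\<^esub> v) = \<ominus>\<^bsub>R\<^esub> (\<ominus>\<^bsub>R\<^esub> w)" by (rule arg_cong)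
      then show ?thesis by (simp only: R.minus_minus[OF c[OF v]] R.minus_minus[OF c[OF w]])
    qed
    ultimately show "v = w \<and> i = j" by simp
  qed
  moreover have "\<psi> ` (lift (cong_quads 1) \<times> {0, 1}) = cong_units G 1"
  proof
    show "\<psi> ` (lift (cong_quads 1) \<times> {0, 1}) \<subseteq> cong_units G 1" using cong_units_1_mem by (auto simp: \<psi>_def)
    show "cong_units G 1 \<subseteq> \<psi> ` (lift (cong_quads 1) \<times> {0, 1})"
    proof
      fix u assume u: "u \<in> cong_units G 1"
      then have uc: "u \<in> carrier R" by (auto simp: cong_units_iff)
      from cong_units_1_sign[OF u] show "u \<in> \<psi> ` (lift (cong_quads 1) \<times> {0, 1})"
      proof
        assume "u \<in> lift (cong_quads 1)"
        then show ?thesis by (intro image_eqI[of _ _ "(u, 0)"]) (auto simp: \<psi>_def)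
      next
        assume "\<ominus>\<^bsub>R\<^esub> u \<in> lift (cong_quads 1) \<and> lin u = (-1, 0, 0, 0)"
        then show ?thesis
          using uc by (intro image_eqI[of _ _ "(\<ominus>\<^bsub>R\<^esub> u, 1)"]) (auto simp: \<psi>_def)
      qed
    qed
  qed
  ultimately have "\<psi> \<in> iso (U\<lparr>carrier := lift (cong_quads 1)\<rparr> \<times>\<times> integer_mod_group 2) (cong_unit_group G 1)"
    by (simp add: iso_def bij_betw_def Z)
  then show ?thesis by (auto simp: is_iso_def)
qed

lemma cong_units_1_free:
  "cong_unit_group G 1 \<cong> free_group {..<9::nat} \<times>\<times> integer_mod_group 2"
proof -
  let ?L = "U\<lparr>carrier := lift (cong_quads 1)\<rparr>"
  have L: "group ?L" by (intro U.subgroup_imp_group lift_subgroup cong_quads_subgroup cong_quads_subset)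
  have Z: "group (integer_mod_group 2)" by simp
  obtain h where h: "h \<in> iso ?L (free_group {..<9::nat})"
    using lift_cong_quads_free[of 1] by (auto simp: is_iso_def)
  have "(\<lambda>x. x) \<in> iso (integer_mod_group 2) (integer_mod_group 2)"
    by (auto simp: iso_def hom_def bij_betw_def carrier_integer_mod_group)
  then have "?L \<times>\<times> integer_mod_group 2 \<cong> free_group {..<9::nat} \<times>\<times> integer_mod_group 2"
    using iso_paired2[OF L Z, of h "\<lambda>x. x"] h unfolding is_iso_def by blast
  moreover have "cong_unit_group G 1 \<cong> ?L \<times>\<times> integer_mod_group 2"
    using group.iso_sym[OF DirProd_group[OF L Z] cong_units_1_iso] .
  ultimately show ?thesis using iso_trans by blast
qed

end

section \<open>Adjoining a central involution\<close>

context integral_group_ring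
begin

definition aug :: "('a \<Rightarrow> int) \<Rightarrow> int" where
  "aug f = (\<Sum>x\<in>carrier G. f x)"

lemma aug_mult:
  assumes "finite (carrier G)" "f \<in> carrier R" "g \<in> carrier R"
  shows "aug (f \<otimes>\<^bsub>R\<^esub> g) = aug f * aug g"
proof -
  have "aug (f \<otimes>\<^bsub>R\<^esub> g)
      = (\<Sum>x\<in>carrier G. \<Sum>y\<in>carrier G. \<Sum>z\<in>carrier G. if y \<otimes> z = x then f y * g z else 0)"
    unfolding aug_def using assms by (intro sum.cong refl group_ring_mult) (auto simp: group_ring_simps)
  also have "\<dots> = (\<Sum>y\<in>carrier G. \<Sum>z\<in>carrier G. \<Sum>x\<in>carrier G. if y \<otimes> z = x then f y * g z else 0)"
    by (subst sum.swap, rule sum.cong[OF refl], rule sum.swap)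
  also have "\<dots> = (\<Sum>y\<in>carrier G. \<Sum>z\<in>carrier G. f y * g z)"
    using assms(1) by (intro sum.cong refl) (simp add: sum.delta')
  finally show ?thesis by (simp add: aug_def sum_product)
qed

lemma aug_one: "finite (carrier G) \<Longrightarrow> aug \<one>\<^bsub>R\<^esub> = 1"
  by (simp add: aug_def group_ring_simps elt_def sum.delta)

lemma aug_neg: "f \<in> carrier R \<Longrightarrow> aug (\<ominus>\<^bsub>R\<^esub> f) = - aug f"
  by (simp add: aug_def neg_eq sum_negf)

lemma aug_unit: "finite (carrier G) \<Longrightarrow> u \<in> Units R \<Longrightarrow> \<bar>aug u\<bar> = 1"
proof -
  assume "finite (carrier G)" "u \<in> Units R"
  then have "aug u * aug (inv\<^bsub>R\<^esub> u) = 1"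
    by (simp add: aug_mult[symmetric] R.Units_closed aug_one)
  then show ?thesis by (auto simp: zmult_eq_1_iff)
qed

end

text \<open>G is the internal direct product of A and the group generated by z. The internal form
  lets all stages of the induction live in one ambient group.\<close>

locale central_involution = integral_group_ring G for G (structure) +
  fixes A :: "'a set" and z :: 'a
  assumes A: "subgroup A G" and finA: "finite A" and z: "z \<in> carrier G" "z \<notin> A" "z \<otimes> z = \<one>"
    and central: "x \<in> carrier G \<Longrightarrow> z \<otimes> x = x \<otimes> z"
    and carrier_eq: "carrier G = A \<union> (\<lambda>x. x \<otimes> z) ` A"
begin

abbreviation K where "K \<equiv> G\<lparr>carrier := A\<rparr>"

end

sublocale central_involution \<subseteq> K: integral_group_ring "G\<lparr>carrier := A\<rparr>"
  by (simp add: integral_group_ring_def subgroup_imp_group[OF A])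

context central_involution
begin

lemma A_sub: "x \<in> A \<Longrightarrow> x \<in> carrier G"
  using subgroup.subset[OF A] by blast

lemma fin: "finite (carrier G)"
  using finA by (simp add: carrier_eq)

lemma z_notin: "x \<in> A \<Longrightarrow> x \<otimes> z \<notin> A"
proof
  assume x: "x \<in> A" "x \<otimes> z \<in> A"
  then have "inv x \<otimes> (x \<otimes> z) \<in> A" using A subgroup.m_closed subgroup.m_inv_closed by metis
  then show False using x A_sub z by (simp add: m_assoc[symmetric])
qed

lemma zz: "x \<in> carrier G \<Longrightarrow> x \<otimes> z \<otimes> z = x"
  using z by (simp add: m_assoc)

lemma z_inj: "inj_on (\<lambda>x. x \<otimes> z) A"
  by (rule inj_on_inverseI[of _ "\<lambda>x. x \<otimes> z"]) (simp add: zz A_sub)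

lemma z_eq: "x \<in> carrier G \<Longrightarrow> y \<in> carrier G \<Longrightarrow> x \<otimes> z = y \<otimes> z \<longleftrightarrow> x = y"
  using z by simp

lemma zmult:
  assumes "x \<in> carrier G" "y \<in> carrier G"
  shows "(x \<otimes> z) \<otimes> y = (x \<otimes> y) \<otimes> z" "x \<otimes> (y \<otimes> z) = (x \<otimes> y) \<otimes> z"
    "(x \<otimes> z) \<otimes> (y \<otimes> z) = x \<otimes> y"
proof -
  show 1: "(x \<otimes> z) \<otimes> y = (x \<otimes> y) \<otimes> z" using assms z by (simp add: m_assoc central[OF assms(2)])
  show "x \<otimes> (y \<otimes> z) = (x \<otimes> y) \<otimes> z" using assms z by (simp add: m_assoc)
  have "(x \<otimes> z) \<otimes> (y \<otimes> z) = ((x \<otimes> z) \<otimes> y) \<otimes> z" using assms z by (simp add: m_assoc)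
  then show "(x \<otimes> z) \<otimes> (y \<otimes> z) = x \<otimes> y" unfolding 1 using assms by (simp add: zz)
qed

lemma A_mult: "x \<in> A \<Longrightarrow> y \<in> A \<Longrightarrow> x \<otimes> y \<in> A"
  using A subgroup.m_closed by metis

lemma sum_carrier: "(\<Sum>x\<in>carrier G. F x) = (\<Sum>x\<in>A. F x + F (x \<otimes> z))" for F :: "'a \<Rightarrow> int"
proof -
  have "A \<inter> (\<lambda>x. x \<otimes> z) ` A = {}" using z_notin by auto
  then have "(\<Sum>x\<in>carrier G. F x) = (\<Sum>x\<in>A. F x) + (\<Sum>x\<in>(\<lambda>x. x \<otimes> z) ` A. F x)"
    unfolding carrier_eq using finA by (intro sum.union_disjoint) auto
  then show ?thesis by (simp add: sum.reindex[OF z_inj] sum.distrib)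
qed

lemma mult_coeff:
  assumes f: "f \<in> carrier R" "g \<in> carrier R" and x: "x \<in> A"
  shows "(f \<otimes>\<^bsub>R\<^esub> g) x = (\<Sum>y\<in>A. \<Sum>w\<in>A.
      if y \<otimes> w = x then f y * g w + f (y \<otimes> z) * g (w \<otimes> z) else 0)" (is ?t1)
    and "(f \<otimes>\<^bsub>R\<^esub> g) (x \<otimes> z) = (\<Sum>y\<in>A. \<Sum>w\<in>A.
      if y \<otimes> w = x then f y * g (w \<otimes> z) + f (y \<otimes> z) * g w else 0)" (is ?t2)
proof -
  have *: "(f \<otimes>\<^bsub>R\<^esub> g) v = (\<Sum>y\<in>A. \<Sum>w\<in>A.
      ((if y \<otimes> w = v then f y * g w else 0) + (if y \<otimes> (w \<otimes> z) = v then f y * g (w \<otimes> z) else 0)) +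
      ((if (y \<otimes> z) \<otimes> w = v then f (y \<otimes> z) * g w else 0)
        + (if (y \<otimes> z) \<otimes> (w \<otimes> z) = v then f (y \<otimes> z) * g (w \<otimes> z) else 0)))" for v
  proof -
    have "(f \<otimes>\<^bsub>R\<^esub> g) v = (\<Sum>y\<in>carrier G. \<Sum>w\<in>carrier G. if y \<otimes> w = v then f y * g w else 0)"
      using f fin by (intro group_ring_mult) (auto simp: group_ring_simps)
    then show ?thesis by (simp only: sum_carrier sum.distrib)
  qed
  have ne: "y \<otimes> w \<otimes> z \<noteq> x" "y \<otimes> w \<noteq> x \<otimes> z" if "y \<in> A" "w \<in> A" for y w
    using that x z_notin A_mult by metis+
  show ?t1 unfolding *
    by (intro sum.cong refl) (simp add: zmult A_sub ne)
  show ?t2 unfolding *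
    using x by (intro sum.cong refl) (simp add: zmult A_sub ne z_eq)
qed

text \<open>The two specialisations \<open>z = s\<close> for \<open>s = 1\<close> and \<open>s = -1\<close>.\<close>

definition pr :: "int \<Rightarrow> ('a \<Rightarrow> int) \<Rightarrow> 'a \<Rightarrow> int" where
  "pr s f x = (if x \<in> A then f x + s * f (x \<otimes> z) else 0)"

lemma pr_closed: "pr s f \<in> carrier K.R"
proof -
  have "supp (pr s f) \<subseteq> A" by (auto simp: supp_def pr_def)
  then show ?thesis using finA by (auto simp: group_ring_simps intro: finite_subset)
qed

lemma pr_mult:
  assumes "f \<in> carrier R" "g \<in> carrier R" "s * s = 1"
  shows "pr s (f \<otimes>\<^bsub>R\<^esub> g) = pr s f \<otimes>\<^bsub>K.R\<^esub> pr s g"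
proof
  fix x
  show "pr s (f \<otimes>\<^bsub>R\<^esub> g) x = (pr s f \<otimes>\<^bsub>K.R\<^esub> pr s g) x"
  proof (cases "x \<in> A")
    case True
    have e: "a + s * b = c" if "a = p * q + p' * q'" "b = p * q' + p' * q" "c = (p + s * p') * (q + s * q')"
      for a b c p q p' q' :: int
    proof -
      have "c = p * q + s * (p * q') + s * (p' * q) + (s * s) * (p' * q')"
        unfolding that by (simp add: algebra_simps)
      then show ?thesis using that(1,2) assms(3) by (simp add: algebra_simps)
    qed
    have "(pr s f \<otimes>\<^bsub>K.R\<^esub> pr s g) x
        = (\<Sum>y\<in>A. \<Sum>w\<in>A. if y \<otimes>\<^bsub>K\<^esub> w = x then pr s f y * pr s g w else 0)"
      using finA by (intro group_ring_mult) (auto simp: supp_def pr_def)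
    also have "\<dots> = (f \<otimes>\<^bsub>R\<^esub> g) x + s * (f \<otimes>\<^bsub>R\<^esub> g) (x \<otimes> z)"
      unfolding mult_coeff[OF assms(1,2) True] sum_distrib_left sum.distrib[symmetric]
      by (intro sum.cong refl) (auto simp: pr_def intro!: e[symmetric])
    finally show ?thesis using True by (simp add: pr_def)
  next
    case False
    have "pr s f \<otimes>\<^bsub>K.R\<^esub> pr s g \<in> carrier K.R" using pr_closed by simp
    then have "x \<notin> supp (pr s f \<otimes>\<^bsub>K.R\<^esub> pr s g)"
      using False unfolding group_ring_simps by auto
    then show ?thesis using False by (simp add: supp_def pr_def)
  qed
qed

lemma pr_elt:
  assumes "g \<in> A"
  shows "pr s (elt g) = elt g" "pr s (elt (g \<otimes> z)) = (\<lambda>x. s * elt g x)"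
proof -
  have "x \<otimes> z \<noteq> g" if "x \<in> A" for x using that z_notin assms by metis
  then show "pr s (elt g) = elt g" using assms by (auto simp: pr_def elt_def)
  have "x \<noteq> g \<otimes> z" "x \<otimes> z = g \<otimes> z \<longleftrightarrow> x = g" if "x \<in> A" for x
    using that z_notin assms z_eq A_sub by metis+
  then show "pr s (elt (g \<otimes> z)) = (\<lambda>x. s * elt g x)" using assms by (auto simp: pr_def elt_def)
qed

lemma pr_neg: "f \<in> carrier R \<Longrightarrow> pr s (\<ominus>\<^bsub>R\<^esub> f) = \<ominus>\<^bsub>K.R\<^esub> pr s f"
  by (auto simp: neg_eq K.neg_eq[OF pr_closed] pr_def)

lemma one_A: "\<one> \<in> A"
  using subgroup.one_closed[OF A] .

lemma one_K: "\<one>\<^bsub>K.R\<^esub> = elt \<one>" "\<one>\<^bsub>R\<^esub> = elt \<one>"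
  by (simp_all add: group_ring_simps)

lemma pr_one: "pr s \<one>\<^bsub>R\<^esub> = \<one>\<^bsub>K.R\<^esub>"
  by (simp add: one_K pr_elt one_A)

lemma pr_inject:
  assumes "f \<in> carrier R" "g \<in> carrier R" "pr 1 f = pr 1 g" "pr (-1) f = pr (-1) g"
  shows "f = g"
proof
  fix x
  have A: "f y = g y \<and> f (y \<otimes> z) = g (y \<otimes> z)" if "y \<in> A" for y
    using fun_cong[OF assms(3), of y] fun_cong[OF assms(4), of y] that by (auto simp: pr_def)
  show "f x = g x"
  proof (cases "x \<in> carrier G")
    case True
    then show ?thesis using A by (auto simp: carrier_eq)
  next
    case False
    then have "x \<notin> supp f" "x \<notin> supp g" using assms(1,2) by (auto simp: group_ring_simps)
    then show ?thesis by (simp add: supp_def)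
  qed
qed

lemma pr_unit:
  assumes "u \<in> Units R" "s * s = 1"
  shows "pr s u \<in> Units K.R"
proof -
  have "pr s u \<otimes>\<^bsub>K.R\<^esub> pr s (inv\<^bsub>R\<^esub> u) = \<one>\<^bsub>K.R\<^esub>" "pr s (inv\<^bsub>R\<^esub> u) \<otimes>\<^bsub>K.R\<^esub> pr s u = \<one>\<^bsub>K.R\<^esub>"
    using assms by (simp_all add: pr_mult[symmetric] R.Units_closed pr_one)
  then show ?thesis using pr_closed by (auto simp: Units_def)
qed

lemma pr_hom: "s * s = 1 \<Longrightarrow> group_hom U K.U (pr s)"
  by (auto simp: group_hom_def group_hom_axioms_def hom_def U.is_group K.U.is_group pr_unit pr_mult
      R.Units_closed)

text \<open>Both specialisations inherit torsion and the congruence, so each is 1 or -1. Opposite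
  signs would make the coefficient at 1 vanish, although it is odd.\<close>

lemma torsion_lift:
  assumes T: "K.torsion_cong_trivial"
  shows "torsion_cong_trivial"
  unfolding torsion_cong_trivial_def
proof (intro ballI allI impI)
  fix u and k :: nat
  assume u: "u \<in> Units R" and k: "k > 0" "u [^]\<^bsub>U\<^esub> k = \<one>\<^bsub>U\<^esub>"
    and c: "\<forall>y\<in>carrier G. even (u y - elt \<one> y)"
  have p: "pr s u = \<one>\<^bsub>K.R\<^esub> \<or> pr s u = \<ominus>\<^bsub>K.R\<^esub> \<one>\<^bsub>K.R\<^esub>" if s: "s = 1 \<or> s = -1" for s
  proof -
    have s2: "s * s = 1" using s by auto
    interpret h: group_hom U K.U "pr s" by (rule pr_hom[OF s2])
    have "pr s u [^]\<^bsub>K.U\<^esub> k = \<one>\<^bsub>K.U\<^esub>" using h.hom_nat_pow[of u k] u k by (simp add: pr_one)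
    moreover have "even (pr s u y - elt \<one>\<^bsub>K\<^esub> y)" if y: "y \<in> carrier K" for y
    proof -
      have yA: "y \<in> A" using y by simp
      have "y \<otimes> z \<noteq> \<one>" using z_notin[OF yA] one_A by metis
      then have "even (u (y \<otimes> z))" using c[rule_format, of "y \<otimes> z"] yA A_sub z by (auto simp: elt_def)
      moreover have "even (u y - elt \<one> y)" using c yA A_sub by blast
      ultimately show ?thesis using yA s by (auto simp: pr_def)
    qed
    ultimately show ?thesis
      using T pr_unit[OF u s2] k(1) unfolding K.torsion_cong_trivial_def by blast
  qed
  have v: "pr s u \<one> = u \<one> + s * u z" for s using one_A z by (simp add: pr_def)
  have o: "odd (u \<one>)" using c[rule_format, of \<one>] by (simp add: elt_def)
  have one: "\<one>\<^bsub>K.R\<^esub> \<one> = 1" "(\<ominus>\<^bsub>K.R\<^esub> \<one>\<^bsub>K.R\<^esub>) \<one> = - 1"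
    using K.neg_eq[OF K.R.one_closed] by (simp_all add: one_K)
  have uc: "u \<in> carrier R" using u by blast
  consider "pr 1 u = \<one>\<^bsub>K.R\<^esub>" "pr (-1) u = \<one>\<^bsub>K.R\<^esub>"
    | "pr 1 u = \<ominus>\<^bsub>K.R\<^esub> \<one>\<^bsub>K.R\<^esub>" "pr (-1) u = \<ominus>\<^bsub>K.R\<^esub> \<one>\<^bsub>K.R\<^esub>"
    | "pr 1 u \<one> + pr (-1) u \<one> = 0"
    using p[of 1] p[of "-1"] one by force
  then show "u = \<one>\<^bsub>R\<^esub> \<or> u = \<ominus>\<^bsub>R\<^esub> \<one>\<^bsub>R\<^esub>"
  proof cases
    case 1
    then have "u = \<one>\<^bsub>R\<^esub>" using uc pr_inject[of u "\<one>\<^bsub>R\<^esub>"] by (simp add: pr_one)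
    then show ?thesis ..
  next
    case 2
    then have "u = \<ominus>\<^bsub>R\<^esub> \<one>\<^bsub>R\<^esub>" using uc pr_inject[of u "\<ominus>\<^bsub>R\<^esub> \<one>\<^bsub>R\<^esub>"] by (simp add: pr_one pr_neg)
    then show ?thesis ..
  next
    case 3
    then have "u \<one> = 0" by (simp add: v)
    then show ?thesis using o by simp
  qed
qed

text \<open>The first condition cutting out \<open>M'\<close> below pulls \<open>M\<close> back along \<open>z = 1\<close>; comparing the two
  augmentations, which are signs, separates \<open>z\<close> from \<open>1\<close>.\<close>

lemma complement_lift:
  assumes tf: "torsion_free_set K.U M" and sd: "internal_semidirect K.U M (trivial_units K)"
    and T: "K.torsion_cong_trivial"
  shows "\<exists>M'. torsion_free_set U M' \<and> internal_semidirect U M' (trivial_units G)"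
proof -
  define M' where "M' = {u \<in> Units R. pr 1 u \<in> M \<and> K.aug (pr (-1) u) = K.aug (pr 1 u)}"
  interpret h: group_hom U K.U "pr 1" by (rule pr_hom) simp
  interpret h': group_hom U K.U "pr (-1)" by (rule pr_hom) simp
  have finK: "finite (carrier K)" using finA by simp
  have M: "M \<lhd> K.U" and tK: "subgroup (trivial_units K) K.U"
    and int: "M \<inter> trivial_units K = {\<one>\<^bsub>K.R\<^esub>}" and prod: "M <#>\<^bsub>K.U\<^esub> trivial_units K = Units K.R"
    using sd by (simp_all add: internal_semidirect_def)
  have Msub: "subgroup M K.U" using M K.U.normal_inv_iff by blast
  have augm: "K.aug (pr s (u \<otimes>\<^bsub>R\<^esub> v)) = K.aug (pr s u) * K.aug (pr s v)"
    if "u \<in> Units R" "v \<in> Units R" "s * s = 1" for u v s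
    using that by (simp add: pr_mult K.aug_mult[OF finK] pr_closed R.Units_closed)
  have augi: "K.aug (pr s u) * K.aug (pr s (inv\<^bsub>R\<^esub> u)) = 1" if "u \<in> Units R" "s * s = 1" for u s
    using that augm[of u "inv\<^bsub>R\<^esub> u" s] by (simp add: pr_one K.aug_one[OF finK])
  have auginv: "K.aug (pr s (inv\<^bsub>R\<^esub> u)) = K.aug (pr s u)" if "u \<in> Units R" "s * s = 1" for u s
  proof -
    have "K.aug (pr s u) = 1 \<or> K.aug (pr s u) = -1"
      using K.aug_unit[OF finK pr_unit[OF that]] by auto
    then show ?thesis using augi[OF that] by auto
  qed
  have sub': "subgroup M' U"
  proof (rule U.subgroupI)
    show "M' \<subseteq> carrier U" by (auto simp: M'_def)
    have "\<one>\<^bsub>R\<^esub> \<in> M'" using subgroup.one_closed[OF Msub] by (simp add: M'_def pr_one)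
    then show "M' \<noteq> {}" by blast
  next
    fix u assume u: "u \<in> M'"
    then have uU: "u \<in> Units R" by (simp add: M'_def)
    have "pr 1 (inv\<^bsub>R\<^esub> u) \<in> M"
      using h.hom_inv[of u] uU u subgroup.m_inv_closed[OF Msub] by (simp add: M'_def inv_U)
    then show "inv\<^bsub>U\<^esub> u \<in> M'" using u uU auginv by (simp add: M'_def inv_U)
  next
    fix u v assume u: "u \<in> M'" and v: "v \<in> M'"
    have "pr 1 (u \<otimes>\<^bsub>R\<^esub> v) \<in> M"
      using u v subgroup.m_closed[OF Msub] h.hom_mult[of u v] by (simp add: M'_def)
    then show "u \<otimes>\<^bsub>U\<^esub> v \<in> M'" using u v augm by (simp add: M'_def)
  qed
  have "M' \<lhd> U"
    unfolding U.normal_inv_iff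
  proof (intro conjI ballI sub')
    fix u m assume u: "u \<in> carrier U" and m: "m \<in> M'"
    then have uU: "u \<in> Units R" "m \<in> Units R" by (auto simp: M'_def)
    have "pr 1 u \<otimes>\<^bsub>K.U\<^esub> pr 1 m \<otimes>\<^bsub>K.U\<^esub> inv\<^bsub>K.U\<^esub> (pr 1 u) \<in> M"
      using M m uU pr_unit[of u 1] unfolding K.U.normal_inv_iff by (simp add: M'_def)
    moreover have "pr 1 (u \<otimes>\<^bsub>U\<^esub> m \<otimes>\<^bsub>U\<^esub> inv\<^bsub>U\<^esub> u)
        = pr 1 u \<otimes>\<^bsub>K.U\<^esub> pr 1 m \<otimes>\<^bsub>K.U\<^esub> inv\<^bsub>K.U\<^esub> (pr 1 u)"
      using u uU(2) U.m_closed[of u m] U.inv_closed[of u]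
      by (simp only: h.hom_mult h.hom_inv U_simps(1))
    ultimately have "pr 1 (u \<otimes>\<^bsub>U\<^esub> m \<otimes>\<^bsub>U\<^esub> inv\<^bsub>U\<^esub> u) \<in> M" by (simp only:)
    moreover have "K.aug (pr s (u \<otimes>\<^bsub>R\<^esub> m \<otimes>\<^bsub>R\<^esub> inv\<^bsub>R\<^esub> u)) = K.aug (pr s m)" if "s * s = 1" for s
      using uU that augi[OF uU(1) that] by (simp add: augm)
    ultimately show "u \<otimes>\<^bsub>U\<^esub> m \<otimes>\<^bsub>U\<^esub> inv\<^bsub>U\<^esub> u \<in> M'"
      using uU m by (simp add: M'_def inv_U)
  qed
  moreover have tG: "subgroup (trivial_units G) U" by (rule trivial_units_subgroup)
  moreover have "M' \<inter> trivial_units G = {\<one>\<^bsub>R\<^esub>}"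
  proof
    show "{\<one>\<^bsub>R\<^esub>} \<subseteq> M' \<inter> trivial_units G"
      using subgroup.one_closed[OF sub'] subgroup.one_closed[OF tG] by simp
    show "M' \<inter> trivial_units G \<subseteq> {\<one>\<^bsub>R\<^esub>}"
    proof
      fix t assume t: "t \<in> M' \<inter> trivial_units G"
      then obtain x where x: "x \<in> carrier G" "t = elt x \<or> t = \<ominus>\<^bsub>R\<^esub> elt x" by (auto simp: trivial_units_iff)
      then obtain g where g: "g \<in> A" "x = g \<or> x = g \<otimes> z" by (auto simp: carrier_eq)
      have tM: "pr 1 t \<in> M" "K.aug (pr (-1) t) = K.aug (pr 1 t)" "t \<in> Units R" using t by (auto simp: M'_def)
      have gK: "g \<in> carrier K" using g by simp
      have e: "pr 1 (elt x) = elt g" using g by (auto simp: pr_elt)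
      have "pr 1 t = elt g \<or> pr 1 t = \<ominus>\<^bsub>K.R\<^esub> elt g"
        using x e pr_neg[OF elt_closed[OF x(1)]] by auto
      then have "pr 1 t \<in> trivial_units K" using gK K.trivial_units_iff by blast
      then have p1: "pr 1 t = \<one>\<^bsub>K.R\<^esub>" using tM(1) int by blast
      have pm: "pr (-1) t = \<one>\<^bsub>K.R\<^esub> \<or> pr (-1) t = \<ominus>\<^bsub>K.R\<^esub> \<one>\<^bsub>K.R\<^esub>"
      proof -
        have "pr (-1) (elt x) = elt g \<or> pr (-1) (elt x) = \<ominus>\<^bsub>K.R\<^esub> elt g"
          using g K.neg_eq[OF K.elt_closed[OF gK]] by (auto simp: pr_elt)
        then have "pr (-1) (elt x) = pr 1 (elt x) \<or> pr (-1) (elt x) = \<ominus>\<^bsub>K.R\<^esub> pr 1 (elt x)"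
          by (simp add: e)
        then have "pr (-1) t = pr 1 t \<or> pr (-1) t = \<ominus>\<^bsub>K.R\<^esub> pr 1 t"
          using x(2) by (auto simp: pr_neg[OF elt_closed[OF x(1)]])
        then show ?thesis by (simp add: p1)
      qed
      \<comment> \<open>The value -1 would give the two projections opposite augmentations.\<close>
      have "pr (-1) t = \<one>\<^bsub>K.R\<^esub>"
        using pm tM(2) K.aug_neg[OF K.R.one_closed] K.aug_one[OF finK] by (auto simp: p1)
      then have "t = \<one>\<^bsub>R\<^esub>" using tM(3) p1 pr_inject[of t "\<one>\<^bsub>R\<^esub>"] by (simp add: pr_one R.Units_closed)
      then show "t \<in> {\<one>\<^bsub>R\<^esub>}" by simp
    qed
  qed
  moreover have "M' <#>\<^bsub>U\<^esub> trivial_units G = Units R"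
  proof
    show "M' <#>\<^bsub>U\<^esub> trivial_units G \<subseteq> Units R"
      using subgroup.subset[OF tG] by (auto simp: set_mult_def M'_def)
    show "Units R \<subseteq> M' <#>\<^bsub>U\<^esub> trivial_units G"
    proof
      fix u assume u: "u \<in> Units R"
      have "pr 1 u \<in> M <#>\<^bsub>K.U\<^esub> trivial_units K" using pr_unit[OF u, of 1] prod by simp
      then obtain m t where m: "m \<in> M" and t: "t \<in> trivial_units K" and mt: "pr 1 u = m \<otimes>\<^bsub>K.R\<^esub> t"
        by (auto simp: set_mult_def)
      obtain g where g: "g \<in> A" "t = elt g \<or> t = \<ominus>\<^bsub>K.R\<^esub> elt g" using t K.trivial_units_iff by auto
      have gG: "g \<in> carrier G" "g \<in> carrier K" using g A_sub by auto
      have "\<ominus>\<^bsub>K.R\<^esub> elt g = \<ominus>\<^bsub>R\<^esub> elt g"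
        using neg_eq[OF elt_closed[OF gG(1)]] K.neg_eq[OF K.elt_closed[OF gG(2)]] by simp
      then have tG': "t \<in> trivial_units G" and prt: "pr 1 t = t"
        using g gG pr_neg[OF elt_closed[OF gG(1)], of 1] by (auto simp: trivial_units_iff pr_elt)
      have tU: "t \<in> Units R" using subgroup.subset[OF tG] tG' by auto
      have tKU: "t \<in> Units K.R" using subgroup.subset[OF tK] t by auto
      have mU: "m \<in> Units K.R" using subgroup.subset[OF Msub] m by auto
      define v where "v = u \<otimes>\<^bsub>R\<^esub> inv\<^bsub>R\<^esub> t"
      have vU: "v \<in> Units R" using u tU by (simp add: v_def)
      have vt: "v \<otimes>\<^bsub>R\<^esub> t = u" using u tU by (simp add: v_def R.m_assoc R.Units_closed)
      have "pr 1 v \<otimes>\<^bsub>K.R\<^esub> t = m \<otimes>\<^bsub>K.R\<^esub> t"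
        using pr_mult[of v t 1] vU tU by (simp add: vt prt mt R.Units_closed)
      then have pv: "pr 1 v = m"
        using K.U.r_cancel[of "pr 1 v" t m] pr_unit[OF vU, of 1] mU tKU by simp
      show "u \<in> M' <#>\<^bsub>U\<^esub> trivial_units G"
      proof (cases "K.aug (pr (-1) v) = K.aug (pr 1 v)")
        case True
        then have "v \<in> M'" using vU pv m by (simp add: M'_def)
        then show ?thesis using tG' vt by (auto simp: set_mult_def)
      next
        case False
        have ab: "\<bar>K.aug (pr (-1) v)\<bar> = 1" "\<bar>K.aug (pr 1 v)\<bar> = 1"
          using K.aug_unit[OF finK] pr_unit[OF vU] by simp_all
        have z1: "elt z \<in> Units R" "elt z \<in> trivial_units G"
          using z elt_unit by (auto simp: trivial_units_iff)
        have zz1: "elt z \<otimes>\<^bsub>R\<^esub> elt z = \<one>\<^bsub>R\<^esub>" using z by (simp add: elt_mult one_K)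
        have pz: "pr s (elt z) = (\<lambda>x. s * elt \<one> x)" for s
          using pr_elt(2)[OF one_A] z(1) by simp
        have pz1: "pr 1 (elt z) = \<one>\<^bsub>K.R\<^esub>" "pr (-1) (elt z) = \<ominus>\<^bsub>K.R\<^esub> \<one>\<^bsub>K.R\<^esub>"
          using K.neg_eq[OF K.R.one_closed] by (simp_all add: pz one_K)
        \<comment> \<open>Multiplication by z keeps \<open>pr 1\<close> and negates
          \<open>pr (-1)\<close>. Both augmentations are signs, so if they differ they are opposite,
          and one factor z makes them equal.\<close>
        define w where "w = v \<otimes>\<^bsub>R\<^esub> elt z"
        have wU: "w \<in> Units R" using vU z1 by (simp add: w_def)
        have "pr 1 w = m"
          using vU z1 mU by (simp add: w_def pr_mult R.Units_closed pz1 pv K.R.Units_closed)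
        moreover have "K.aug (pr (-1) w) = - K.aug (pr (-1) v)"
          using vU z1 augm[of v "elt z" "-1"] K.aug_neg[OF K.R.one_closed] K.aug_one[OF finK]
          by (simp add: w_def pz1)
        ultimately have "w \<in> M'" using wU m pv ab False by (auto simp: M'_def)
        moreover have "elt z \<otimes>\<^bsub>R\<^esub> t \<in> trivial_units G"
          using subgroup.m_closed[OF tG z1(2) tG'] by simp
        moreover have "w \<otimes>\<^bsub>R\<^esub> (elt z \<otimes>\<^bsub>R\<^esub> t) = v \<otimes>\<^bsub>R\<^esub> (elt z \<otimes>\<^bsub>R\<^esub> elt z) \<otimes>\<^bsub>R\<^esub> t"
          using vU z1(1) tU by (simp only: w_def R.m_assoc R.m_closed R.Units_closed)
        then have "w \<otimes>\<^bsub>R\<^esub> (elt z \<otimes>\<^bsub>R\<^esub> t) = u" using vU vt by (simp add: zz1 R.Units_closed)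
        ultimately show ?thesis by (auto simp: set_mult_def)
      qed
    qed
  qed
  moreover have "torsion_free_set U M'"
    unfolding torsion_free_set_def
  proof (intro ballI allI impI)
    fix u and k :: nat
    assume u: "u \<in> M'" and k: "k > 0" "u [^]\<^bsub>U\<^esub> k = \<one>\<^bsub>U\<^esub>"
    have uU: "u \<in> Units R" and uM: "pr 1 u \<in> M" using u by (auto simp: M'_def)
    have "pr 1 u [^]\<^bsub>K.U\<^esub> k = \<one>\<^bsub>K.U\<^esub>" using h.hom_nat_pow[of u k] uU k(2) by (simp add: pr_one)
    then have p1: "pr 1 u = \<one>\<^bsub>K.R\<^esub>" using tf uM k(1) unfolding torsion_free_set_def by simp
    have pk: "pr (-1) u [^]\<^bsub>K.U\<^esub> k = \<one>\<^bsub>K.U\<^esub>" using h'.hom_nat_pow[of u k] uU k(2) by (simp add: pr_one)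
    \<comment> \<open>The two projections differ by twice a coefficient, so \<open>pr (-1) u\<close>
      is congruent modulo 2 to \<open>pr 1 u\<close>, which is one.\<close>
    have "even (pr (-1) u y - elt \<one>\<^bsub>K\<^esub> y)" if "y \<in> carrier K" for y
    proof -
      have "pr 1 u y = elt \<one> y" using p1 by (simp add: one_K)
      then show ?thesis using that by (simp add: pr_def)
    qed
    then have "pr (-1) u = \<one>\<^bsub>K.R\<^esub> \<or> pr (-1) u = \<ominus>\<^bsub>K.R\<^esub> \<one>\<^bsub>K.R\<^esub>"
      using T pr_unit[OF uU, of "-1"] k(1) pk unfolding K.torsion_cong_trivial_def by simp
    moreover have "K.aug (pr (-1) u) = 1" using u p1 K.aug_one[OF finK] by (simp add: M'_def)
    ultimately have "pr (-1) u = \<one>\<^bsub>K.R\<^esub>"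
      using K.aug_neg[OF K.R.one_closed] K.aug_one[OF finK] by auto
    then show "u = \<one>\<^bsub>U\<^esub>" using uU p1 pr_inject[of u "\<one>\<^bsub>R\<^esub>"] by (simp add: pr_one R.Units_closed)
  qed
  ultimately show ?thesis unfolding internal_semidirect_def by auto
qed

end

section \<open>The presented dihedral group\<close>

text \<open>Moving b past a power of a multiplies the exponent by 3, which is -1 modulo 4 and keeps
  exponents natural.\<close>

lemma (in group) dihedral_table:
  assumes a: "a \<in> carrier G" "a [^] (4::nat) = \<one>" and b: "b \<in> carrier G" "b \<otimes> b = \<one>"
    and ba: "b \<otimes> a = a [^] (3::nat) \<otimes> b"
    and ij: "i < 8" "j < 8"
  defines "d \<equiv> \<lambda>i. if i < 4 then a [^] (i::nat) else a [^] (i - 4) \<otimes> b"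
  shows "d i \<otimes> d j = d (dihedral_index i j)"
proof -
  have md: "a [^] n = a [^] (n mod 4)" for n :: nat
  proof -
    have "a [^] n = (a [^] (4::nat)) [^] (n div 4) \<otimes> a [^] (n mod 4)"
      using a(1) by (simp add: nat_pow_pow nat_pow_mult)
    then show ?thesis using a by simp
  qed
  have eq: "a [^] m = a [^] n" if "m mod 4 = n mod 4" for m n :: nat
    using md[of m] md[of n] that by simp
  have bp: "b \<otimes> a [^] n = a [^] (3 * n) \<otimes> b" for n :: nat
  proof (induction n)
    case (Suc n)
    have "b \<otimes> a [^] Suc n = (b \<otimes> a [^] n) \<otimes> a" using a b by (simp add: m_assoc)
    also have "\<dots> = a [^] (3 * n) \<otimes> (b \<otimes> a)" unfolding Suc using a b by (simp add: m_assoc)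
    also have "\<dots> = (a [^] (3 * n) \<otimes> a [^] (3::nat)) \<otimes> b" unfolding ba using a b by (simp add: m_assoc)
    finally show ?case using a by (simp add: nat_pow_mult add.commute)
  qed (use b in simp)
  have p: "a [^] m \<otimes> a [^] n = a [^] (m + n)" for m n :: nat using a by (simp add: nat_pow_mult)
  have c: "a [^] n \<in> carrier G" for n :: nat using a by simp
  consider "i < 4" "j < 4" | "i < 4" "\<not> j < 4" | "\<not> i < 4" "j < 4" | "\<not> i < 4" "\<not> j < 4" by blast
  then show ?thesis
  proof cases
    case 1
    then show ?thesis using md[of "i + j"] by (simp add: d_def dihedral_index_def p)
  next
    case 2
    have "i + j = i + (j - 4) + 4" using 2 by simp
    then have "(i + (j - 4)) mod 4 = (i + j) mod 4" by (simp only: mod_add_self2)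
    then have "a [^] (i + (j - 4)) = a [^] ((i + j) mod 4)" by (intro eq) simp
    then show ?thesis
      using 2 b c by (simp add: d_def dihedral_index_def m_assoc[symmetric] p)
  next
    case 3
    have "(i - 4 + 3 * j) mod 4 = (i + 4 - j) mod 4"
    proof -
      \<comment> \<open>Multiples of 4 are added on both sides to make this an identity of natural
        numbers without truncated subtraction; likewise with \<open>4 * 5\<close> below.\<close>
      have "i - 4 + 3 * j + 4 * 2 = (i + 4 - j) + 4 * j" using 3 by simp
      then have "(i - 4 + 3 * j + 4 * 2) mod 4 = (i + 4 - j + 4 * j) mod 4" by (rule arg_cong)
      then show ?thesis by (simp only: mod_mult_self2)
    qed
    then have e: "a [^] (i - 4 + 3 * j) = a [^] ((i + 4 - j) mod 4)" by (intro eq) simp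
    have "d i \<otimes> d j = a [^] (i - 4) \<otimes> (b \<otimes> a [^] j)" using 3 b c by (simp add: d_def m_assoc)
    also have "\<dots> = a [^] (i - 4 + 3 * j) \<otimes> b" unfolding bp using b c by (simp add: m_assoc[symmetric] p)
    also have "\<dots> = a [^] ((i + 4 - j) mod 4) \<otimes> b" by (simp only: e)
    finally show ?thesis using 3 by (simp add: d_def dihedral_index_def)
  next
    case 4
    have "(i - 4 + 3 * (j - 4)) mod 4 = (i + 4 - j) mod 4"
    proof -
      have "i - 4 + 3 * (j - 4) + 4 * 5 = (i + 4 - j) + 4 * j" using 4 ij by simp
      then have "(i - 4 + 3 * (j - 4) + 4 * 5) mod 4 = (i + 4 - j + 4 * j) mod 4" by (rule arg_cong)
      then show ?thesis by (simp only: mod_mult_self2)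
    qed
    then have e: "a [^] (i - 4 + 3 * (j - 4)) = a [^] ((i + 4 - j) mod 4)" by (intro eq) simp
    have "d i \<otimes> d j = a [^] (i - 4) \<otimes> (b \<otimes> a [^] (j - 4)) \<otimes> b" using 4 b c by (simp add: d_def m_assoc)
    also have "\<dots> = ((a [^] (i - 4) \<otimes> a [^] (3 * (j - 4))) \<otimes> b) \<otimes> b"
      unfolding bp using b c by (simp add: m_assoc)
    also have "\<dots> = a [^] (i - 4 + 3 * (j - 4)) \<otimes> (b \<otimes> b)"
      unfolding p by (rule m_assoc) (simp_all add: b c)
    also have "\<dots> = a [^] ((i + 4 - j) mod 4)" unfolding e b(2) using c by simp
    finally show ?thesis using 4 by (simp add: d_def dihedral_index_def)
  qed
qed

text \<open>The relations bring every word to one of eight normal forms. These stay distinct because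
  the relations hold for two explicit quadruples, whose products separate the eight forms.\<close>

lemma D8_dihedral: "\<exists>d. dihedral8 D8 d"
proof -
  define F where "F = free_group (UNIV :: dihedral_gen set)"
  define a where "a = [(gen_a, True)]"
  define b where "b = [(gen_b, True)]"
  define E where "E = {(a [^]\<^bsub>F\<^esub> (4::nat), \<one>\<^bsub>F\<^esub>), (b [^]\<^bsub>F\<^esub> (2::nat), \<one>\<^bsub>F\<^esub>),
    (inv\<^bsub>F\<^esub> b \<otimes>\<^bsub>F\<^esub> a \<otimes>\<^bsub>F\<^esub> b, inv\<^bsub>F\<^esub> a)}"
  define N where "N = relators_closure UNIV E"
  interpret F: group F unfolding F_def by (rule group_free_group)
  have ab: "a \<in> carrier F" "b \<in> carrier F" by (simp_all add: a_def b_def F_def free_group_gen)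
  have EF: "u \<in> carrier F" "v \<in> carrier F" if "(u, v) \<in> E" for u v
    using that ab by (auto simp: E_def)
  then have "N \<lhd> F" unfolding N_def F_def by (intro relators_closure_normal) auto
  then interpret N: normal N F .
  have D8: "D8 = F Mod N"
    by (simp add: D8_def Let_def presented_group_def N_def E_def F_def a_def b_def)
  interpret D: group D8 by (rule group_D8)
  define \<pi> where "\<pi> w = N #>\<^bsub>F\<^esub> w" for w
  have "\<pi> \<in> hom F D8" unfolding D8 \<pi>_def by (rule N.r_coset_hom_Mod)
  then interpret \<pi>: group_hom F D8 \<pi> by (simp add: group_hom_def group_hom_axioms_def D.is_group F.is_group)
  have surj: "\<pi> ` carrier F = carrier D8" by (auto simp: D8 FactGroup_def RCOSETS_def \<pi>_def)
  have rel: "\<pi> u = \<pi> v" if "(u, v) \<in> E" for u v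
  proof -
    have c: "u \<in> carrier F" "v \<in> carrier F" using EF that by blast+
    have "\<one>\<^bsub>F\<^esub> \<otimes>\<^bsub>F\<^esub> (u \<otimes>\<^bsub>F\<^esub> inv\<^bsub>F\<^esub> v) \<otimes>\<^bsub>F\<^esub> inv\<^bsub>F\<^esub> \<one>\<^bsub>F\<^esub> \<in> N"
      unfolding N_def relators_closure_def Let_def F_def[symmetric]
      using that by (intro generate.incl) blast
    then have "u \<otimes>\<^bsub>F\<^esub> inv\<^bsub>F\<^esub> v \<in> N" using c by simp
    then have "u \<in> N #>\<^bsub>F\<^esub> v"
      using c by (auto simp: r_coset_def F.m_assoc intro!: bexI[of _ "u \<otimes>\<^bsub>F\<^esub> inv\<^bsub>F\<^esub> v"])
    then show ?thesis
      unfolding \<pi>_def using F.repr_independence[OF _ c(2) N.subgroup_axioms] by blast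
  qed
  define \<alpha> where "\<alpha> = \<pi> a"
  define \<beta> where "\<beta> = \<pi> b"
  have car: "\<alpha> \<in> carrier D8" "\<beta> \<in> carrier D8" using ab by (simp_all add: \<alpha>_def \<beta>_def)
  have r1: "\<alpha> [^]\<^bsub>D8\<^esub> (4::nat) = \<one>\<^bsub>D8\<^esub>"
    using rel[of "a [^]\<^bsub>F\<^esub> (4::nat)" "\<one>\<^bsub>F\<^esub>"] \<pi>.hom_nat_pow[OF ab(1), of 4] by (simp add: E_def \<alpha>_def)
  have "\<beta> [^]\<^bsub>D8\<^esub> (2::nat) = \<one>\<^bsub>D8\<^esub>"
    using rel[of "b [^]\<^bsub>F\<^esub> (2::nat)" "\<one>\<^bsub>F\<^esub>"] \<pi>.hom_nat_pow[OF ab(2), of 2] by (simp add: E_def \<beta>_def)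
  then have r2: "\<beta> \<otimes>\<^bsub>D8\<^esub> \<beta> = \<one>\<^bsub>D8\<^esub>" using car by (simp add: numeral_2_eq_2)
  have "\<pi> (inv\<^bsub>F\<^esub> b \<otimes>\<^bsub>F\<^esub> a \<otimes>\<^bsub>F\<^esub> b) = \<pi> (inv\<^bsub>F\<^esub> a)" by (rule rel) (simp add: E_def)
  then have r3: "inv\<^bsub>D8\<^esub> \<beta> \<otimes>\<^bsub>D8\<^esub> \<alpha> \<otimes>\<^bsub>D8\<^esub> \<beta> = inv\<^bsub>D8\<^esub> \<alpha>" using ab by (simp add: \<alpha>_def \<beta>_def)
  have ib: "inv\<^bsub>D8\<^esub> \<beta> = \<beta>" using car r2 by (intro D.inv_equality)
  have ia: "inv\<^bsub>D8\<^esub> \<alpha> = \<alpha> [^]\<^bsub>D8\<^esub> (3::nat)"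
    using car r1 by (intro D.inv_equality) (simp_all add: eval_nat_numeral)
  have ba: "\<beta> \<otimes>\<^bsub>D8\<^esub> \<alpha> = \<alpha> [^]\<^bsub>D8\<^esub> (3::nat) \<otimes>\<^bsub>D8\<^esub> \<beta>"
  proof -
    have "\<beta> \<otimes>\<^bsub>D8\<^esub> \<alpha> = (\<beta> \<otimes>\<^bsub>D8\<^esub> \<alpha> \<otimes>\<^bsub>D8\<^esub> \<beta>) \<otimes>\<^bsub>D8\<^esub> \<beta>" using car r2 by (simp add: D.m_assoc)
    then show ?thesis using r3 ib ia by simp
  qed
  define d where "d i = (if i < 4 then \<alpha> [^]\<^bsub>D8\<^esub> (i::nat) else \<alpha> [^]\<^bsub>D8\<^esub> (i - 4) \<otimes>\<^bsub>D8\<^esub> \<beta>)" for i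
  have tab: "d i \<otimes>\<^bsub>D8\<^esub> d j = d (dihedral_index i j)" if "i < 8" "j < 8" for i j
    using D.dihedral_table[OF car(1) r1 car(2) r2 ba that] unfolding d_def .
  have dc: "d i \<in> carrier D8" for i using car by (simp add: d_def)
  have d1: "d 0 = \<one>\<^bsub>D8\<^esub>" "d 1 = \<alpha>" "d 3 = inv\<^bsub>D8\<^esub> \<alpha>" "d 4 = \<beta>" using car ia by (simp_all add: d_def)
  have "\<pi> w \<in> d ` {..<8}" if "w \<in> carrier F" for w
    using that
  proof (induction w)
    case Nil
    have "\<pi> [] = d 0" using \<pi>.hom_one d1 by (simp add: F_def)
    then show ?case by auto
  next
    case (Cons p w)
    have w: "w \<in> carrier F" and r: "reduced (p # w)"
      using Cons.prems by (auto simp: F_def free_group_carrier reduced_Cons)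
    have pc: "[p] \<in> carrier F" by (simp add: F_def free_group_gen)
    have "p # w = [p] \<otimes>\<^bsub>F\<^esub> w" using r by (cases w) (auto simp: reduced_Cons F_def)
    then have "\<pi> (p # w) = \<pi> [p] \<otimes>\<^bsub>D8\<^esub> \<pi> w" using \<pi>.hom_mult[OF pc w] by simp
    moreover obtain j where j: "j < 8" "\<pi> w = d j" using Cons.IH[OF w] by auto
    moreover have "\<exists>i<8. \<pi> [p] = d i"
    proof -
      have inv: "\<pi> [(x, False)] = inv\<^bsub>D8\<^esub> \<pi> [(x, True)]" for x
        using free_group_inv_gen[of x UNIV True] \<pi>.hom_inv[of "[(x, True)]"]
        by (simp add: F_def free_group_gen)
      obtain x s where p: "p = (x, s)" by (cases p)
      consider "p = (gen_a, True)" | "p = (gen_a, False)" | "p = (gen_b, True)" | "p = (gen_b, False)"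
        by (cases x; cases s) (auto simp: p)
      then have "\<pi> [p] = d 1 \<or> \<pi> [p] = d 3 \<or> \<pi> [p] = d 4"
        using d1 ib inv by cases (simp_all add: \<alpha>_def \<beta>_def a_def b_def)
      then show ?thesis by (elim disjE) (rule exI[of _ 1] exI[of _ 3] exI[of _ 4]; simp)+
    qed
    ultimately show ?case using tab dihedral_index_less by auto
  qed
  then have "\<pi> ` carrier F \<subseteq> d ` {..<8}" by blast
  then have car_eq: "carrier D8 = d ` {..<8}" unfolding surj using dc by blast
  \<comment> \<open>The faithful representation of the dihedral group by integral 2 x 2
    matrices.\<close>
  define g :: "dihedral_gen \<Rightarrow> quad" where
    "g x = (case x of gen_a \<Rightarrow> (0, 1, 0, 0) | gen_b \<Rightarrow> (0, 0, 1, 0))" for x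
  have gQ: "g ` UNIV \<subseteq> carrier QG" by (auto simp: g_def split: dihedral_gen.split)
  interpret \<psi>: group_hom F QG "word_val QG g" unfolding F_def by (rule QG.word_val_group_hom[OF gQ])
  have \<psi>a: "word_val QG g a = (0, 1, 0, 0)" "word_val QG g b = (0, 0, 1, 0)"
    using gQ by (simp_all add: a_def b_def QG.word_val_gen g_def qmul_one letter_val_def)
  have \<psi>E: "word_val QG g u = word_val QG g v" if "(u, v) \<in> E" for u v
    using that ab \<psi>a unfolding E_def
    by (auto simp: \<psi>.hom_nat_pow inv_QG Let_def eval_nat_numeral)
  have NK: "N \<subseteq> kernel F QG (word_val QG g)"
    unfolding N_def relators_closure_def Let_def F_def[symmetric]
  proof (rule F.generate_subgroup_incl[OF _ \<psi>.subgroup_kernel])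
    show "{h \<otimes>\<^bsub>F\<^esub> (u \<otimes>\<^bsub>F\<^esub> inv\<^bsub>F\<^esub> v) \<otimes>\<^bsub>F\<^esub> inv\<^bsub>F\<^esub> h |h u v. h \<in> carrier F \<and> (u, v) \<in> E}
      \<subseteq> kernel F QG (word_val QG g)"
    proof
      fix x assume "x \<in> {h \<otimes>\<^bsub>F\<^esub> (u \<otimes>\<^bsub>F\<^esub> inv\<^bsub>F\<^esub> v) \<otimes>\<^bsub>F\<^esub> inv\<^bsub>F\<^esub> h |h u v. h \<in> carrier F \<and> (u, v) \<in> E}"
      then obtain h u v where x: "x = h \<otimes>\<^bsub>F\<^esub> (u \<otimes>\<^bsub>F\<^esub> inv\<^bsub>F\<^esub> v) \<otimes>\<^bsub>F\<^esub> inv\<^bsub>F\<^esub> h" "h \<in> carrier F" "(u, v) \<in> E"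
        by blast
      have c: "u \<in> carrier F" "v \<in> carrier F" using EF x(3) by blast+
      let ?w = "word_val QG g"
      have "?w x = ?w h \<otimes>\<^bsub>QG\<^esub> (?w u \<otimes>\<^bsub>QG\<^esub> inv\<^bsub>QG\<^esub> ?w v) \<otimes>\<^bsub>QG\<^esub> inv\<^bsub>QG\<^esub> ?w h"
        using x c F.m_closed F.inv_closed by (simp only: \<psi>.hom_mult \<psi>.hom_inv)
      also have "\<dots> = \<one>\<^bsub>QG\<^esub>"
        using \<psi>E[OF x(3)] \<psi>.hom_closed[OF c(2)] \<psi>.hom_closed[OF x(2)]
        by (simp only: QG.r_inv QG.r_one)
      finally show "x \<in> kernel F QG ?w" using x c by (simp add: kernel_def)
    qed
  qed
  have fac: "word_val QG g u = word_val QG g v" if "\<pi> u = \<pi> v" "u \<in> carrier F" "v \<in> carrier F" for u v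
  proof -
    have "u \<in> N #>\<^bsub>F\<^esub> v" using that F.rcos_self[OF that(2) N.subgroup_axioms] by (simp add: \<pi>_def)
    then obtain n where n: "n \<in> N" "u = n \<otimes>\<^bsub>F\<^esub> v" by (auto simp: r_coset_def)
    then have "n \<in> carrier F" "word_val QG g n = \<one>\<^bsub>QG\<^esub>" using NK by (auto simp: kernel_def)
    then show ?thesis using n(2) \<psi>.hom_mult[of n v] \<psi>.hom_closed[OF that(3)] that(3)
      by (simp only: QG.l_one)
  qed
  define w where "w i = (if i < 4 then a [^]\<^bsub>F\<^esub> (i::nat) else a [^]\<^bsub>F\<^esub> (i - 4) \<otimes>\<^bsub>F\<^esub> b)" for i
  have wc: "w i \<in> carrier F" for i using ab by (simp add: w_def)
  have dw: "d i = \<pi> (w i)" for i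
    using ab by (simp add: d_def w_def \<alpha>_def \<beta>_def \<pi>.hom_nat_pow)
  define L :: "quad list" where
    "L = [(1, 0, 0, 0), (0, 1, 0, 0), (-1, 0, 0, 0), (0, -1, 0, 0),
      (0, 0, 1, 0), (0, 0, 0, 1), (0, 0, -1, 0), (0, 0, 0, -1)]"
  have L: "distinct L" "length L = 8" by (simp_all add: L_def)
  have \<psi>w: "word_val QG g (w i) = L ! i" if "i < 8" for i
  proof -
    have 1: "word_val QG g (w i) = (if i < 4 then (0, 1, 0, 0) [^]\<^bsub>QG\<^esub> i
        else (0, 1, 0, 0) [^]\<^bsub>QG\<^esub> (i - 4) \<otimes>\<^bsub>QG\<^esub> (0, 0, 1, 0))"
      using ab \<psi>a by (simp add: w_def \<psi>.hom_nat_pow del: QG_simps(2))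
    have p: "(0, 1, 0, 0) [^]\<^bsub>QG\<^esub> (0::nat) = (1, 0, 0, 0)" "(0, 1, 0, 0) [^]\<^bsub>QG\<^esub> (1::nat) = (0, 1, 0, 0)"
      "(0, 1, 0, 0) [^]\<^bsub>QG\<^esub> (2::nat) = (-1, 0, 0, 0)" "(0, 1, 0, 0) [^]\<^bsub>QG\<^esub> (3::nat) = (0, -1, 0, 0)"
      by (simp_all add: eval_nat_numeral)
    show ?thesis using that unfolding 1 less_8_iff by (elim disjE) (simp_all add: p[simplified] L_def)
  qed
  have "inj_on d {..<8}"
  proof (rule inj_onI)
    fix i j assume ij: "i \<in> {..<8::nat}" "j \<in> {..<8}" and "d i = d j"
    then have "\<pi> (w i) = \<pi> (w j)" by (simp add: dw)
    from fac[OF this wc wc] have "word_val QG g (w i) = word_val QG g (w j)" .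
    then have "L ! i = L ! j" using ij \<psi>w by simp
    then show "i = j" using ij L nth_eq_iff_index_eq[OF L(1), of i j] by simp
  qed
  then have "dihedral8 D8 d"
    by (simp add: dihedral8_def integral_group_ring_def dihedral8_axioms_def D.is_group car_eq tab)
  then show ?thesis by blast
qed

section \<open>Products with elementary abelian 2-groups\<close>

text \<open>The base case of the induction below: a copy of the dihedral group cut out by vanishing
  coordinates, in the same form as the later stages.\<close>

lemma dihedral8_D8_C2_power:
  fixes n :: nat
  defines "H \<equiv> D8 \<times>\<times> C2_power n"
  shows "\<exists>d. dihedral8 (H\<lparr>carrier := {x \<in> carrier H. \<forall>i<n. snd x i = 0}\<rparr>) d"
proof -
  obtain d where "dihedral8 D8 d" using D8_dihedral by blast
  then interpret D: dihedral8 D8 d .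
  have C: "group (C2_power n)" by (rule group_C2_power)
  interpret C: group "C2_power n" by (rule C)
  have one: "\<one>\<^bsub>C2_power n\<^esub> = (\<lambda>i\<in>{..<n}. 0)" by (simp add: C2_power_def product_group_def)
  have A: "{x \<in> carrier H. \<forall>i<n. snd x i = 0} = (\<lambda>i. (d i, \<one>\<^bsub>C2_power n\<^esub>)) ` {..<8}"
  proof -
    have "v = \<one>\<^bsub>C2_power n\<^esub>" if "v \<in> carrier (C2_power n)" "\<forall>i<n. v i = 0" for v
      using that unfolding one by (auto simp: C2_power_def PiE_def extensional_def)
    moreover have "\<one>\<^bsub>C2_power n\<^esub> i = 0" if "i < n" for i using that by (simp add: one)
    ultimately show ?thesis unfolding H_def by (auto simp: DirProd_def D.carrier_eq)
  qed
  have m: "(d i, \<one>\<^bsub>C2_power n\<^esub>) \<otimes>\<^bsub>H\<^esub> (d j, \<one>\<^bsub>C2_power n\<^esub>) = (d (dihedral_index i j), \<one>\<^bsub>C2_power n\<^esub>)"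
    if "i < 8" "j < 8" for i j
    using that by (simp add: H_def DirProd_def D.mult)
  have H: "group H" unfolding H_def by (rule DirProd_group[OF D.is_group C])
  then interpret H: group H .
  have "subgroup {x \<in> carrier H. \<forall>i<n. snd x i = 0} H"
  proof -
    have "{x \<in> carrier H. \<forall>i<n. snd x i = 0} = carrier D8 \<times> {\<one>\<^bsub>C2_power n\<^esub>}"
      unfolding A D.carrier_eq by auto
    then show ?thesis unfolding H_def
      using DirProd_subgroups[OF D.is_group D.subgroup_self C C.triv_subgroup] by simp
  qed
  then have "group (H\<lparr>carrier := {x \<in> carrier H. \<forall>i<n. snd x i = 0}\<rparr>)" by (rule H.subgroup_imp_group)
  moreover have "inj_on (\<lambda>i. (d i, \<one>\<^bsub>C2_power n\<^esub>)) {..<8}" using D.inj by (auto simp: inj_on_def)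
  ultimately have "dihedral8 (H\<lparr>carrier := {x \<in> carrier H. \<forall>i<n. snd x i = 0}\<rparr>)
      (\<lambda>i. (d i, \<one>\<^bsub>C2_power n\<^esub>))"
    using A m by (simp add: dihedral8_def integral_group_ring_def dihedral8_axioms_def)
  then show ?thesis by blast
qed

text \<open>Induction along the subgroups \<open>A k\<close> in which the C_2-coordinates from k on
  vanish. The predicate \<open>P\<close> carries the torsion statement along with the complement,
  since extending a complement uses it.\<close>

lemma D8_C2_power_complement:
  "\<exists>M. torsion_free_set (unit_group (D8 \<times>\<times> C2_power n)) M \<and>
    internal_semidirect (unit_group (D8 \<times>\<times> C2_power n)) M (trivial_units (D8 \<times>\<times> C2_power n))"
proof -
  define H where "H = D8 \<times>\<times> C2_power n"
  define A where "A k = {x \<in> carrier H. \<forall>i<n. k \<le> i \<longrightarrow> snd x i = 0}" for k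
  define P where "P K \<longleftrightarrow> (\<exists>M. torsion_free_set (unit_group K) M \<and>
    internal_semidirect (unit_group K) M (trivial_units K)) \<and> integral_group_ring.torsion_cong_trivial K"
    for K :: "(dihedral_gen letter list set \<times> (nat \<Rightarrow> int)) monoid"
  obtain d where "dihedral8 D8 d" using D8_dihedral by blast
  then interpret D: dihedral8 D8 d .
  interpret H: group H unfolding H_def by (rule DirProd_group[OF D.is_group group_C2_power])
  have "0 \<le> m \<and> m < 2 \<longleftrightarrow> m = 0 \<or> m = 1" for m :: int by auto
  then have vC: "v \<in> carrier (C2_power n) \<longleftrightarrow> (\<forall>i<n. v i = 0 \<or> v i = 1) \<and> v \<in> extensional {..<n}" for v
    by (auto simp: C2_power_def PiE_iff carrier_integer_mod_group)
  have Hc: "x \<in> carrier H \<longleftrightarrow> fst x \<in> carrier D8 \<and> snd x \<in> carrier (C2_power n)" for x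
    by (cases x) (simp add: H_def DirProd_def)
  have Hm: "x \<otimes>\<^bsub>H\<^esub> y = (fst x \<otimes>\<^bsub>D8\<^esub> fst y, \<lambda>i\<in>{..<n}. (snd x i + snd y i) mod 2)" for x y
    by (cases x; cases y) (simp add: H_def DirProd_def C2_power_def product_group_def)
  have H1: "\<one>\<^bsub>H\<^esub> = (\<one>\<^bsub>D8\<^esub>, \<lambda>i\<in>{..<n}. 0)"
    by (simp add: H_def DirProd_def C2_power_def product_group_def)
  have fin: "finite (carrier H)"
    by (simp add: H_def DirProd_def C2_power_def D.carrier_eq carrier_integer_mod_group finite_PiE)
  have sub: "subgroup (A k) H" for k
  proof (rule H.subgroupI)
    show "A k \<subseteq> carrier H" by (auto simp: A_def)
    have "\<one>\<^bsub>H\<^esub> \<in> A k" using H.one_closed by (simp add: A_def H1)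
    then show "A k \<noteq> {}" by blast
  next
    fix x assume x: "x \<in> A k"
    then have xc: "x \<in> carrier H" by (simp add: A_def)
    have "snd (inv\<^bsub>H\<^esub> x) i = 0" if i: "i < n" "k \<le> i" for i
    proof -
      have "snd (inv\<^bsub>H\<^esub> x \<otimes>\<^bsub>H\<^esub> x) i = 0" using xc i by (simp add: H1)
      then have "(snd (inv\<^bsub>H\<^esub> x) i + snd x i) mod 2 = 0" using i by (simp add: Hm)
      moreover have "snd x i = 0" using x i by (simp add: A_def)
      moreover have "snd (inv\<^bsub>H\<^esub> x) i = 0 \<or> snd (inv\<^bsub>H\<^esub> x) i = 1"
        using H.inv_closed[OF xc] i by (simp add: Hc vC)
      ultimately show ?thesis by auto
    qed
    then show "inv\<^bsub>H\<^esub> x \<in> A k" using xc by (simp add: A_def)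
  next
    fix x y assume x: "x \<in> A k" and y: "y \<in> A k"
    then have "x \<otimes>\<^bsub>H\<^esub> y \<in> carrier H" by (simp add: A_def)
    moreover have "snd (x \<otimes>\<^bsub>H\<^esub> y) i = 0" if "i < n" "k \<le> i" for i
      using x y that by (simp add: Hm A_def)
    ultimately show "x \<otimes>\<^bsub>H\<^esub> y \<in> A k" by (simp add: A_def)
  qed
  have "P (H\<lparr>carrier := A k\<rparr>)" if "k \<le> n" for k
    using that
  proof (induction k)
    case 0
    have "A 0 = {x \<in> carrier H. \<forall>i<n. snd x i = 0}" by (simp add: A_def)
    then obtain d' where "dihedral8 (H\<lparr>carrier := A 0\<rparr>) d'"
      using dihedral8_D8_C2_power[of n] by (auto simp: H_def)
    then interpret A: dihedral8 "H\<lparr>carrier := A 0\<rparr>" d' .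
    show ?case
      unfolding P_def using A.lift_cong_quads_0_torsion_free A.lift_cong_quads_0_complement A.torsion_cong_trivial by blast
  next
    case (Suc k)
    define K where "K = H\<lparr>carrier := A (Suc k)\<rparr>"
    \<comment> \<open>The basis vector of coordinate k, the only new generator of
      \<open>A (Suc k)\<close> over \<open>A k\<close>.\<close>
    define z where "z = (\<one>\<^bsub>D8\<^esub>, \<lambda>i\<in>{..<n}. if i = k then 1 else 0 :: int)"
    have kn: "k < n" using Suc.prems by simp
    have AA: "A k \<subseteq> A (Suc k)" by (auto simp: A_def)
    have zc: "z \<in> carrier H" by (auto simp: Hc vC z_def)
    then have zA: "z \<in> A (Suc k)" by (simp add: A_def z_def)
    have zn: "z \<notin> A k" using kn by (auto simp: A_def z_def)
    have zz: "z \<otimes>\<^bsub>H\<^esub> z = \<one>\<^bsub>H\<^esub>" by (auto simp: Hm H1 z_def)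
    have zx: "z \<otimes>\<^bsub>H\<^esub> x = x \<otimes>\<^bsub>H\<^esub> z" if "x \<in> carrier H" for x
      using that by (auto simp: Hm Hc z_def add.commute)
    have "x \<in> A k \<union> (\<lambda>x. x \<otimes>\<^bsub>H\<^esub> z) ` A k" if x: "x \<in> A (Suc k)" for x
    proof (cases "snd x k = 0")
      case True
      then have "x \<in> A k" using x by (auto simp: A_def le_eq_less_or_eq Suc_le_eq)
      then show ?thesis by blast
    next
      case False
      have xc: "x \<in> carrier H" using x by (simp add: A_def)
      then have xk: "snd x k = 1" using False kn unfolding Hc vC by blast
      have "snd (x \<otimes>\<^bsub>H\<^esub> z) i = 0" if i: "i < n" "k \<le> i" for i
      proof (cases "i = k")
        case True
        then show ?thesis using xk kn by (simp add: Hm z_def)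
      next
        case False
        then have "Suc k \<le> i" using i by simp
        then have "snd x i = 0" using x i by (simp add: A_def)
        then show ?thesis using False i by (simp add: Hm z_def)
      qed
      then have "x \<otimes>\<^bsub>H\<^esub> z \<in> A k" using H.m_closed[OF xc zc] by (simp add: A_def)
      moreover have "x = (x \<otimes>\<^bsub>H\<^esub> z) \<otimes>\<^bsub>H\<^esub> z" using xc zc zz by (simp add: H.m_assoc)
      ultimately show ?thesis by blast
    qed
    moreover have "x \<otimes>\<^bsub>H\<^esub> z \<in> A (Suc k)" if "x \<in> A k" for x
      using subgroup.m_closed[OF sub, of x "Suc k" z] that AA zA by blast
    ultimately have Aeq: "A (Suc k) = A k \<union> (\<lambda>x. x \<otimes>\<^bsub>H\<^esub> z) ` A k" using AA by blast
    have "central_involution K (A k) z"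
    proof (intro central_involution.intro integral_group_ring.intro central_involution_axioms.intro)
      show "group K" unfolding K_def by (rule H.subgroup_imp_group[OF sub])
      show "subgroup (A k) K" unfolding K_def by (rule H.subgroup_incl[OF sub sub AA])
      show "finite (A k)" using fin by (simp add: A_def)
      show "z \<in> carrier K" "z \<notin> A k" "z \<otimes>\<^bsub>K\<^esub> z = \<one>\<^bsub>K\<^esub>" using zA zn zz by (simp_all add: K_def)
      show "z \<otimes>\<^bsub>K\<^esub> x = x \<otimes>\<^bsub>K\<^esub> z" if "x \<in> carrier K" for x
        using that zx by (simp add: K_def A_def)
      show "carrier K = A k \<union> (\<lambda>x. x \<otimes>\<^bsub>K\<^esub> z) ` A k" using Aeq by (simp add: K_def)
    qed
    then interpret c: central_involution K "A k" z .
    have KA: "K\<lparr>carrier := A k\<rparr> = H\<lparr>carrier := A k\<rparr>" by (simp add: K_def)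
    show ?case
      using Suc.IH kn c.complement_lift c.torsion_lift unfolding P_def KA K_def[symmetric] by auto
  qed
  moreover have "H\<lparr>carrier := A n\<rparr> = H" by (simp add: A_def)
  ultimately show ?thesis unfolding P_def H_def by (metis order_refl)
qed

theorem proposition9p2:
  shows
    "(\<exists>N. internal_semidirect (unit_group D8) N (trivial_units D8) \<and>
          (unit_group D8)\<lparr>carrier := N\<rparr> \<cong> free_group {..<3::nat} \<and>
          (\<exists>S \<subseteq> bicyclic_units D8. N = generate (unit_group D8) S)) \<and>
     cong_unit_group D8 1 \<cong> free_group {..<9::nat} \<times>\<times> integer_mod_group 2 \<and>
     (\<forall>i\<ge>2. cong_unit_group D8 i \<cong> free_group {..<1 + 8 ^ i :: nat}) \<and>
     (\<forall>n::nat. \<exists>M. torsion_free_set (unit_group (D8 \<times>\<times> C2_power n)) M \<and>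
          internal_semidirect (unit_group (D8 \<times>\<times> C2_power n)) M
            (trivial_units (D8 \<times>\<times> C2_power n)))"
proof -
  obtain d where "dihedral8 D8 d" using D8_dihedral by blast
  then interpret D: dihedral8 D8 d .
  have "cong_unit_group D8 i \<cong> free_group {..<1 + 8 ^ i :: nat}" if "i \<ge> 2" for i
    using D.lift_cong_quads_free[of i] D.cong_units_lift[OF that] that by simp
  then show ?thesis
    using D.lift_cong_quads_0_complement D.lift_cong_quads_0_free D.lift_cong_quads_0_generated D.cong_units_1_free
      D8_C2_power_complement by blast
qed

end
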